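(* Let $d\ge 2$ be an integer. The space $\mathrm{M}_d(\mathbb{R})$ of real points of the moduli space $\mathrm{M}_d$ is connected and, if $d\ge 3$ is odd, the locus $\mathcal{P}_d\subset \mathrm{M}_d$ of equivalence classes of pseudo-real rational maps of degree $d$ is disconnected.
   Context: $\mathrm{Rat}_d$ is the space of complex rational maps of degree $d\ge 2$, identified (via coefficients) with the complement in $\mathbb{P}^{2d+1}(\mathbb{C})$ of the resultant hypersurface, with the induced topology. $\mathrm{PSL}_2(\mathbb{C})$ acts on it by $\phi\mapsto \phi^T=T\circ\phi\circ T^{-1}$, and $\mathrm{M}_d=\mathrm{Rat}_d/\mathrm{PSL}_2(\mathbb{C})$ with the quotient topology; two maps in the same orbit are called equivalent. An extended Möbius transformation is a map $Q=T\circ J$ with $T\in \mathrm{PSL}_2(\mathbb{C})$ and $J(z)=\overline z$; it is an antiholomorphic automorphism of $\phi$ if $Q\circ\phi\circ Q^{-1}=\phi$. The map $\phi\mapsto J\circ\phi\circ J$ induces an antiholomorphic involution $\widehat J$ of $\mathrm{M}_d$ (every extended Möbius transformation induces the same one), and $\mathrm{M}_d(\mathbb{R})$ is the set of fixed points of $\widehat J$. A reflection is an antiholomorphic involution of $\widehat{\mathbb{C}}$ with fixed points (a circle of fixed points). A rational map is pseudo-real if it admits antiholomorphic automorphisms but none of them is a reflection. *)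

theory Defs
  imports "HOL-Analysis.Analysis" "Subresultants.Resultant_Prelim"
begin

section \<open>Quotient topology\<close>

definition quotient_topology :: "'a topology \<Rightarrow> ('a \<Rightarrow> 'b) \<Rightarrow> 'b topology" where
  "quotient_topology X f =
     topology (\<lambda>U. U \<subseteq> f ` topspace X \<and> openin X {x \<in> topspace X. f x \<in> U})"

lemma openin_quotient_topology:
  "openin (quotient_topology X f) U \<longleftrightarrow>
     U \<subseteq> f ` topspace X \<and> openin X {x \<in> topspace X. f x \<in> U}"
proof -
  have "istopology (\<lambda>U. U \<subseteq> f ` topspace X \<and> openin X {x \<in> topspace X. f x \<in> U})"
    unfolding istopology_def
  proof (intro conjI allI impI)
    fix S T
    assume S: "S \<subseteq> f ` topspace X \<and> openin X {x \<in> topspace X. f x \<in> S}"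
      and T: "T \<subseteq> f ` topspace X \<and> openin X {x \<in> topspace X. f x \<in> T}"
    then show "S \<inter> T \<subseteq> f ` topspace X" by blast
    have "{x \<in> topspace X. f x \<in> S \<inter> T} =
        {x \<in> topspace X. f x \<in> S} \<inter> {x \<in> topspace X. f x \<in> T}" by blast
    then show "openin X {x \<in> topspace X. f x \<in> S \<inter> T}"
      using S T by auto
  next
    fix K
    assume K: "\<forall>S\<in>K. S \<subseteq> f ` topspace X \<and> openin X {x \<in> topspace X. f x \<in> S}"
    then show "\<Union> K \<subseteq> f ` topspace X" by blast
    have "{x \<in> topspace X. f x \<in> \<Union> K} = (\<Union>S\<in>K. {x \<in> topspace X. f x \<in> S})" by blast
    then show "openin X {x \<in> topspace X. f x \<in> \<Union> K}"
      using K by auto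
  qed
  then show ?thesis
    by (simp add: quotient_topology_def topology_inverse')
qed

lemma topspace_quotient_topology [simp]: "topspace (quotient_topology X f) = f ` topspace X"
proof
  show "topspace (quotient_topology X f) \<subseteq> f ` topspace X"
    using openin_quotient_topology[of X f "topspace (quotient_topology X f)"] by simp
  have "{x \<in> topspace X. f x \<in> f ` topspace X} = topspace X" by blast
  then have "openin (quotient_topology X f) (f ` topspace X)"
    by (simp add: openin_quotient_topology)
  then show "f ` topspace X \<subseteq> topspace (quotient_topology X f)"
    by (rule openin_subset)
qed

lemma quotient_map_quotient_topology: "quotient_map X (quotient_topology X f) f"
  unfolding quotient_map_def by (auto simp: openin_quotient_topology)


section \<open>Complex projective space\<close>

text \<open>A vector of \<open>\<complex>\<^sup>n\<^sup>+\<^sup>1\<close> is a sequence vanishing beyond index \<open>n\<close>; a point of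
  projective space is the set of all nonzero multiples of a nonzero vector.\<close>

definition nonzero_vectors :: "nat \<Rightarrow> (nat \<Rightarrow> complex) set" where
  "nonzero_vectors n = {v. (\<forall>i>n. v i = 0) \<and> (\<exists>i. v i \<noteq> 0)}"

definition proj_point :: "(nat \<Rightarrow> complex) \<Rightarrow> (nat \<Rightarrow> complex) set" where
  "proj_point v = {(\<lambda>i. c * v i) | c. c \<noteq> 0}"

definition proj_space :: "nat \<Rightarrow> (nat \<Rightarrow> complex) set topology" where
  "proj_space n = quotient_topology (top_of_set (nonzero_vectors n)) proj_point"


section \<open>Rational maps of degree d\<close>

text \<open>The Riemann sphere is \<open>complex option\<close>, with \<open>None\<close> as the point at infinity
  (the point set of \<open>Alexandroff_compactification euclidean\<close>).\<close>

type_synonym sphere = "complex option"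

text \<open>The map \<open>z \<mapsto> p z / q z\<close> of the sphere, where \<open>p\<close> and \<open>q\<close> are regarded as forms
  of degree \<open>n\<close>.  It is the intended map when these forms have no common zero.\<close>

fun quotient_fun :: "nat \<Rightarrow> complex poly \<Rightarrow> complex poly \<Rightarrow> sphere \<Rightarrow> sphere" where
  "quotient_fun n p q (Some z) = (if poly q z = 0 then None else Some (poly p z / poly q z))"
| "quotient_fun n p q None = (if coeff q n = 0 then None else Some (coeff p n / coeff q n))"

text \<open>The vector \<open>(a\<^sub>0, \<dots>, a\<^sub>d, b\<^sub>0, \<dots>, b\<^sub>d)\<close> of \<open>\<complex>\<^sup>2\<^sup>d\<^sup>+\<^sup>2\<close> holds the coefficients of
  \<open>(a\<^sub>0 + \<dots> + a\<^sub>d z\<^sup>d) / (b\<^sub>0 + \<dots> + b\<^sub>d z\<^sup>d)\<close>.\<close>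

definition numer :: "nat \<Rightarrow> (nat \<Rightarrow> complex) \<Rightarrow> complex poly" where
  "numer d v = (\<Sum>i\<le>d. monom (v i) i)"

definition denom :: "nat \<Rightarrow> (nat \<Rightarrow> complex) \<Rightarrow> complex poly" where
  "denom d v = (\<Sum>i\<le>d. monom (v (d + 1 + i)) i)"

definition coeff_map :: "nat \<Rightarrow> (nat \<Rightarrow> complex) \<Rightarrow> sphere \<Rightarrow> sphere" where
  "coeff_map d v = quotient_fun d (numer d v) (denom d v)"

text \<open>The resultant is that of forms of degree \<open>d\<close> (Sylvester matrix of size \<open>2 * d\<close>,
  whatever the actual degrees of the two polynomials), so it also vanishes when both
  coefficients of \<open>z\<^sup>d\<close> are zero.\<close>

definition resultant_hypersurface :: "nat \<Rightarrow> (nat \<Rightarrow> complex) set set" where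
  "resultant_hypersurface d =
     {proj_point v | v. v \<in> nonzero_vectors (2 * d + 1) \<and>
        resultant_sub d d (numer d v) (denom d v) = 0}"

text \<open>All representatives of a projective point induce the same map
  (see \<open>proj_map_proj_point\<close>).\<close>

definition proj_map :: "nat \<Rightarrow> (nat \<Rightarrow> complex) set \<Rightarrow> sphere \<Rightarrow> sphere" where
  "proj_map d L = the_elem (coeff_map d ` L)"

lemma numer_scale: "numer d (\<lambda>i. c * v i) = Polynomial.smult c (numer d v)"
  by (rule poly_eqI) (simp add: numer_def coeff_sum sum_distrib_left if_distrib cong: if_cong)

lemma denom_scale: "denom d (\<lambda>i. c * v i) = Polynomial.smult c (denom d v)"
  by (rule poly_eqI) (simp add: denom_def coeff_sum sum_distrib_left if_distrib cong: if_cong)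

lemma proj_map_proj_point: "proj_map d (proj_point v) = coeff_map d v"
proof -
  have "coeff_map d (\<lambda>i. c * v i) x = coeff_map d v x" if "c \<noteq> 0" for c x
    using that by (cases x) (simp_all add: coeff_map_def numer_scale denom_scale)
  then have "coeff_map d w = coeff_map d v" if "w \<in> proj_point v" for w
    using that by (auto simp: proj_point_def)
  moreover have "v \<in> proj_point v"
    unfolding proj_point_def by (intro CollectI exI[of _ 1]) simp
  ultimately have "coeff_map d ` proj_point v = {coeff_map d v}" by blast
  then show ?thesis by (simp add: proj_map_def)
qed

text \<open>The points of \<open>Rat_space d\<close> are maps of the sphere; its topology is carried over by the
  identification of such a map with the projective point of its coefficients.\<close>

definition Rat_space :: "nat \<Rightarrow> (sphere \<Rightarrow> sphere) topology" where
  "Rat_space d =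
     quotient_topology
       (subtopology (proj_space (2 * d + 1))
          (topspace (proj_space (2 * d + 1)) - resultant_hypersurface d))
       (proj_map d)"


section \<open>The moduli space and its real points\<close>

definition PSL2 :: "(sphere \<Rightarrow> sphere) set" where
  "PSL2 = {quotient_fun 1 [:b, a:] [:d, c:] | a b c d. a * d - b * c = 1}"

definition orbit :: "(sphere \<Rightarrow> sphere) \<Rightarrow> (sphere \<Rightarrow> sphere) set" where
  "orbit \<phi> = {T \<circ> \<phi> \<circ> Hilbert_Choice.inv T | T. T \<in> PSL2}"

definition moduli_space :: "nat \<Rightarrow> (sphere \<Rightarrow> sphere) set topology" where
  "moduli_space d = quotient_topology (Rat_space d) orbit"

definition J :: "sphere \<Rightarrow> sphere" where
  "J = map_option cnj"

definition J_hat :: "(sphere \<Rightarrow> sphere) set \<Rightarrow> (sphere \<Rightarrow> sphere) set" where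
  "J_hat C = (\<lambda>\<phi>. J \<circ> \<phi> \<circ> J) ` C"

definition real_points :: "nat \<Rightarrow> (sphere \<Rightarrow> sphere) set set" where
  "real_points d = {C \<in> topspace (moduli_space d). J_hat C = C}"


section \<open>Pseudo-real rational maps\<close>

definition extended_moebius :: "(sphere \<Rightarrow> sphere) set" where
  "extended_moebius = {T \<circ> J | T. T \<in> PSL2}"

definition antiholomorphic_automorphism :: "(sphere \<Rightarrow> sphere) \<Rightarrow> (sphere \<Rightarrow> sphere) \<Rightarrow> bool" where
  "antiholomorphic_automorphism \<phi> Q \<longleftrightarrow> Q \<in> extended_moebius \<and> Q \<circ> \<phi> \<circ> Hilbert_Choice.inv Q = \<phi>"

definition reflection :: "(sphere \<Rightarrow> sphere) \<Rightarrow> bool" where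
  "reflection Q \<longleftrightarrow> Q \<in> extended_moebius \<and> Q \<circ> Q = id \<and> (\<exists>x. Q x = x)"

definition pseudo_real :: "(sphere \<Rightarrow> sphere) \<Rightarrow> bool" where
  "pseudo_real \<phi> \<longleftrightarrow>
     (\<exists>Q. antiholomorphic_automorphism \<phi> Q) \<and>
     (\<forall>Q. antiholomorphic_automorphism \<phi> Q \<longrightarrow> \<not> reflection Q)"

definition pseudo_real_locus :: "nat \<Rightarrow> (sphere \<Rightarrow> sphere) set set" where
  "pseudo_real_locus d = {orbit \<phi> | \<phi>. \<phi> \<in> topspace (Rat_space d) \<and> pseudo_real \<phi>}"

text \<open>In particular, \<open>connectedin (moduli_space d) (pseudo_real_locus d)\<close> can fail only because
  the locus is disconnected as a subspace.\<close>

lemma pseudo_real_locus_subset: "pseudo_real_locus d \<subseteq> topspace (moduli_space d)"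
  by (auto simp: pseudo_real_locus_def moduli_space_def)

end

theory Submission
  imports Defs
    "HOL-Computational_Algebra.Fundamental_Theorem_Algebra"
    "HOL-Computational_Algebra.Field_as_Ring"
    "Jordan_Normal_Form.Char_Poly"
begin

text \<open>
The argument works with pairs of a rational map and an antiholomorphic automorphism of it: a class
is a real point exactly when some, hence every, representative commutes with some \<open>T \<circ> J\<close>
(\<open>real_pointI\<close>, \<open>real_pointD\<close>).

In homogeneous coordinates a map of degree \<open>d\<close> is a pair of forms of degree \<open>d\<close> without common
zero, which by the Sylvester matrix is the same as a nonzero resultant. The moduli space is
therefore a quotient of an open set of coefficient vectors (\<open>quotient_map_moduli\<close>): families with
continuous coefficients have connected images, and an invariant property defines a closed set as
soon as it passes to limits of coefficient sequences (\<open>connectedin_family\<close>, \<open>closedin_moduli\<close>).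

The analytic input is that conjugation is a proper action for \<open>d \<ge> 2\<close>: comparing the growth of the
two sides of \<open>\<phi> \<circ> M = M \<circ> \<psi>\<close> bounds the entries of the matrix \<open>M\<close> of determinant 1
(\<open>conjugating_matrix_bound\<close>), so conjugating matrices subconverge along convergent sequences of
maps (\<open>conjugating_maps_converge\<close>) and automorphism groups are bounded. Since the powers of an
automorphism stay bounded, one with a positive eigenvalue is trivial
(\<open>automorphism_positive_eigenvalue\<close>). As a consequence every antiholomorphic automorphism is
conjugate to \<open>z \<mapsto> c / cnj z\<close> with \<open>norm c = 1\<close> (\<open>antiholomorphic_normal_form\<close>).

Connectedness. Let the map commute with \<open>z \<mapsto> c / cnj z\<close>. Either it commutes with the reflection
\<open>z \<mapsto> 1 / cnj z\<close> and is a unimodular multiple of a quotient of finite Blaschke products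
(\<open>reflection_commuting_is_blaschke\<close>), or \<open>c ^ n = - 1\<close> for some \<open>n\<close> and the map is \<open>u F / G\<close> or
\<open>u G / F\<close> with \<open>F = z ^ m * \<Prod> (z ^ n - A)\<close> and \<open>G = \<Prod> (1 + cnj A * z ^ n)\<close>
(\<open>commuting_dichotomy\<close>, \<open>commuting_is_orb\<close>). In the second case the parameters \<open>A\<close> can be moved to
\<open>0\<close> one after the other, which ends at a power map, an instance of the first case (\<open>orb_linked\<close>).
The Blaschke quotients with \<open>j\<close> poles in the disc form a connected family, and paths of maps with
real coefficients lead from \<open>j\<close> to \<open>j + 2\<close>, from \<open>0\<close> to \<open>d\<close> and from \<open>0\<close> to \<open>d - 1\<close>; the resulting
graph on the values of \<open>j\<close> is connected (\<open>base_points_linked\<close>).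

Disconnectedness. Consider the classes of maps with an antiholomorphic involution among their
automorphisms, and the classes of maps with a holomorphic one. Both sets are closed by properness
(\<open>closed_anti_involution\<close>, \<open>closed_half_turn\<close>). They cover the pseudo-real locus: in normal form a
pseudo-real map has \<open>c ^ n = - 1\<close>, and the \<open>n\<close>-th iterate of \<open>z \<mapsto> c / cnj z\<close> is \<open>z \<mapsto> - 1 / cnj z\<close>
for odd \<open>n\<close> and \<open>z \<mapsto> - z\<close> for even \<open>n\<close> (\<open>pseudo_real_cover\<close>). They are disjoint on the locus: if
\<open>z \<mapsto> - 1 / cnj z\<close> and a half turn both commute with a map, their composition is \<open>A J\<close> with a
symmetric matrix \<open>A\<close>, its square \<open>A A*\<close> is positive definite and thus trivial, and so the
composition is a reflection (\<open>anti_involution_half_turn_reflection\<close>). Finally both sets meet the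
locus when \<open>d = 2 * k + 1\<close>: the maps \<open>\<i> z ^ (n + 1) (z ^ n - t) / (1 + t z ^ n)\<close> with \<open>n = k\<close> and
\<open>\<i> (1 + t z ^ n) / (z ^ (n - 1) (z ^ n - t))\<close> with \<open>n = k + 1\<close> have degree \<open>d\<close> and commute with
\<open>z \<mapsto> c / cnj z\<close> for \<open>c = cis (pi / n)\<close>, and exactly one of the two values of \<open>n\<close> is odd. For small
\<open>t\<close> they commute with no reflection (\<open>perturbed_power_no_reflection\<close>): by properness such
reflections would accumulate at an antiholomorphic automorphism for \<open>t = 0\<close>, which preserves \<open>0\<close>
and \<open>\<infinity>\<close> as a set; \<open>0\<close> and \<open>\<infinity>\<close> are attracting or superattracting for the second iterate, so the
reflections themselves preserve this set, and a direct computation excludes those.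
\<close>

section \<open>Homogeneous coordinates\<close>

text \<open>The value at \<open>(x, y)\<close> of the form of degree \<open>d\<close> that dehomogenises to \<open>P\<close>; the actual degree
  of \<open>P\<close> may be smaller, which encodes zeros at infinity.\<close>

definition hform :: "nat \<Rightarrow> complex poly \<Rightarrow> complex \<Rightarrow> complex \<Rightarrow> complex" where
  "hform d P x y = (\<Sum>i\<le>d. coeff P i * x ^ i * y ^ (d - i))"

text \<open>The point \<open>[x : y]\<close> of the sphere. The pair \<open>(0, 0)\<close> also yields \<open>\<infinity>\<close>, so most rules carry
  the hypothesis \<open>x \<noteq> 0 \<or> y \<noteq> 0\<close>.\<close>

definition hpt :: "complex \<Rightarrow> complex \<Rightarrow> sphere" where
  "hpt x y = (if y = 0 then None else Some (x / y))"

definition nondeg :: "nat \<Rightarrow> complex poly \<Rightarrow> complex poly \<Rightarrow> bool" where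
  "nondeg d P Q \<longleftrightarrow> degree P \<le> d \<and> degree Q \<le> d \<and>
     (\<forall>x y. hform d P x y = 0 \<and> hform d Q x y = 0 \<longrightarrow> x = 0 \<and> y = 0)"

text \<open>The fourth entry is called \<open>e\<close>, as \<open>d\<close> denotes the degree throughout.\<close>

definition mob :: "complex \<Rightarrow> complex \<Rightarrow> complex \<Rightarrow> complex \<Rightarrow> sphere \<Rightarrow> sphere" where
  "mob a b c e = quotient_fun 1 [:b, a:] [:e, c:]"

lemma hform_affine:
  assumes "degree P \<le> d" shows "hform d P z 1 = poly P z"
proof -
  have "poly P z = (\<Sum>i\<le>degree P. coeff P i * z ^ i)" by (rule poly_altdef)
  also have "\<dots> = (\<Sum>i\<le>d. coeff P i * z ^ i)"
    by (rule sum.mono_neutral_left) (use assms in \<open>auto simp: coeff_eq_0\<close>)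
  finally show ?thesis by (simp add: hform_def)
qed

lemma hform_scale: "hform d P (c * x) (c * y) = c ^ d * hform d P x y"
proof -
  have "c ^ i * c ^ (d - i) = c ^ d" if "i \<le> d" for i
    using that by (simp flip: power_add)
  then show ?thesis
    unfolding hform_def sum_distrib_left power_mult_distrib
    by (intro sum.cong) (auto simp: algebra_simps simp flip: power_add)
qed

lemma hform_infinity: "hform d P x 0 = coeff P d * x ^ d"
proof -
  have "hform d P x 0 = (\<Sum>i\<in>{d}. coeff P i * x ^ i * 0 ^ (d - i))"
    unfolding hform_def by (rule sum.mono_neutral_right) auto
  then show ?thesis by simp
qed

lemma hform_nonzero:
  assumes "degree P \<le> d" "y \<noteq> 0" shows "hform d P x y = y ^ d * poly P (x / y)"
  using hform_scale[of d P y "x / y" 1] assms by (simp add: hform_affine)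

lemma hform_add: "hform d (P + Q) x y = hform d P x y + hform d Q x y"
  by (simp add: hform_def sum.distrib algebra_simps)

lemma hform_smult: "hform d (Polynomial.smult c P) x y = c * hform d P x y"
  by (simp add: hform_def sum_distrib_left algebra_simps)

lemma hform_sum: "hform d (\<Sum>i\<in>A. P i) x y = (\<Sum>i\<in>A. hform d (P i) x y)"
  by (induction A rule: infinite_finite_induct) (auto simp: hform_add, simp_all add: hform_def)

lemma coeff_mult_top:
  fixes p q :: "complex poly"
  assumes "degree p \<le> m" "degree q \<le> n"
  shows "coeff (p * q) (m + n) = coeff p m * coeff q n"
proof -
  have "coeff (p * q) (m + n) = (\<Sum>i\<in>{m}. coeff p i * coeff q (m + n - i))"
    unfolding coeff_mult
  proof (rule sum.mono_neutral_right, goal_cases)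
    case 3
    show ?case
    proof
      fix i assume i: "i \<in> {..m + n} - {m}"
      show "coeff p i * coeff q (m + n - i) = 0"
      proof (cases "i > m")
        case True with assms show ?thesis by (simp add: coeff_eq_0)
      next
        case False with i assms have "degree q < m + n - i" by auto
        then show ?thesis by (simp add: coeff_eq_0)
      qed
    qed
  qed auto
  then show ?thesis by simp
qed

lemma hform_mult:
  assumes "degree p \<le> m" "degree q \<le> n"
  shows "hform (m + n) (p * q) x y = hform m p x y * hform n q x y"
proof (cases "y = 0")
  case True
  with assms show ?thesis by (simp add: hform_infinity coeff_mult_top power_add)
next
  case False
  have "degree (p * q) \<le> m + n" using degree_mult_le[of p q] assms by linarith
  with False assms show ?thesis by (simp add: hform_nonzero power_add)
qed

lemma hform_linear: "hform 1 [:a, b:] x y = a * y + b * x"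
  by (simp add: hform_def)

lemma degree_linear_power: "degree ([:a, b:] ^ n :: complex poly) \<le> n"
  using degree_power_le[of "[:a, b:]" n] by (auto intro: order_trans)

lemma hform_linear_power: "hform n ([:a, b:] ^ n) x y = (a * y + b * x) ^ n"
proof (induction n)
  case 0 show ?case by (simp add: hform_def)
next
  case (Suc n)
  have "hform (1 + n) ([:a, b:] * [:a, b:] ^ n) x y = (a * y + b * x) * (a * y + b * x) ^ n"
    by (subst hform_mult) (auto simp: degree_linear_power Suc hform_linear[unfolded One_nat_def])
  then show ?case by simp
qed

lemma hpt_cases:
  obtains x y where "s = hpt x y" "x \<noteq> 0 \<or> y \<noteq> 0"
proof (cases s)
  case None
  then have "s = hpt 1 0" by (simp add: hpt_def)
  then show ?thesis using that[of 1 0] by simp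
next
  case (Some z)
  then have "s = hpt z 1" by (simp add: hpt_def)
  then show ?thesis using that[of z 1] by simp
qed

lemma hpt_scale: "c \<noteq> 0 \<Longrightarrow> hpt (c * x) (c * y) = hpt x y"
  by (simp add: hpt_def)

lemma hpt_eq_iff:
  assumes "x \<noteq> 0 \<or> y \<noteq> 0" "x' \<noteq> 0 \<or> y' \<noteq> 0"
  shows "hpt x y = hpt x' y' \<longleftrightarrow> x * y' = x' * y"
  using assms by (auto simp: hpt_def field_simps)

lemma quotient_fun_hpt:
  assumes "degree P \<le> d" "degree Q \<le> d" "x \<noteq> 0 \<or> y \<noteq> 0"
  shows "quotient_fun d P Q (hpt x y) = hpt (hform d P x y) (hform d Q x y)"
proof (cases "y = 0")
  case True
  with assms show ?thesis by (simp add: hpt_def hform_infinity)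
next
  case False
  with assms show ?thesis by (simp add: hpt_def hform_nonzero)
qed

lemma mob_hpt:
  assumes "x \<noteq> 0 \<or> y \<noteq> 0"
  shows "mob a b c e (hpt x y) = hpt (a * x + b * y) (c * x + e * y)"
  using quotient_fun_hpt[of "[:b, a:]" 1 "[:e, c:]" x y] assms
  by (simp add: mob_def hform_linear[unfolded One_nat_def] add.commute)

lemma sphere_fun_eqI:
  assumes "\<And>x y. x \<noteq> 0 \<or> y \<noteq> 0 \<Longrightarrow> f (hpt x y) = g (hpt x y)"
  shows "f = (g :: sphere \<Rightarrow> 'a)"
proof
  fix s :: sphere
  obtain x y where "s = hpt x y" "x \<noteq> 0 \<or> y \<noteq> 0" by (rule hpt_cases)
  with assms show "f s = g s" by simp
qed

text \<open>The common zeros split into the finite ones and the one at infinity, where the forms take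
  the values of their top coefficients.\<close>

lemma nondeg_iff:
  "nondeg d P Q \<longleftrightarrow> degree P \<le> d \<and> degree Q \<le> d \<and>
     (\<forall>z. poly P z = 0 \<longrightarrow> poly Q z \<noteq> 0) \<and> (coeff P d \<noteq> 0 \<or> coeff Q d \<noteq> 0)"
proof (cases "degree P \<le> d \<and> degree Q \<le> d")
  case True
  then have deg: "degree P \<le> d" "degree Q \<le> d" by auto
  show ?thesis
  proof (intro iffI conjI allI impI; (elim conjE)?)
    assume n: "nondeg d P Q"
    show "poly Q z \<noteq> 0" if "poly P z = 0" for z
      using n that deg unfolding nondeg_def by (metis hform_affine zero_neq_one)
    show "coeff P d \<noteq> 0 \<or> coeff Q d \<noteq> 0"
      using n unfolding nondeg_def by (metis hform_infinity mult_zero_left zero_neq_one)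
  next
    assume a: "\<forall>z. poly P z = 0 \<longrightarrow> poly Q z \<noteq> 0" "coeff P d \<noteq> 0 \<or> coeff Q d \<noteq> 0"
    show "nondeg d P Q" unfolding nondeg_def
    proof (intro conjI allI impI deg)
      fix x y assume h: "hform d P x y = 0 \<and> hform d Q x y = 0"
      show y: "y = 0"
      proof (rule ccontr)
        assume "y \<noteq> 0"
        with h deg have "poly P (x / y) = 0" "poly Q (x / y) = 0" by (simp_all add: hform_nonzero)
        with a(1) show False by blast
      qed
      show "x = 0" using h a(2) y by (auto simp: hform_infinity)
    qed
  qed (use deg in auto)
qed (auto simp: nondeg_def)

lemma nondeg_degree: "nondeg d P Q \<Longrightarrow> degree P \<le> d" "nondeg d P Q \<Longrightarrow> degree Q \<le> d"
  by (auto simp: nondeg_def)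

lemma nondeg_hform:
  "nondeg d P Q \<Longrightarrow> x \<noteq> 0 \<or> y \<noteq> 0 \<Longrightarrow> hform d P x y \<noteq> 0 \<or> hform d Q x y \<noteq> 0"
  unfolding nondeg_def by blast

lemma nondeg_swap: "nondeg d P Q \<Longrightarrow> nondeg d Q P"
  unfolding nondeg_def by blast

lemma nondeg_coprime:
  assumes "nondeg d P Q" shows "coprime P Q"
proof (rule ccontr)
  assume "\<not> coprime P Q"
  then obtain g where g: "g dvd P" "g dvd Q" "\<not> is_unit g" by (rule not_coprimeE)
  have "P \<noteq> 0 \<or> Q \<noteq> 0" using assms by (auto simp: nondeg_iff)
  with g have "g \<noteq> 0" by auto
  with g(3) have "degree g \<noteq> 0" by (simp add: is_unit_iff_degree)
  then have "\<exists>z. poly g z = 0"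
    using fundamental_theorem_of_algebra[of g] constant_degree[of g] by auto
  then show False using g assms by (auto simp: nondeg_iff elim!: dvdE)
qed

text \<open>Equality of the two maps means \<open>P Q' = P' Q\<close>, and coprimality then makes the numerators, and
  the denominators, divide each other. The case where one of \<open>P\<close>, \<open>Q\<close> vanishes is excluded by
  \<open>d \<ge> 1\<close>.\<close>

lemma quotient_fun_eq_imp_proportional:
  assumes n: "nondeg d P Q" and n': "nondeg d P' Q'" and "d \<ge> 1"
    and eq: "quotient_fun d P Q = quotient_fun d P' Q'"
  shows "\<exists>c. c \<noteq> 0 \<and> P' = Polynomial.smult c P \<and> Q' = Polynomial.smult c Q"
proof -
  have "poly (P * Q') z = poly (P' * Q) z" for z
    using fun_cong[OF eq, of "Some z"] n n'
    by (auto simp: nondeg_iff divide_simps split: if_splits)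
  then have cross: "P * Q' = P' * Q" by (simp add: poly_eq_poly_eq_iff[symmetric] fun_eq_iff)
  have "P dvd P' * Q" unfolding cross[symmetric] by (rule dvd_triv_left)
  moreover have "P' dvd P * Q'" unfolding cross by (rule dvd_triv_left)
  ultimately have d1: "P dvd P'" "P' dvd P"
    using nondeg_coprime[OF n] nondeg_coprime[OF n']
      coprime_dvd_mult_left_iff[of P Q P'] coprime_dvd_mult_left_iff[of P' Q' P] by blast+
  have cross': "Q * P' = Q' * P" using cross by (simp add: mult.commute)
  have "Q dvd Q' * P" unfolding cross'[symmetric] by (rule dvd_triv_left)
  moreover have "Q' dvd Q * P'" unfolding cross' by (rule dvd_triv_left)
  moreover have "coprime Q P" "coprime Q' P'"
    using nondeg_coprime[OF n] nondeg_coprime[OF n'] by (simp_all add: coprime_commute)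
  ultimately have d2: "Q dvd Q'" "Q' dvd Q"
    using coprime_dvd_mult_left_iff[of Q P Q'] coprime_dvd_mult_left_iff[of Q' P' Q] by blast+
  have scal: "\<exists>c. c \<noteq> 0 \<and> B = Polynomial.smult c A" if "A dvd B" "B dvd A" for A B :: "complex poly"
  proof (cases "A = 0")
    case True with that show ?thesis by (intro exI[of _ 1]) auto
  next
    case False
    with that have "B \<noteq> 0" by auto
    from that(1) obtain k where k: "B = A * k" by (rule dvdE)
    with False that \<open>B \<noteq> 0\<close> have "degree A = degree B"
      by (metis dvd_imp_degree_le le_antisym)
    with k False \<open>B \<noteq> 0\<close> have "degree k = 0" by (auto simp: degree_mult_eq)
    then obtain c where "k = [:c:]" by (metis degree_eq_zeroE)
    with k \<open>B \<noteq> 0\<close> show ?thesis by (intro exI[of _ c]) (auto simp: mult.commute)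
  qed
  obtain c where c: "c \<noteq> 0" "P' = Polynomial.smult c P" using scal[OF d1] by auto
  obtain e where e: "e \<noteq> 0" "Q' = Polynomial.smult e Q" using scal[OF d2] by auto
  have "P \<noteq> 0 \<and> Q \<noteq> 0"
  proof (rule ccontr)
    assume "\<not> (P \<noteq> 0 \<and> Q \<noteq> 0)"
    then have z: "P = 0 \<or> Q = 0" by auto
    then have "\<forall>z. poly (P + Q) z \<noteq> 0" using n by (auto simp: nondeg_iff)
    then have "constant (poly (P + Q))" using fundamental_theorem_of_algebra by blast
    then have "degree (P + Q) = 0" by (simp add: constant_degree)
    then have "coeff (P + Q) d = 0" using \<open>d \<ge> 1\<close> by (intro coeff_eq_0) auto
    with z n show False by (auto simp: nondeg_iff)
  qed
  moreover have "Polynomial.smult (e - c) (P * Q) = 0" using cross c e by (simp add: smult_diff_left)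
  ultimately have "e = c" by (auto simp: smult_eq_0_iff)
  with c e show ?thesis by auto
qed

lemma linear_nonzero:
  fixes a b c e x y :: complex
  assumes "a * e - b * c \<noteq> 0" "x \<noteq> 0 \<or> y \<noteq> 0"
  shows "a * x + b * y \<noteq> 0 \<or> c * x + e * y \<noteq> 0"
proof (rule ccontr)
  assume "\<not> ?thesis"
  then have 0: "a * x + b * y = 0" "c * x + e * y = 0" by auto
  have "(a * e - b * c) * x = e * (a * x + b * y) - b * (c * x + e * y)"
    "(a * e - b * c) * y = a * (c * x + e * y) - c * (a * x + b * y)" by (simp_all add: algebra_simps)
  with 0 assms show False by auto
qed

lemma nondeg_precompose:
  assumes n: "nondeg d P Q" and det: "a * e - b * c \<noteq> 0"
  obtains P' Q' where "nondeg d P' Q'"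
    "\<And>x y. hform d P' x y = hform d P (a * x + b * y) (c * x + e * y)"
    "\<And>x y. hform d Q' x y = hform d Q (a * x + b * y) (c * x + e * y)"
proof -
  define sub where "sub R = (\<Sum>i\<le>d. Polynomial.smult (coeff R i) ([:b, a:] ^ i * [:e, c:] ^ (d - i)))"
    for R :: "complex poly"
  have deg1: "degree ([:b, a:] ^ i * [:e, c:] ^ (d - i)) \<le> d" if "i \<le> d" for i
    using degree_mult_le[of "[:b, a:] ^ i" "[:e, c:] ^ (d - i)"]
      degree_linear_power[of b a i] degree_linear_power[of e c "d - i"] that by linarith
  have deg: "degree (sub R) \<le> d" for R
    unfolding sub_def by (rule degree_sum_le) (auto intro: order_trans[OF degree_smult_le] deg1)
  have val: "hform d (sub R) x y = hform d R (a * x + b * y) (c * x + e * y)" for R x y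
  proof -
    have "hform d ([:b, a:] ^ i * [:e, c:] ^ (d - i)) x y
        = (a * x + b * y) ^ i * (c * x + e * y) ^ (d - i)" if "i \<le> d" for i
      using hform_mult[of "[:b, a:] ^ i" i "[:e, c:] ^ (d - i)" "d - i" x y] that
      by (simp add: degree_linear_power hform_linear_power add.commute)
    then show ?thesis
      unfolding sub_def hform_sum hform_smult hform_def[of d R] by (simp add: mult.assoc)
  qed
  have "nondeg d (sub P) (sub Q)"
    unfolding nondeg_def val using deg nondeg_hform[OF n] linear_nonzero[OF det] by blast
  with val that show ?thesis by blast
qed

lemma nondeg_postcompose:
  assumes n: "nondeg d P Q" and det: "a * e - b * c \<noteq> 0"
  shows "nondeg d (Polynomial.smult a P + Polynomial.smult b Q) (Polynomial.smult c P + Polynomial.smult e Q)"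
  unfolding nondeg_def hform_add hform_smult
  using nondeg_degree[OF n] nondeg_hform[OF n] linear_nonzero[OF det]
  by (blast intro: degree_add_le order_trans[OF degree_smult_le])

text \<open>A semiconjugacy of maps is an identity of pairs of forms up to one scalar, because the two
  pairs define the same map.\<close>

lemma equivariance_factor:
  assumes n: "nondeg d P Q" and n': "nondeg d R S" and "d \<ge> 1" and det: "a * e - b * c \<noteq> 0"
    and eq: "quotient_fun d P Q \<circ> mob a b c e = mob a b c e \<circ> quotient_fun d R S"
  obtains \<mu> where "\<mu> \<noteq> 0"
    "\<And>x y. hform d P (a * x + b * y) (c * x + e * y) = \<mu> * (a * hform d R x y + b * hform d S x y)"
    "\<And>x y. hform d Q (a * x + b * y) (c * x + e * y) = \<mu> * (c * hform d R x y + e * hform d S x y)"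
proof -
  obtain P' Q' where p: "nondeg d P' Q'"
    "\<And>x y. hform d P' x y = hform d P (a * x + b * y) (c * x + e * y)"
    "\<And>x y. hform d Q' x y = hform d Q (a * x + b * y) (c * x + e * y)"
    using nondeg_precompose[OF n det] by blast
  define R' where "R' = Polynomial.smult a R + Polynomial.smult b S"
  define S' where "S' = Polynomial.smult c R + Polynomial.smult e S"
  have r: "nondeg d R' S'" unfolding R'_def S'_def by (rule nondeg_postcompose[OF n' det])
  have "quotient_fun d R' S' = quotient_fun d P' Q'"
  proof (rule sphere_fun_eqI)
    fix x y :: complex assume xy: "x \<noteq> 0 \<or> y \<noteq> 0"
    show "quotient_fun d R' S' (hpt x y) = quotient_fun d P' Q' (hpt x y)"
      using fun_cong[OF eq, of "hpt x y"] xy linear_nonzero[OF det xy] nondeg_hform[OF n' xy]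
      by (simp add: quotient_fun_hpt mob_hpt nondeg_degree[OF n] nondeg_degree[OF n'] nondeg_degree[OF p(1)]
          nondeg_degree[OF r] p(2,3)) (simp add: R'_def S'_def hform_add hform_smult)
  qed
  from quotient_fun_eq_imp_proportional[OF r p(1) \<open>d \<ge> 1\<close> this]
  obtain \<mu> where m: "\<mu> \<noteq> 0" "P' = Polynomial.smult \<mu> R'" "Q' = Polynomial.smult \<mu> S'" by auto
  show ?thesis
    by (rule that[OF m(1)]) (simp_all add: p(2,3)[symmetric] m(2,3) hform_smult R'_def S'_def hform_add)
qed

section \<open>Moebius transformations, conjugation and orbits\<close>

lemma mob_comp:
  assumes "a' * e' - b' * c' \<noteq> 0"
  shows "mob a b c e \<circ> mob a' b' c' e' = mob (a * a' + b * c') (a * b' + b * e') (c * a' + e * c') (c * b' + e * e')"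
proof (rule sphere_fun_eqI)
  fix x y :: complex assume xy: "x \<noteq> 0 \<or> y \<noteq> 0"
  show "(mob a b c e \<circ> mob a' b' c' e') (hpt x y)
    = mob (a * a' + b * c') (a * b' + b * e') (c * a' + e * c') (c * b' + e * e') (hpt x y)"
    using linear_nonzero[OF assms xy] xy by (simp add: mob_hpt algebra_simps)
qed

lemma mob_scale: "k \<noteq> 0 \<Longrightarrow> mob (k * a) (k * b) (k * c) (k * e) = mob a b c e"
  by (rule sphere_fun_eqI) (simp add: mob_hpt mult.assoc hpt_scale flip: distrib_left)

lemma mob_id: "k \<noteq> 0 \<Longrightarrow> mob k 0 0 k = id"
  by (rule sphere_fun_eqI) (simp add: mob_hpt hpt_scale)

lemma PSL2_iff: "T \<in> PSL2 \<longleftrightarrow> (\<exists>a b c e. a * e - b * c = 1 \<and> T = mob a b c e)"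
  by (auto simp: PSL2_def mob_def)

lemma mob_in_PSL2:
  assumes "a * e - b * c \<noteq> 0" shows "mob a b c e \<in> PSL2"
proof -
  define k where "k = inverse (csqrt (a * e - b * c))"
  have k: "k \<noteq> 0" using assms by (simp add: k_def)
  have "k * a * (k * e) - k * b * (k * c) = (a * e - b * c) * inverse (csqrt (a * e - b * c) ^ 2)"
    by (simp add: k_def power2_eq_square algebra_simps)
  also have "\<dots> = 1" using assms by simp
  finally show ?thesis using mob_scale[OF k, of a b c e] unfolding PSL2_iff by metis
qed

lemma mob_inverse:
  assumes "a * e - b * c \<noteq> 0"
  shows "mob e (- b) (- c) a \<circ> mob a b c e = id" "mob a b c e \<circ> mob e (- b) (- c) a = id"
proof -
  have eq: "e * a + - b * c = a * e - b * c" "e * b + - b * e = 0" "- c * a + a * c = 0" "- c * b + a * e = a * e - b * c"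
    "a * e + b * - c = a * e - b * c" "a * - b + b * a = 0" "c * e + e * - c = 0" "c * - b + e * a = a * e - b * c"
    by (simp_all add: algebra_simps)
  have det': "e * a - - b * - c \<noteq> 0" using assms by (simp add: mult.commute)
  show "mob e (- b) (- c) a \<circ> mob a b c e = id"
    by (subst mob_comp[OF assms], unfold eq(1-4)) (rule mob_id[OF assms])
  show "mob a b c e \<circ> mob e (- b) (- c) a = id"
    by (subst mob_comp[OF det'], unfold eq(5-8)) (rule mob_id[OF assms])
qed

lemma mob_bij: "a * e - b * c \<noteq> 0 \<Longrightarrow> bij (mob a b c e)"
  by (rule o_bij[OF mob_inverse(1) mob_inverse(2)])

lemma inv_mob: "a * e - b * c \<noteq> 0 \<Longrightarrow> Hilbert_Choice.inv (mob a b c e) = mob e (- b) (- c) a"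
  by (rule inv_unique_comp[OF mob_inverse(2) mob_inverse(1)])

lemma PSL2_bij: "T \<in> PSL2 \<Longrightarrow> bij T"
  by (auto simp: PSL2_iff intro!: mob_bij)

lemma PSL2_inv: "T \<in> PSL2 \<Longrightarrow> Hilbert_Choice.inv T \<in> PSL2"
  by (auto simp: PSL2_iff[of T] inv_mob intro!: mob_in_PSL2) (simp add: mult.commute)

lemma PSL2_comp: "S \<in> PSL2 \<Longrightarrow> T \<in> PSL2 \<Longrightarrow> S \<circ> T \<in> PSL2"
proof -
  assume "S \<in> PSL2" "T \<in> PSL2"
  then obtain a b c e a' b' c' e' where *: "a * e - b * c = 1" "S = mob a b c e"
    "a' * e' - b' * c' = 1" "T = mob a' b' c' e'" unfolding PSL2_iff by metis
  have "(a * a' + b * c') * (c * b' + e * e') - (a * b' + b * e') * (c * a' + e * c')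
      = (a * e - b * c) * (a' * e' - b' * c')" by (simp add: algebra_simps)
  then show ?thesis unfolding *(2,4) using *(1,3) by (subst mob_comp) (auto intro!: mob_in_PSL2)
qed

lemma PSL2_id: "id \<in> PSL2"
  using mob_in_PSL2[of 1 1 0 0] mob_id[of 1] by simp

definition cpoly :: "complex poly \<Rightarrow> complex poly" where
  "cpoly P = map_poly cnj P"

lemma coeff_cpoly [simp]: "coeff (cpoly P) i = cnj (coeff P i)"
  by (simp add: cpoly_def coeff_map_poly)

lemma degree_cpoly: "degree P \<le> d \<Longrightarrow> degree (cpoly P) \<le> d"
  by (intro degree_le) (auto simp: coeff_eq_0)

lemma hform_cpoly: "hform d (cpoly P) x y = cnj (hform d P (cnj x) (cnj y))"
  by (simp add: hform_def)

lemma nondeg_cpoly: "nondeg d P Q \<Longrightarrow> nondeg d (cpoly P) (cpoly Q)"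
  unfolding nondeg_def hform_cpoly
  using degree_cpoly complex_cnj_zero_iff by metis

lemma J_hpt: "J (hpt x y) = hpt (cnj x) (cnj y)"
  by (simp add: J_def hpt_def)

lemma J_J: "J \<circ> J = id"
  by (rule sphere_fun_eqI) (simp add: J_hpt)

lemma J_J_apply: "J (J s) = s"
  using fun_cong[OF J_J] by simp

lemma J_bij: "bij J" by (rule o_bij[OF J_J J_J])

lemma J_mob: "J \<circ> mob a b c e \<circ> J = mob (cnj a) (cnj b) (cnj c) (cnj e)"
  by (rule sphere_fun_eqI) (simp add: J_hpt mob_hpt)

lemma J_quotient_fun:
  assumes "nondeg d P Q"
  shows "J \<circ> quotient_fun d P Q \<circ> J = quotient_fun d (cpoly P) (cpoly Q)"
  by (rule sphere_fun_eqI)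
    (simp add: J_hpt quotient_fun_hpt nondeg_degree[OF assms] nondeg_degree[OF nondeg_cpoly[OF assms]] hform_cpoly)

lemma PSL2_J: "T \<in> PSL2 \<Longrightarrow> J \<circ> T \<circ> J \<in> PSL2"
proof -
  assume "T \<in> PSL2"
  then obtain a b c e where *: "a * e - b * c = 1" "T = mob a b c e" unfolding PSL2_iff by metis
  have "cnj a * cnj e - cnj b * cnj c = 1"
    using arg_cong[OF *(1), of cnj] by simp
  then show ?thesis unfolding *(2) J_mob by (intro mob_in_PSL2) simp
qed

lemma orbit_conj:
  assumes T: "T \<in> PSL2" shows "orbit (T \<circ> \<phi> \<circ> Hilbert_Choice.inv T) = orbit \<phi>"
proof -
  note bT = PSL2_bij[OF T]
  have inv_comp: "Hilbert_Choice.inv (S \<circ> T) = Hilbert_Choice.inv T \<circ> Hilbert_Choice.inv S" if "S \<in> PSL2" for S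
    using o_inv_distrib[OF PSL2_bij[OF that] bT] .
  have "S \<circ> (T \<circ> \<phi> \<circ> Hilbert_Choice.inv T) \<circ> Hilbert_Choice.inv S \<in> orbit \<phi>" if "S \<in> PSL2" for S
    unfolding orbit_def mem_Collect_eq
    by (rule exI[of _ "S \<circ> T"]) (simp add: inv_comp that PSL2_comp T comp_assoc)
  moreover have "S \<circ> \<phi> \<circ> Hilbert_Choice.inv S \<in> orbit (T \<circ> \<phi> \<circ> Hilbert_Choice.inv T)" if S: "S \<in> PSL2" for S
  proof -
    define R where "R = S \<circ> Hilbert_Choice.inv T"
    have R: "R \<in> PSL2" unfolding R_def by (intro PSL2_comp S PSL2_inv T)
    have "Hilbert_Choice.inv R = T \<circ> Hilbert_Choice.inv S"
      unfolding R_def by (subst o_inv_distrib[OF PSL2_bij[OF S] bij_imp_bij_inv[OF bT]]) (simp add: inv_inv_eq bT)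
    moreover have "Hilbert_Choice.inv T \<circ> T = id" using bT by (simp add: bij_is_inj)
    ultimately have "S \<circ> \<phi> \<circ> Hilbert_Choice.inv S = R \<circ> (T \<circ> \<phi> \<circ> Hilbert_Choice.inv T) \<circ> Hilbert_Choice.inv R"
      unfolding R_def by (simp add: fun_eq_iff)
    with R show ?thesis unfolding orbit_def by blast
  qed
  ultimately show ?thesis by (fastforce simp: orbit_def)
qed

lemma self_in_orbit: "\<phi> \<in> orbit \<phi>"
  unfolding orbit_def using PSL2_id by (auto intro!: exI[of _ id])

lemma orbit_eqD: "orbit \<phi> = orbit \<psi> \<Longrightarrow> \<exists>T\<in>PSL2. \<psi> = T \<circ> \<phi> \<circ> Hilbert_Choice.inv T"
  using self_in_orbit[of \<psi>] by (auto simp: orbit_def)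

definition is_rat :: "nat \<Rightarrow> (sphere \<Rightarrow> sphere) \<Rightarrow> bool" where
  "is_rat d \<phi> \<longleftrightarrow> (\<exists>P Q. nondeg d P Q \<and> \<phi> = quotient_fun d P Q)"

lemma is_ratI: "nondeg d P Q \<Longrightarrow> is_rat d (quotient_fun d P Q)"
  by (auto simp: is_rat_def)

lemma is_rat_conj:
  assumes "is_rat d \<phi>" "T \<in> PSL2" shows "is_rat d (T \<circ> \<phi> \<circ> Hilbert_Choice.inv T)"
proof -
  obtain P Q where n: "nondeg d P Q" and \<phi>: "\<phi> = quotient_fun d P Q" using assms(1) by (auto simp: is_rat_def)
  obtain a b c e where T: "a * e - b * c = 1" "T = mob a b c e" using assms(2) unfolding PSL2_iff by metis
  then have det: "a * e - b * c \<noteq> 0" and det': "e * a - (- b) * (- c) \<noteq> 0" by (auto simp: mult.commute)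
  obtain P' Q' where p: "nondeg d P' Q'"
    "\<And>x y. hform d P' x y = hform d P (e * x + (- b) * y) ((- c) * x + a * y)"
    "\<And>x y. hform d Q' x y = hform d Q (e * x + (- b) * y) ((- c) * x + a * y)"
    using nondeg_precompose[OF n det'] by blast
  let ?P = "Polynomial.smult a P' + Polynomial.smult b Q'" and ?Q = "Polynomial.smult c P' + Polynomial.smult e Q'"
  have n': "nondeg d ?P ?Q" by (rule nondeg_postcompose[OF p(1) det])
  have "T \<circ> \<phi> \<circ> Hilbert_Choice.inv T = quotient_fun d ?P ?Q"
  proof (rule sphere_fun_eqI)
    fix x y :: complex assume xy: "x \<noteq> 0 \<or> y \<noteq> 0"
    note nz = linear_nonzero[OF det' xy]
    show "(T \<circ> \<phi> \<circ> Hilbert_Choice.inv T) (hpt x y) = quotient_fun d ?P ?Q (hpt x y)"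
      unfolding \<phi> T(2) inv_mob[OF det] comp_def mob_hpt[OF xy]
        quotient_fun_hpt[OF nondeg_degree[OF n] nz] mob_hpt[OF nondeg_hform[OF n nz]]
        quotient_fun_hpt[OF nondeg_degree[OF n'] xy] hform_add hform_smult p(2,3) ..
  qed
  with n' show ?thesis by (auto simp: is_rat_def)
qed

section \<open>The resultant\<close>

text \<open>The Sylvester matrix, applied to the vector of monomials of degree \<open>2 * d - 1\<close>, lists the
  products of the two forms with the monomials of degree \<open>d - 1\<close>.\<close>

lemma sylvester_row:
  assumes "i < 2 * d"
  shows "(\<Sum>j<2*d. sylvester_mat_sub d d P Q $$ (i, j) * x ^ (2 * d - 1 - j) * y ^ j) =
    (if i < d then x ^ (d - 1 - i) * y ^ i * hform d P x y else x ^ (2 * d - 1 - i) * y ^ (i - d) * hform d Q x y)"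
proof -
  have row: "(\<Sum>j<2*d. (if k \<le> j \<and> j \<le> k + d then coeff R (k + d - j) else 0) * x ^ (2 * d - 1 - j) * y ^ j) =
     x ^ (d - 1 - k) * y ^ k * hform d R x y" if "k < d" for k and R :: "complex poly"
  proof -
    have "(\<Sum>j<2*d. (if k \<le> j \<and> j \<le> k + d then coeff R (k + d - j) else 0) * x ^ (2 * d - 1 - j) * y ^ j)
        = (\<Sum>j\<in>{k..k+d}. coeff R (k + d - j) * x ^ (2 * d - 1 - j) * y ^ j)"
      using that by (intro sum.mono_neutral_cong_right) auto
    also have "\<dots> = (\<Sum>m\<in>{..d}. coeff R m * x ^ (2 * d - 1 - (k + d - m)) * y ^ (k + d - m))"
      by (rule sum.reindex_bij_witness[of _ "\<lambda>m. k + d - m" "\<lambda>j. k + d - j"]) auto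
    also have "\<dots> = (\<Sum>m\<in>{..d}. x ^ (d - 1 - k) * y ^ k * (coeff R m * x ^ m * y ^ (d - m)))"
    proof (rule sum.cong)
      fix m assume "m \<in> {..d}"
      then have e: "2 * d - 1 - (k + d - m) = (d - 1 - k) + m" "k + d - m = k + (d - m)" using that by auto
      show "coeff R m * x ^ (2 * d - 1 - (k + d - m)) * y ^ (k + d - m)
        = x ^ (d - 1 - k) * y ^ k * (coeff R m * x ^ m * y ^ (d - m))"
        unfolding e(1) unfolding e(2) power_add by (simp only: mult.assoc mult.commute mult.left_commute)
    qed simp
    finally show ?thesis by (simp add: hform_def sum_distrib_left)
  qed
  show ?thesis
  proof (cases "i < d")
    case True
    have "(\<Sum>j<2*d. sylvester_mat_sub d d P Q $$ (i, j) * x ^ (2 * d - 1 - j) * y ^ j) =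
      (\<Sum>j<2*d. (if i \<le> j \<and> j \<le> i + d then coeff P (i + d - j) else 0) * x ^ (2 * d - 1 - j) * y ^ j)"
      using True by (intro sum.cong) (auto simp: sylvester_mat_sub_index add.commute)
    then show ?thesis using row[of i P] True by simp
  next
    case False
    have "(\<Sum>j<2*d. sylvester_mat_sub d d P Q $$ (i, j) * x ^ (2 * d - 1 - j) * y ^ j) =
      (\<Sum>j<2*d. (if i - d \<le> j \<and> j \<le> (i - d) + d then coeff Q ((i - d) + d - j) else 0) * x ^ (2 * d - 1 - j) * y ^ j)"
      using False assms by (intro sum.cong) (auto simp: sylvester_mat_sub_index)
    moreover have "d - 1 - (i - d) = 2 * d - 1 - i" using False assms by auto
    ultimately show ?thesis using row[of "i - d" Q] False assms by simp
  qed
qed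

text \<open>At a common zero the vector of monomials is a kernel vector of the Sylvester matrix.\<close>

lemma resultant_nonzero_imp_nondeg:
  assumes "d \<ge> 1" "degree P \<le> d" "degree Q \<le> d" and r: "resultant_sub d d P Q \<noteq> 0"
  shows "nondeg d P Q"
proof (rule ccontr)
  assume "\<not> nondeg d P Q"
  then obtain x y where xy: "hform d P x y = 0" "hform d Q x y = 0" "x \<noteq> 0 \<or> y \<noteq> 0"
    using assms(2,3) unfolding nondeg_def by blast
  let ?S = "sylvester_mat_sub d d P Q"
  define v where "v = vec (2 * d) (\<lambda>j. x ^ (2 * d - 1 - j) * y ^ j)"
  have S: "?S \<in> carrier_mat (2 * d) (2 * d)" using sylvester_mat_sub_carrier[of d d] by (simp add: mult_2)
  have v: "v \<in> carrier_vec (2 * d)" by (simp add: v_def)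
  have "v \<noteq> 0\<^sub>v (2 * d)"
  proof
    assume v0: "v = 0\<^sub>v (2 * d)"
    have "v $ 0 = 0" "v $ (2 * d - 1) = 0" unfolding v0 using assms(1) by auto
    then show False using assms(1) xy(3) by (auto simp: v_def)
  qed
  moreover have "?S *\<^sub>v v = 0\<^sub>v (2 * d)"
  proof (rule eq_vecI)
    fix i assume "i < dim_vec (0\<^sub>v (2 * d) :: complex vec)"
    then have i: "i < 2 * d" by simp
    have "(?S *\<^sub>v v) $ i = (\<Sum>j<2*d. ?S $$ (i, j) * x ^ (2 * d - 1 - j) * y ^ j)"
      using i S by (auto simp: scalar_prod_def v_def lessThan_atLeast0 mult.assoc intro!: sum.cong)
    then show "(?S *\<^sub>v v) $ i = 0\<^sub>v (2 * d) $ i" using sylvester_row[OF i, of P Q x y] xy i by simp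
  qed (use S in auto)
  ultimately have "det ?S = 0" using det_0_iff_vec_prod_zero[OF S] v by blast
  with r show False by (simp add: resultant_sub_def)
qed

text \<open>A kernel vector of the transposed Sylvester matrix is a relation \<open>A P + B Q = 0\<close> with \<open>A\<close>
  and \<open>B\<close> of degree less than \<open>d\<close>; coprimality and the nonvanishing of a top coefficient force it
  to be trivial.\<close>

lemma nondeg_imp_resultant_nonzero:
  assumes "d \<ge> 1" and n: "nondeg d P Q"
  shows "resultant_sub d d P Q \<noteq> 0"
proof
  assume r: "resultant_sub d d P Q = 0"
  let ?S = "sylvester_mat_sub d d P Q"
  have S: "?S \<in> carrier_mat (2 * d) (2 * d)" using sylvester_mat_sub_carrier[of d d] by (simp add: mult_2)
  have "det (transpose_mat ?S) = 0" using r det_transpose[OF S] by (simp add: resultant_sub_def)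
  then obtain w where w: "w \<in> carrier_vec (2 * d)" "w \<noteq> 0\<^sub>v (2 * d)" "transpose_mat ?S *\<^sub>v w = 0\<^sub>v (2 * d)"
    using det_0_iff_vec_prod_zero[of "transpose_mat ?S" "2 * d"] S by auto
  define A where "A = (\<Sum>i<d. monom (w $ i) (d - 1 - i))"
  define B where "B = (\<Sum>i<d. monom (w $ (d + i)) (d - 1 - i))"
  have coeffs: "coeff (\<Sum>i<d. monom (f i) (d - 1 - i)) (d - 1 - k) = f k" if "k < d" for f :: "nat \<Rightarrow> complex" and k
  proof -
    have "coeff (\<Sum>i<d. monom (f i) (d - 1 - i)) (d - 1 - k) = (\<Sum>i<d. if i = k then f i else 0)"
      unfolding coeff_sum using that by (intro sum.cong) (auto simp: coeff_monom)
    then show ?thesis using that by simp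
  qed
  have degs: "degree (\<Sum>i<d. monom (f i) (d - 1 - i)) < d" for f :: "nat \<Rightarrow> complex"
  proof -
    have "degree (\<Sum>i<d. monom (f i) (d - 1 - i)) \<le> d - 1"
      by (rule degree_sum_le) (auto intro: order_trans[OF degree_monom_le])
    with assms(1) show ?thesis by simp
  qed
  have sum0: "(\<Sum>i<2*d. w $ i * ?S $$ (i, j)) = 0" if "j < 2 * d" for j
  proof -
    have "(transpose_mat ?S *\<^sub>v w) $ j = (\<Sum>i<2*d. w $ i * ?S $$ (i, j))"
      using that S w(1) by (auto simp: scalar_prod_def lessThan_atLeast0 mult.commute intro!: sum.cong)
    with w(3) that show ?thesis by simp
  qed
  have "poly (A * P + B * Q) z = poly 0 z" for z
  proof -
    have "0 = (\<Sum>j<2*d. (\<Sum>i<2*d. w $ i * ?S $$ (i, j)) * z ^ (2 * d - 1 - j))"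
      using sum0 by simp
    also have "\<dots> = (\<Sum>i<2*d. w $ i * (\<Sum>j<2*d. ?S $$ (i, j) * z ^ (2 * d - 1 - j) * 1 ^ j))"
      unfolding sum_distrib_left sum_distrib_right by (subst sum.swap) (simp add: mult.assoc)
    also have "\<dots> = (\<Sum>i<2*d. w $ i * (if i < d then z ^ (d - 1 - i) * poly P z else z ^ (2 * d - 1 - i) * poly Q z))"
    proof (rule sum.cong)
      fix i assume "i \<in> {..<2 * d}"
      then show "w $ i * (\<Sum>j<2*d. ?S $$ (i, j) * z ^ (2 * d - 1 - j) * 1 ^ j) =
        w $ i * (if i < d then z ^ (d - 1 - i) * poly P z else z ^ (2 * d - 1 - i) * poly Q z)"
        by (subst sylvester_row) (simp_all add: hform_affine nondeg_degree[OF n])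
    qed simp
    also have "\<dots> = (\<Sum>i<d. w $ i * z ^ (d - 1 - i)) * poly P z + (\<Sum>i<d. w $ (d + i) * z ^ (d - 1 - i)) * poly Q z"
    proof -
      have "(\<Sum>i<2*d. w $ i * (if i < d then z ^ (d - 1 - i) * poly P z else z ^ (2 * d - 1 - i) * poly Q z))
        = (\<Sum>i<d. w $ i * (z ^ (d - 1 - i) * poly P z)) + (\<Sum>i\<in>{d..<2*d}. w $ i * (z ^ (2 * d - 1 - i) * poly Q z))"
        unfolding lessThan_atLeast0 by (subst sum.atLeastLessThan_concat[of 0 d "2 * d", symmetric]) auto
      also have "(\<Sum>i\<in>{d..<2*d}. w $ i * (z ^ (2 * d - 1 - i) * poly Q z)) = (\<Sum>i<d. w $ (d + i) * (z ^ (d - 1 - i) * poly Q z))"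
        by (rule sum.reindex_bij_witness[of _ "\<lambda>i. d + i" "\<lambda>i. i - d"]) (auto simp: mult_2)
      finally show ?thesis by (simp add: sum_distrib_right mult.assoc)
    qed
    finally show ?thesis by (simp add: A_def B_def poly_sum poly_monom)
  qed
  then have ABz: "A * P + B * Q = 0" by (simp add: poly_eq_poly_eq_iff[symmetric] fun_eq_iff)
  have degA: "degree A < d" and degB: "degree B < d" unfolding A_def B_def by (rule degs)+
  have eqs: "A * P = - (B * Q)" by (rule eq_neg_iff_add_eq_0[THEN iffD2]) (rule ABz)
  have "Q dvd A * P" unfolding eqs by (rule dvd_minus_iff[THEN iffD2]) (rule dvd_triv_right)
  moreover have "P dvd - (A * P)" by (rule dvd_minus_iff[THEN iffD2]) (rule dvd_triv_right)
  then have "P dvd B * Q" unfolding eqs minus_minus .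
  ultimately have dv: "P dvd B" "Q dvd A"
    using nondeg_coprime[OF n] coprime_dvd_mult_left_iff[of P Q B] coprime_dvd_mult_left_iff[of Q P A]
    by (auto simp: coprime_commute)
  have AB0: "A = 0 \<and> B = 0"
  proof (cases "coeff P d = 0")
    case False
    then have "degree P \<ge> d" by (rule le_degree)
    have "B = 0" using dvd_imp_degree_le[OF dv(1)] degB \<open>degree P \<ge> d\<close> by auto
    moreover have "P \<noteq> 0" using False by auto
    ultimately show ?thesis using eqs by simp
  next
    case True
    then have Q: "coeff Q d \<noteq> 0" using n by (auto simp: nondeg_iff)
    then have "degree Q \<ge> d" by (rule le_degree)
    have "A = 0" using dvd_imp_degree_le[OF dv(2)] degA \<open>degree Q \<ge> d\<close> by auto
    moreover have "Q \<noteq> 0" using Q by auto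
    ultimately show ?thesis using eqs by simp
  qed
  have "w $ i = 0" if "i < 2 * d" for i
  proof (cases "i < d")
    case True
    then show ?thesis using coeffs[of i "\<lambda>i. w $ i"] AB0 by (simp add: A_def)
  next
    case False
    then show ?thesis using coeffs[of "i - d" "\<lambda>i. w $ (d + i)"] AB0 that by (simp add: B_def)
  qed
  then have "w = 0\<^sub>v (2 * d)" using w(1) by auto
  with w(2) show False ..
qed

section \<open>The moduli space as a quotient of a space of coefficient vectors\<close>

text \<open>Inverse of the passage from coefficient vectors to pairs of polynomials.\<close>

definition cvec :: "nat \<Rightarrow> complex poly \<Rightarrow> complex poly \<Rightarrow> nat \<Rightarrow> complex" where
  "cvec d P Q i = (if i \<le> d then coeff P i else if i \<le> 2 * d + 1 then coeff Q (i - d - 1) else 0)"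

definition nondeg_vectors :: "nat \<Rightarrow> (nat \<Rightarrow> complex) set" where
  "nondeg_vectors d = {v \<in> nonzero_vectors (2 * d + 1). nondeg d (numer d v) (denom d v)}"

lemma coeff_numer: "coeff (numer d v) i = (if i \<le> d then v i else 0)"
  by (simp add: numer_def coeff_sum coeff_monom)

lemma coeff_denom: "coeff (denom d v) i = (if i \<le> d then v (d + 1 + i) else 0)"
  by (simp add: denom_def coeff_sum coeff_monom)

lemma degree_numer: "degree (numer d v) \<le> d" and degree_denom: "degree (denom d v) \<le> d"
  by (rule degree_le; simp add: coeff_numer coeff_denom)+

lemma numer_cvec: "degree P \<le> d \<Longrightarrow> numer d (cvec d P Q) = P"
  by (rule poly_eqI) (auto simp: coeff_numer cvec_def coeff_eq_0)

lemma denom_cvec: "degree Q \<le> d \<Longrightarrow> denom d (cvec d P Q) = Q"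
  by (rule poly_eqI) (auto simp: coeff_denom cvec_def coeff_eq_0)

lemma nondeg_smult: "c \<noteq> 0 \<Longrightarrow> nondeg d (Polynomial.smult c P) (Polynomial.smult c Q) \<longleftrightarrow> nondeg d P Q"
  by (simp add: nondeg_def hform_smult)

lemma cvec_in_nondeg_vectors:
  assumes "nondeg d P Q" shows "cvec d P Q \<in> nondeg_vectors d"
proof -
  have "\<exists>i. cvec d P Q i \<noteq> 0"
  proof (cases "coeff P d = 0")
    case False
    then show ?thesis by (intro exI[of _ d]) (simp add: cvec_def)
  next
    case True
    with assms have "coeff Q d \<noteq> 0" by (auto simp: nondeg_iff)
    then show ?thesis by (intro exI[of _ "2 * d + 1"]) (simp add: cvec_def mult_2)
  qed
  with assms show ?thesis
    by (auto simp: nondeg_vectors_def nonzero_vectors_def numer_cvec denom_cvec nondeg_degree)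
       (simp add: cvec_def)
qed

lemma coeff_map_cvec:
  "nondeg d P Q \<Longrightarrow> coeff_map d (cvec d P Q) = quotient_fun d P Q"
  by (simp add: coeff_map_def numer_cvec denom_cvec nondeg_degree)

lemma resultant_iff_nondeg:
  assumes "d \<ge> 1"
  shows "resultant_sub d d (numer d v) (denom d v) \<noteq> 0 \<longleftrightarrow> nondeg d (numer d v) (denom d v)"
  using nondeg_imp_resultant_nonzero[OF assms] resultant_nonzero_imp_nondeg[OF assms degree_numer degree_denom]
  by blast

text \<open>The resultant is a polynomial in the coefficients, hence continuous.\<close>

lemma open_nondeg:
  assumes "d \<ge> 1" shows "open {v. nondeg d (numer d v) (denom d v)}"
proof -
  have entry: "continuous_on UNIV (\<lambda>v. sylvester_mat_sub d d (numer d v) (denom d v) $$ (i, j))"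
    if "i < d + d" "j < d + d" for i j
    unfolding sylvester_mat_sub_index[OF that] coeff_numer coeff_denom
    by (cases "i < d"; cases "i \<le> j \<and> j - i \<le> d"; cases "d + i - j \<le> d"; cases "i - d \<le> j \<and> j \<le> i";
        cases "i - j \<le> d"; simp)
  have "continuous_on UNIV (\<lambda>v. resultant_sub d d (numer d v) (denom d v))"
    unfolding resultant_sub_def det_def
    by (auto intro!: continuous_intros entry simp: permutes_in_image dest: permutes_in_image)
      (metis atLeastLessThan_iff permutes_in_image zero_le)?
  then have "open {v. resultant_sub d d (numer d v) (denom d v) \<noteq> 0}"
    by (rule open_Collect_neq) (rule continuous_on_const)
  then show ?thesis using resultant_iff_nondeg[OF assms] by simp
qed

text \<open>The resultant hypersurface is saturated, so the quotient map to projective space restricts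
  to its open complement.\<close>

lemma quotient_map_Rat:
  assumes "d \<ge> 1"
  shows "quotient_map (top_of_set (nondeg_vectors d)) (Rat_space d) (coeff_map d)"
proof -
  let ?N = "nonzero_vectors (2 * d + 1)"
  let ?W = "topspace (proj_space (2 * d + 1)) - resultant_hypersurface d"
  have hyp: "proj_point v \<in> resultant_hypersurface d \<longleftrightarrow> \<not> nondeg d (numer d v) (denom d v)"
    if v: "v \<in> ?N" for v
  proof
    assume "proj_point v \<in> resultant_hypersurface d"
    then obtain w where w: "proj_point v = proj_point w" "\<not> nondeg d (numer d w) (denom d w)"
      unfolding resultant_hypersurface_def using resultant_iff_nondeg[OF assms] by blast
    have "v \<in> proj_point v" unfolding proj_point_def by (intro CollectI exI[of _ 1]) simp
    then obtain c where c: "c \<noteq> 0" "v = (\<lambda>i. c * w i)" unfolding w(1) by (auto simp: proj_point_def)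
    show "\<not> nondeg d (numer d v) (denom d v)"
      unfolding c(2) numer_scale denom_scale using w(2) c(1) by (simp add: nondeg_smult)
  next
    assume "\<not> nondeg d (numer d v) (denom d v)"
    then show "proj_point v \<in> resultant_hypersurface d"
      unfolding resultant_hypersurface_def using resultant_iff_nondeg[OF assms] v by blast
  qed
  have pre: "{v \<in> topspace (top_of_set ?N). proj_point v \<in> ?W} = nondeg_vectors d"
    using hyp by (auto simp: nondeg_vectors_def proj_space_def)
  have eq: "nondeg_vectors d = ?N \<inter> {v. nondeg d (numer d v) (denom d v)}"
    by (auto simp: nondeg_vectors_def)
  have "openin (top_of_set ?N) (nondeg_vectors d)"
    unfolding eq by (rule openin_open_Int) (rule open_nondeg[OF assms])
  then have "openin (proj_space (2 * d + 1)) ?W"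
    unfolding proj_space_def openin_quotient_topology using pre by (auto simp: proj_space_def)
  then have "quotient_map (subtopology (top_of_set ?N) (nondeg_vectors d))
      (subtopology (proj_space (2 * d + 1)) ?W) proj_point"
    using quotient_map_restriction[OF quotient_map_quotient_topology, of "top_of_set ?N" proj_point ?W] pre
    by (simp add: proj_space_def)
  moreover have "subtopology (top_of_set ?N) (nondeg_vectors d) = top_of_set (nondeg_vectors d)"
    by (simp add: subtopology_subtopology Int_absorb1 nondeg_vectors_def)
  ultimately have "quotient_map (top_of_set (nondeg_vectors d)) (Rat_space d) (proj_map d \<circ> proj_point)"
    unfolding Rat_space_def by (metis quotient_map_compose quotient_map_quotient_topology)
  moreover have "proj_map d \<circ> proj_point = coeff_map d" by (auto simp: proj_map_proj_point)
  ultimately show ?thesis by simp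
qed

lemma quotient_map_moduli:
  assumes "d \<ge> 1"
  shows "quotient_map (top_of_set (nondeg_vectors d)) (moduli_space d) (orbit \<circ> coeff_map d)"
  unfolding moduli_space_def
  by (rule quotient_map_compose[OF quotient_map_Rat[OF assms] quotient_map_quotient_topology])

lemma topspace_Rat:
  assumes "d \<ge> 1" shows "topspace (Rat_space d) = {\<phi>. is_rat d \<phi>}"
proof -
  have "topspace (Rat_space d) = coeff_map d ` nondeg_vectors d"
    using quotient_imp_surjective_map[OF quotient_map_Rat[OF assms]] by simp
  also have "\<dots> = {\<phi>. is_rat d \<phi>}"
  proof safe
    fix v assume "v \<in> nondeg_vectors d"
    then show "is_rat d (coeff_map d v)" by (auto simp: nondeg_vectors_def coeff_map_def intro!: is_ratI)
  next
    fix \<phi> assume "is_rat d \<phi>"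
    then obtain P Q where "nondeg d P Q" "\<phi> = quotient_fun d P Q" by (auto simp: is_rat_def)
    then show "\<phi> \<in> coeff_map d ` nondeg_vectors d"
      by (metis coeff_map_cvec cvec_in_nondeg_vectors image_eqI)
  qed
  finally show ?thesis .
qed

lemma topspace_moduli: "d \<ge> 1 \<Longrightarrow> topspace (moduli_space d) = orbit ` {\<phi>. is_rat d \<phi>}"
  by (simp add: moduli_space_def topspace_Rat)

text \<open>Continuity of a family of polynomials, coefficient by coefficient; there is no bound on the
  degree in the type.\<close>

definition cont_poly :: "'a::topological_space set \<Rightarrow> ('a \<Rightarrow> complex poly) \<Rightarrow> bool" where
  "cont_poly S P \<longleftrightarrow> (\<forall>i. continuous_on S (\<lambda>t. coeff (P t) i))"

named_theorems cont_poly_intros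

lemma cont_poly_const [cont_poly_intros]: "cont_poly S (\<lambda>t. P)"
  by (simp add: cont_poly_def)

lemma cont_poly_add [cont_poly_intros]: "cont_poly S P \<Longrightarrow> cont_poly S Q \<Longrightarrow> cont_poly S (\<lambda>t. P t + Q t)"
  by (auto simp: cont_poly_def intro!: continuous_intros)

lemma cont_poly_diff [cont_poly_intros]: "cont_poly S P \<Longrightarrow> cont_poly S Q \<Longrightarrow> cont_poly S (\<lambda>t. P t - Q t)"
  by (auto simp: cont_poly_def intro!: continuous_intros)

lemma cont_poly_mult [cont_poly_intros]: "cont_poly S P \<Longrightarrow> cont_poly S Q \<Longrightarrow> cont_poly S (\<lambda>t. P t * Q t)"
  by (auto simp: cont_poly_def coeff_mult intro!: continuous_intros)

lemma cont_poly_smult [cont_poly_intros]: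
  "continuous_on S f \<Longrightarrow> cont_poly S P \<Longrightarrow> cont_poly S (\<lambda>t. Polynomial.smult (f t) (P t))"
  by (auto simp: cont_poly_def intro!: continuous_intros)

lemma cont_poly_pCons [cont_poly_intros]:
  "continuous_on S f \<Longrightarrow> cont_poly S P \<Longrightarrow> cont_poly S (\<lambda>t. pCons (f t) (P t))"
  unfolding cont_poly_def
proof
  fix i assume "continuous_on S f" "\<forall>i. continuous_on S (\<lambda>t. coeff (P t) i)"
  then show "continuous_on S (\<lambda>t. coeff (pCons (f t) (P t)) i)" by (cases i) auto
qed

lemma cont_poly_power [cont_poly_intros]: "cont_poly S P \<Longrightarrow> cont_poly S (\<lambda>t. P t ^ n)"
  by (induction n) (auto intro: cont_poly_intros)

lemma cont_poly_prod_list: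
  "(\<And>x. x \<in> set xs \<Longrightarrow> cont_poly S (\<lambda>t. P x t)) \<Longrightarrow> cont_poly S (\<lambda>t. prod_list (map (\<lambda>x. P x t) xs))"
  by (induction xs) (auto intro: cont_poly_intros)

text \<open>The family lifts to a continuous family of coefficient vectors.\<close>

lemma connectedin_family:
  assumes "d \<ge> 1" "connected S" "cont_poly S P" "cont_poly S Q"
    and nd: "\<And>t. t \<in> S \<Longrightarrow> nondeg d (P t) (Q t)"
  shows "connectedin (moduli_space d) ((\<lambda>t. orbit (quotient_fun d (P t) (Q t))) ` S)"
proof -
  let ?c = "\<lambda>t. cvec d (P t) (Q t)"
  have "continuous_on S (\<lambda>t. ?c t i)" for i
    using assms(3,4) by (cases "i \<le> d"; cases "i \<le> 2 * d + 1") (auto simp: cont_poly_def cvec_def)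
  then have "continuous_on S ?c" by (rule continuous_on_coordinatewise_then_product)
  then have "connected (?c ` S)" using assms(2) by (rule connected_continuous_image)
  moreover have sub: "?c ` S \<subseteq> nondeg_vectors d" using nd cvec_in_nondeg_vectors by blast
  ultimately have "connectedin (top_of_set (nondeg_vectors d)) (?c ` S)"
    by (simp add: connectedin_subtopology)
  then have "connectedin (moduli_space d) ((orbit \<circ> coeff_map d) ` ?c ` S)"
    by (rule connectedin_continuous_map_image[OF quotient_imp_continuous_map[OF quotient_map_moduli[OF assms(1)]]])
  moreover have "(orbit \<circ> coeff_map d) ` ?c ` S = (\<lambda>t. orbit (quotient_fun d (P t) (Q t))) ` S"
    unfolding image_image using nd by (intro image_cong) (auto simp: coeff_map_cvec)
  ultimately show ?thesis by simp
qed

text \<open>Closedness can be tested upstairs, where the space of coefficient vectors is first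
  countable.\<close>

lemma closedin_moduli:
  assumes "d \<ge> 1"
    and inv: "\<And>\<phi> T. T \<in> PSL2 \<Longrightarrow> R \<phi> \<Longrightarrow> R (T \<circ> \<phi> \<circ> Hilbert_Choice.inv T)"
    and lim: "\<And>P Q P' Q'. (\<And>k. nondeg d (P k) (Q k)) \<Longrightarrow> nondeg d P' Q' \<Longrightarrow>
       (\<And>i. (\<lambda>k. coeff (P k) i) \<longlonglongrightarrow> coeff P' i) \<Longrightarrow> (\<And>i. (\<lambda>k. coeff (Q k) i) \<longlonglongrightarrow> coeff Q' i) \<Longrightarrow>
       (\<And>k. R (quotient_fun d (P k) (Q k))) \<Longrightarrow> R (quotient_fun d P' Q')"
  shows "closedin (moduli_space d) {orbit \<phi> | \<phi>. is_rat d \<phi> \<and> R \<phi>}"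
proof -
  let ?E = "{orbit \<phi> | \<phi>. is_rat d \<phi> \<and> R \<phi>}" and ?V = "nondeg_vectors d"
  have sub: "?E \<subseteq> topspace (moduli_space d)" using assms(1) by (auto simp: topspace_moduli)
  have mem: "orbit \<phi> \<in> ?E \<longleftrightarrow> R \<phi>" if "is_rat d \<phi>" for \<phi>
  proof
    assume "orbit \<phi> \<in> ?E"
    then obtain \<psi> where "orbit \<psi> = orbit \<phi>" "R \<psi>" by auto
    then show "R \<phi>" using orbit_eqD inv by metis
  qed (use that in auto)
  have rat: "is_rat d (coeff_map d v)" if "v \<in> ?V" for v
    using that by (auto simp: nondeg_vectors_def coeff_map_def intro!: is_ratI)
  let ?K = "{v \<in> ?V. R (coeff_map d v)}"
  have "closedin (top_of_set ?V) ?K"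
  proof -
    have "?K = ?V \<inter> closure ?K"
    proof (intro equalityI subsetI)
      fix v assume v: "v \<in> ?V \<inter> closure ?K"
      then have "\<exists>f. (\<forall>k. f k \<in> ?K) \<and> f \<longlonglongrightarrow> v" using closure_sequential[of v ?K] by blast
      then obtain f where f: "\<And>k. f k \<in> ?K" "f \<longlonglongrightarrow> v" by blast
      have co: "(\<lambda>k. f k i) \<longlonglongrightarrow> v i" for i
        using continuous_on_tendsto_compose[OF continuous_on_product_coordinates[of i] f(2)] by simp
      have "R (quotient_fun d (numer d v) (denom d v))"
        by (rule lim[of "\<lambda>k. numer d (f k)" "\<lambda>k. denom d (f k)"])
          (use f(1) v co in \<open>auto simp: nondeg_vectors_def coeff_numer coeff_denom coeff_map_def\<close>)
      with v show "v \<in> ?K" by (auto simp: coeff_map_def)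
    next
      fix v assume "v \<in> ?K"
      then show "v \<in> ?V \<inter> closure ?K" using subsetD[OF closure_subset[of ?K]] by blast
    qed
    then show ?thesis using closedin_closed_Int[of "closure ?K" ?V] by simp
  qed
  moreover have "{v \<in> topspace (top_of_set ?V). (orbit \<circ> coeff_map d) v \<in> ?E} = ?K"
    using mem[OF rat] by auto
  ultimately have "closedin (top_of_set ?V) {v \<in> topspace (top_of_set ?V). (orbit \<circ> coeff_map d) v \<in> ?E}"
    by simp
  then show ?thesis
    using quotient_map_moduli[OF assms(1), unfolded quotient_map_closedin, THEN conjunct2, rule_format, OF sub] by blast
qed

section \<open>Real points\<close>

lemma J_hat_orbit: "J_hat (orbit \<phi>) = orbit (J \<circ> \<phi> \<circ> J)"
proof -
  have conj: "J \<circ> (T \<circ> \<phi> \<circ> Hilbert_Choice.inv T) \<circ> J =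
     (J \<circ> T \<circ> J) \<circ> (J \<circ> \<phi> \<circ> J) \<circ> Hilbert_Choice.inv (J \<circ> T \<circ> J)" if T: "T \<in> PSL2" for T \<phi>
  proof -
    have "Hilbert_Choice.inv (J \<circ> T \<circ> J) = J \<circ> Hilbert_Choice.inv T \<circ> J"
    proof (rule inv_unique_comp)
      have "surj T" "inj T" using PSL2_bij[OF T] by (auto simp: bij_def)
      then show "(J \<circ> T \<circ> J) \<circ> (J \<circ> Hilbert_Choice.inv T \<circ> J) = id"
        "(J \<circ> Hilbert_Choice.inv T \<circ> J) \<circ> (J \<circ> T \<circ> J) = id"
        by (auto simp: fun_eq_iff J_J_apply surj_f_inv_f)
    qed
    then show ?thesis by (auto simp: fun_eq_iff J_J_apply)
  qed
  have "J_hat (orbit \<phi>) \<subseteq> orbit (J \<circ> \<phi> \<circ> J)" for \<phi>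
    unfolding J_hat_def orbit_def using conj PSL2_J by fastforce
  moreover have "orbit (J \<circ> \<phi> \<circ> J) \<subseteq> J_hat (orbit \<phi>)"
  proof
    fix \<psi> assume "\<psi> \<in> orbit (J \<circ> \<phi> \<circ> J)"
    then obtain T where T: "T \<in> PSL2" "\<psi> = T \<circ> (J \<circ> \<phi> \<circ> J) \<circ> Hilbert_Choice.inv T" by (auto simp: orbit_def)
    let ?S = "J \<circ> T \<circ> J"
    have "J \<circ> \<psi> \<circ> J = ?S \<circ> \<phi> \<circ> Hilbert_Choice.inv ?S"
      using conj[OF T(1), of "J \<circ> \<phi> \<circ> J"] unfolding T(2) by (simp add: fun_eq_iff J_J_apply)
    moreover have "\<psi> = J \<circ> (J \<circ> \<psi> \<circ> J) \<circ> J" by (simp add: fun_eq_iff J_J_apply)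
    ultimately show "\<psi> \<in> J_hat (orbit \<phi>)" unfolding J_hat_def orbit_def using PSL2_J[OF T(1)] by blast
  qed
  ultimately show ?thesis by blast
qed

text \<open>The conjugate \<open>J \<circ> \<phi> \<circ> J\<close> lies in the orbit of \<open>\<phi>\<close>, with \<open>T\<close> as conjugating map.\<close>

lemma real_pointI:
  assumes "d \<ge> 1" "is_rat d \<phi>" "T \<in> PSL2" "T \<circ> J \<circ> \<phi> = \<phi> \<circ> (T \<circ> J)"
  shows "orbit \<phi> \<in> real_points d"
proof -
  have "T \<circ> (J \<circ> \<phi> \<circ> J) \<circ> Hilbert_Choice.inv T = (T \<circ> J \<circ> \<phi>) \<circ> (J \<circ> Hilbert_Choice.inv T)"
    by (simp add: comp_assoc)
  also have "\<dots> = \<phi> \<circ> (T \<circ> (J \<circ> J) \<circ> Hilbert_Choice.inv T)" unfolding assms(4) by (simp add: comp_assoc)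
  also have "\<dots> = \<phi>" unfolding J_J using PSL2_bij[OF assms(3)] by (auto simp: fun_eq_iff surj_f_inv_f bij_def)
  finally have "orbit (J \<circ> \<phi> \<circ> J) = orbit \<phi>" using orbit_conj[OF assms(3), of "J \<circ> \<phi> \<circ> J"] by simp
  then show ?thesis using assms(1,2) by (auto simp: real_points_def J_hat_orbit topspace_moduli)
qed

lemma real_pointD:
  assumes "d \<ge> 1" "C \<in> real_points d"
  obtains \<phi> T where "is_rat d \<phi>" "C = orbit \<phi>" "T \<in> PSL2" "T \<circ> J \<circ> \<phi> = \<phi> \<circ> (T \<circ> J)"
proof -
  obtain \<phi> where phi: "is_rat d \<phi>" "C = orbit \<phi>" "orbit (J \<circ> \<phi> \<circ> J) = orbit \<phi>"
    using assms by (auto simp: real_points_def J_hat_orbit topspace_moduli)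
  obtain T where T: "T \<in> PSL2" "\<phi> = T \<circ> (J \<circ> \<phi> \<circ> J) \<circ> Hilbert_Choice.inv T"
    using orbit_eqD[OF phi(3)] by blast
  have "\<phi> \<circ> (T \<circ> J) = T \<circ> (J \<circ> \<phi> \<circ> J) \<circ> (Hilbert_Choice.inv T \<circ> T) \<circ> J"
    using T(2) by (metis comp_assoc)
  also have "\<dots> = T \<circ> J \<circ> \<phi>"
    using PSL2_bij[OF T(1)] by (simp add: fun_eq_iff bij_def J_J_apply)
  finally show ?thesis using that[OF phi(1,2) T(1)] by simp
qed

text \<open>All connecting arguments are carried out inside the connected components of the real points;
  linking is the corresponding equivalence relation.\<close>

definition linked :: "nat \<Rightarrow> (sphere \<Rightarrow> sphere) set \<Rightarrow> (sphere \<Rightarrow> sphere) set \<Rightarrow> bool" where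
  "linked d = connected_component_of (subtopology (moduli_space d) (real_points d))"

lemma linked_sym: "linked d C D \<Longrightarrow> linked d D C"
  unfolding linked_def by (rule connected_component_of_sym[THEN iffD1])

lemma linked_trans: "linked d C D \<Longrightarrow> linked d D E \<Longrightarrow> linked d C E"
  unfolding linked_def by (rule connected_component_of_trans)

lemma linked_family:
  assumes "d \<ge> 1" "connected S" "cont_poly S P" "cont_poly S Q"
    and "\<And>t. t \<in> S \<Longrightarrow> nondeg d (P t) (Q t)"
    and real: "\<And>t. t \<in> S \<Longrightarrow> orbit (quotient_fun d (P t) (Q t)) \<in> real_points d"
    and "s \<in> S" "t \<in> S"
  shows "linked d (orbit (quotient_fun d (P s) (Q s))) (orbit (quotient_fun d (P t) (Q t)))"
  unfolding linked_def connected_component_of_def connectedin_subtopology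
  using connectedin_family[OF assms(1-5)] real assms(7,8)
  by (intro exI[of _ "(\<lambda>t. orbit (quotient_fun d (P t) (Q t))) ` S"]) auto

text \<open>Maps with real coefficients commute with \<open>J\<close> itself.\<close>

lemma real_coeffs_real_point:
  assumes "d \<ge> 1" "nondeg d P Q" "cpoly P = P" "cpoly Q = Q"
  shows "orbit (quotient_fun d P Q) \<in> real_points d"
proof (rule real_pointI[OF assms(1) is_ratI[OF assms(2)] PSL2_id])
  have "(J \<circ> quotient_fun d P Q \<circ> J) \<circ> J = quotient_fun d P Q \<circ> J"
    using J_quotient_fun[OF assms(2)] assms(3,4) by simp
  then show "id \<circ> J \<circ> quotient_fun d P Q = quotient_fun d P Q \<circ> (id \<circ> J)" by (simp add: comp_assoc J_J)
qed

lemma linked_real_family: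
  assumes "d \<ge> 1" "connected S" "cont_poly S P" "cont_poly S Q"
    and "\<And>t. t \<in> S \<Longrightarrow> nondeg d (P t) (Q t)"
    and "\<And>t. t \<in> S \<Longrightarrow> cpoly (P t) = P t" "\<And>t. t \<in> S \<Longrightarrow> cpoly (Q t) = Q t"
    and "s \<in> S" "t \<in> S"
  shows "linked d (orbit (quotient_fun d (P s) (Q s))) (orbit (quotient_fun d (P t) (Q t)))"
  using assms by (intro linked_family real_coeffs_real_point) auto

section \<open>Properness of the action\<close>

lemma hform_upper:
  "norm (hform d P x y) \<le> (\<Sum>i\<le>d. norm (coeff P i)) * (norm x + norm y) ^ d"
proof -
  have "norm x ^ i * norm y ^ (d - i) \<le> (norm x + norm y) ^ d" if "i \<le> d" for i
  proof -
    have "norm x ^ i * norm y ^ (d - i) \<le> (norm x + norm y) ^ i * (norm x + norm y) ^ (d - i)"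
      by (intro mult_mono power_mono) auto
    with that show ?thesis by (simp flip: power_add)
  qed
  then have "norm (hform d P x y) \<le> (\<Sum>i\<le>d. norm (coeff P i) * (norm x + norm y) ^ d)"
    unfolding hform_def
    by (intro sum_norm_le) (auto simp: norm_mult norm_power mult.assoc intro!: mult_left_mono)
  then show ?thesis by (simp add: sum_distrib_right)
qed

text \<open>By homogeneity the minimum on the compact set of vectors of norm 1 suffices, and it is
  positive as the forms have no common zero.\<close>

lemma hform_lower:
  assumes "d \<ge> 1" "nondeg d P Q"
  shows "\<exists>\<epsilon>>0. \<forall>x y. \<epsilon> * (norm x + norm y) ^ d \<le> norm (hform d P x y) + norm (hform d Q x y)"
proof -
  let ?K = "{p :: complex \<times> complex. norm (fst p) + norm (snd p) = 1}"
  let ?f = "\<lambda>p. norm (hform d P (fst p) (snd p)) + norm (hform d Q (fst p) (snd p))"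
  have "closed ?K" by (intro closed_Collect_eq continuous_intros)
  moreover have "bounded ?K"
  proof (rule boundedI[of _ 2])
    fix p :: "complex \<times> complex" assume "p \<in> ?K"
    then have "norm (fst p) \<le> 1" "norm (snd p) \<le> 1" by (auto, (smt (verit) norm_ge_zero)+)
    then show "norm p \<le> 2" using norm_Pair_le[of "fst p" "snd p"] by simp
  qed
  ultimately have "compact ?K" by (simp add: compact_eq_bounded_closed)
  moreover have "(1, 0) \<in> ?K" by simp
  moreover have "continuous_on ?K ?f" unfolding hform_def by (intro continuous_intros)
  ultimately obtain p where p: "p \<in> ?K" "\<And>q. q \<in> ?K \<Longrightarrow> ?f p \<le> ?f q"
    using continuous_attains_inf[of ?K ?f] by blast
  have "fst p \<noteq> 0 \<or> snd p \<noteq> 0" using p(1) by auto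
  then have pos: "?f p > 0" using nondeg_hform[OF assms(2), of "fst p" "snd p"]
    by (auto simp: add_pos_nonneg add_nonneg_pos)
  have "?f p * (norm x + norm y) ^ d \<le> norm (hform d P x y) + norm (hform d Q x y)" for x y
  proof (cases "x = 0 \<and> y = 0")
    case False
    define t where "t = norm x + norm y"
    have t: "t > 0" using False by (auto simp: t_def add_pos_nonneg add_nonneg_pos)
    have "norm (x / of_real t) + norm (y / of_real t) = (norm x + norm y) / t"
      using t by (simp add: norm_divide add_divide_distrib)
    also have "\<dots> = 1" using t by (simp add: t_def[symmetric])
    finally have "(x / of_real t, y / of_real t) \<in> ?K" by simp
    from p(2)[OF this] have "?f p \<le> norm (hform d P (x / of_real t) (y / of_real t)) + norm (hform d Q (x / of_real t) (y / of_real t))"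
      by simp
    moreover have "hform d R x y = of_real t ^ d * hform d R (x / of_real t) (y / of_real t)" for R
      using hform_scale[of d R "of_real t" "x / of_real t" "y / of_real t"] t by simp
    ultimately show ?thesis using t
      by (simp add: norm_mult norm_power t_def[symmetric] mult.commute flip: distrib_left)
  next
    case True
    then show ?thesis
      using assms(1) by (simp add: power_0_left)
  qed
  with pos show ?thesis by blast
qed

text \<open>The constants of \<open>hform_lower\<close> and \<open>hform_upper\<close> can be chosen uniformly along a convergent
  sequence, since the error forms have small coefficients.\<close>

lemma uniform_bounds:
  fixes P Q :: "nat \<Rightarrow> complex poly"
  assumes d: "d \<ge> 1" and n: "nondeg d P' Q'"
    and limP: "\<And>i. (\<lambda>k. coeff (P k) i) \<longlonglongrightarrow> coeff P' i" and limQ: "\<And>i. (\<lambda>k. coeff (Q k) i) \<longlonglongrightarrow> coeff Q' i"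
  obtains \<epsilon> C where "\<epsilon> > 0"
    "eventually (\<lambda>k. \<forall>x y. \<epsilon> * (norm x + norm y) ^ d \<le> norm (hform d (P k) x y) + norm (hform d (Q k) x y) \<and>
       norm (hform d (P k) x y) + norm (hform d (Q k) x y) \<le> C * (norm x + norm y) ^ d) sequentially"
proof -
  obtain \<epsilon> where e: "\<epsilon> > 0"
    "\<And>x y. \<epsilon> * (norm x + norm y) ^ d \<le> norm (hform d P' x y) + norm (hform d Q' x y)"
    using hform_lower[OF d n] by blast
  define C where "C = (\<Sum>i\<le>d. norm (coeff P' i)) + (\<Sum>i\<le>d. norm (coeff Q' i)) + \<epsilon> / 2"
  let ?\<delta> = "\<lambda>k. (\<Sum>i\<le>d. norm (coeff (P k - P') i)) + (\<Sum>i\<le>d. norm (coeff (Q k - Q') i))"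
  have "?\<delta> \<longlonglongrightarrow> (\<Sum>i\<le>d. norm (coeff P' i - coeff P' i)) + (\<Sum>i\<le>d. norm (coeff Q' i - coeff Q' i))"
    unfolding coeff_diff by (intro tendsto_intros limP limQ)
  then have "?\<delta> \<longlonglongrightarrow> 0" by simp
  then have "eventually (\<lambda>k. ?\<delta> k < \<epsilon> / 2) sequentially" using e(1) by (intro order_tendstoD) auto
  then have "eventually (\<lambda>k. \<forall>x y. \<epsilon> / 2 * (norm x + norm y) ^ d \<le> norm (hform d (P k) x y) + norm (hform d (Q k) x y) \<and>
       norm (hform d (P k) x y) + norm (hform d (Q k) x y) \<le> C * (norm x + norm y) ^ d) sequentially"
  proof eventually_elim
    case (elim k)
    show ?case
    proof (intro allI)
      fix x y :: complex
      let ?n = "(norm x + norm y) ^ d"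
      have n0: "?n \<ge> 0" by simp
      have split: "hform d (P k) x y = hform d P' x y + hform d (P k - P') x y"
        "hform d (Q k) x y = hform d Q' x y + hform d (Q k - Q') x y" by (simp_all flip: hform_add)
      have "norm (hform d (P k - P') x y) + norm (hform d (Q k - Q') x y) \<le> ?\<delta> k * ?n"
        using hform_upper[of d "P k - P'" x y] hform_upper[of d "Q k - Q'" x y] by (simp add: distrib_right)
      also have "\<dots> \<le> \<epsilon> / 2 * ?n" using elim n0 by (intro mult_right_mono) auto
      finally have diff: "norm (hform d (P k - P') x y) + norm (hform d (Q k - Q') x y) \<le> \<epsilon> / 2 * ?n" .
      have tri: "norm (hform d P' x y) \<le> norm (hform d (P k) x y) + norm (hform d (P k - P') x y)"
        "norm (hform d Q' x y) \<le> norm (hform d (Q k) x y) + norm (hform d (Q k - Q') x y)"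
        "norm (hform d (P k) x y) \<le> norm (hform d P' x y) + norm (hform d (P k - P') x y)"
        "norm (hform d (Q k) x y) \<le> norm (hform d Q' x y) + norm (hform d (Q k - Q') x y)"
        unfolding split
        by (smt (verit) norm_triangle_ineq norm_triangle_ineq4 add_diff_cancel_right')+
      have "\<epsilon> * ?n - \<epsilon> / 2 * ?n = \<epsilon> / 2 * ?n" by (simp add: field_simps)
      then have "\<epsilon> / 2 * ?n \<le> norm (hform d (P k) x y) + norm (hform d (Q k) x y)"
        using e(2)[of x y] diff tri by linarith
      moreover have "C * ?n = (\<Sum>i\<le>d. norm (coeff P' i)) * ?n + (\<Sum>i\<le>d. norm (coeff Q' i)) * ?n + \<epsilon> / 2 * ?n"
        by (simp add: C_def algebra_simps)
      then have "norm (hform d (P k) x y) + norm (hform d (Q k) x y) \<le> C * ?n"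
        using hform_upper[of d P' x y] hform_upper[of d Q' x y] diff tri by linarith
      ultimately show "\<epsilon> / 2 * ?n \<le> norm (hform d (P k) x y) + norm (hform d (Q k) x y) \<and>
       norm (hform d (P k) x y) + norm (hform d (Q k) x y) \<le> C * ?n" by blast
    qed
  qed
  moreover have "\<epsilon> / 2 > 0" using e(1) by simp
  ultimately show ?thesis using that by blast
qed

lemma matrix_norm_bound:
  fixes a b c e x y :: complex
  shows "norm (a * x + b * y) + norm (c * x + e * y) \<le> (norm a + norm b + norm c + norm e) * (norm x + norm y)"
proof -
  have "norm (a * x + b * y) + norm (c * x + e * y) \<le> (norm a * norm x + norm b * norm y) + (norm c * norm x + norm e * norm y)"
    by (intro add_mono order_trans[OF norm_triangle_ineq]) (simp_all add: norm_mult)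
  also have "\<dots> \<le> (norm a + norm b + norm c + norm e) * (norm x + norm y)"
    by (simp add: algebra_simps)
  finally show ?thesis .
qed

text \<open>The equivariance compares the forms at \<open>M v\<close> with \<open>\<mu> M\<close> applied to the forms at \<open>v\<close>. A
  vector \<open>v\<close> of size about \<open>N = norm M\<close> with \<open>norm (M v) = 1\<close> shows that \<open>norm \<mu>\<close> is at most of
  order \<open>N powr (1 - d)\<close>, and a unit vector with \<open>norm (M v)\<close> of order \<open>N\<close> shows that it is at
  least of order \<open>N powr (d - 1)\<close>. For \<open>d \<ge> 2\<close> this bounds \<open>N\<close>.\<close>

lemma conjugating_matrix_bound:
  assumes d: "d \<ge> 2" and det: "a * e - b * c = 1" and "\<epsilon> > 0"
    and PQ: "\<And>x y. \<epsilon> * (norm x + norm y) ^ d \<le> norm (hform d P x y) + norm (hform d Q x y)"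
      "\<And>x y. norm (hform d P x y) + norm (hform d Q x y) \<le> C * (norm x + norm y) ^ d"
    and RS: "\<And>x y. \<epsilon> * (norm x + norm y) ^ d \<le> norm (hform d R x y) + norm (hform d S x y)"
      "\<And>x y. norm (hform d R x y) + norm (hform d S x y) \<le> C * (norm x + norm y) ^ d"
    and "\<mu> \<noteq> 0"
    and eqP: "\<And>x y. hform d P (a * x + b * y) (c * x + e * y) = \<mu> * (a * hform d R x y + b * hform d S x y)"
    and eqQ: "\<And>x y. hform d Q (a * x + b * y) (c * x + e * y) = \<mu> * (c * hform d R x y + e * hform d S x y)"
  shows "norm a + norm b + norm c + norm e \<le> 2 ^ d * C / \<epsilon>"
proof -
  define N where "N = norm a + norm b + norm c + norm e"
  have "1 = norm (a * e - b * c)" using det by simp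
  also have "\<dots> \<le> norm a * norm e + norm b * norm c" by (rule order_trans[OF norm_triangle_ineq4]) (simp add: norm_mult)
  also have "\<dots> \<le> N * N" by (simp add: N_def algebra_simps)
  finally have "1 * 1 \<le> N * N" by simp
  moreover have N0: "N \<ge> 0" by (simp add: N_def)
  ultimately have N1: "N \<ge> 1" using mult_strict_mono'[of N 1 N 1] by linarith
  have pow: "\<epsilon> * (N / 2) ^ d \<le> \<epsilon> * t ^ d" if "N / 2 \<le> t" for t :: real
    using that N0 \<open>\<epsilon> > 0\<close> by (intro mult_left_mono power_mono) auto
  have C0: "C \<ge> 0" using PQ(1)[of 1 0] PQ(2)[of 1 0] \<open>\<epsilon> > 0\<close> by simp
  \<comment> \<open>A vector that the matrix contracts to a unit vector bounds the factor \<open>\<mu>\<close> from above.\<close>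
  obtain x y where xy: "N / 2 \<le> norm x + norm y" "norm (a * x + b * y) + norm (c * x + e * y) = 1"
  proof (cases "N / 2 \<le> norm e + norm c")
    case True
    moreover have "a * e + b * (- c) = 1" "c * e + e * (- c) = 0" using det by (simp_all add: algebra_simps)
    ultimately show ?thesis using that[of e "- c"] by simp
  next
    case False
    then have "N / 2 \<le> norm (- b) + norm a" by (simp add: N_def)
    moreover have "a * (- b) + b * a = 0" "c * (- b) + e * a = 1" using det by (simp_all add: algebra_simps)
    ultimately show ?thesis using that[of "- b" a] by simp
  qed
  have h1: "norm \<mu> * (\<epsilon> * (N / 2) ^ d) \<le> N * C"
  proof -
    let ?r = "hform d R x y" and ?s = "hform d S x y"
    let ?u = "a * ?r + b * ?s" and ?v = "c * ?r + e * ?s"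
    have "?r = (a * e - b * c) * ?r" "?s = (a * e - b * c) * ?s" using det by simp_all
    then have rs: "?r = e * ?u + (- b) * ?v" "?s = (- c) * ?u + a * ?v" by (simp_all add: algebra_simps)
    have "norm ?r + norm ?s \<le> N * (norm ?u + norm ?v)"
      using matrix_norm_bound[of e ?u "- b" ?v "- c" a] unfolding rs[symmetric] by (simp add: N_def algebra_simps)
    moreover have "\<epsilon> * (N / 2) ^ d \<le> norm ?r + norm ?s"
      using pow[OF xy(1)] RS(1)[of x y] by linarith
    ultimately have "norm \<mu> * (\<epsilon> * (N / 2) ^ d) \<le> norm \<mu> * (N * (norm ?u + norm ?v))"
      by (intro mult_left_mono) auto
    also have "\<dots> = N * (norm (hform d P (a * x + b * y) (c * x + e * y)) + norm (hform d Q (a * x + b * y) (c * x + e * y)))"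
      unfolding eqP eqQ norm_mult by (simp only: distrib_left mult.left_commute)
    also have "\<dots> \<le> N * C" using PQ(2)[of "a * x + b * y" "c * x + e * y"] xy(2) N0 by (intro mult_left_mono) auto
    finally show ?thesis .
  qed
  \<comment> \<open>A unit vector that the matrix expands bounds the same factor from below.\<close>
  obtain x y where xy: "norm x + norm y = 1" "N / 2 \<le> norm (a * x + b * y) + norm (c * x + e * y)"
  proof (cases "N / 2 \<le> norm a + norm c")
    case True then show ?thesis using that[of 1 0] by simp
  next
    case False then show ?thesis using that[of 0 1] by (simp add: N_def)
  qed
  have h2: "\<epsilon> * (N / 2) ^ d \<le> norm \<mu> * (N * C)"
  proof -
    let ?r = "hform d R x y" and ?s = "hform d S x y"
    have "\<epsilon> * (N / 2) ^ d \<le> norm (hform d P (a * x + b * y) (c * x + e * y)) + norm (hform d Q (a * x + b * y) (c * x + e * y))"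
      using pow[OF xy(2)] PQ(1)[of "a * x + b * y" "c * x + e * y"] by linarith
    also have "\<dots> = norm \<mu> * (norm (a * ?r + b * ?s) + norm (c * ?r + e * ?s))"
      unfolding eqP eqQ norm_mult by (simp only: distrib_left)
    also have "\<dots> \<le> norm \<mu> * (N * (norm ?r + norm ?s))"
      unfolding N_def by (intro mult_left_mono matrix_norm_bound) auto
    also have "\<dots> \<le> norm \<mu> * (N * C)"
      using RS(2)[of x y] xy(1) N0 by (intro mult_left_mono) auto
    finally show ?thesis .
  qed
  let ?A = "\<epsilon> * (N / 2) ^ d"
  have A0: "?A > 0" using N1 \<open>\<epsilon> > 0\<close> by simp
  have "norm \<mu> * (?A * ?A) \<le> (N * C) * ?A" using mult_right_mono[OF h1, of ?A] A0 by (simp add: algebra_simps)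
  also have "\<dots> \<le> (N * C) * (norm \<mu> * (N * C))" using h2 N0 C0 by (intro mult_left_mono) auto
  finally have "norm \<mu> * (?A * ?A) \<le> norm \<mu> * ((N * C) * (N * C))" by (simp add: algebra_simps)
  then have "?A ^ 2 \<le> (N * C) ^ 2" using \<open>\<mu> \<noteq> 0\<close> by (simp add: power2_eq_square)
  then have "?A \<le> N * C" by (rule power2_le_imp_le) (use N0 C0 in simp)
  moreover have "N ^ 2 \<le> N ^ d" using N1 d by (intro power_increasing) auto
  then have "\<epsilon> * (N * N) / 2 ^ d \<le> ?A" using \<open>\<epsilon> > 0\<close> by (simp add: power_divide power2_eq_square divide_right_mono)
  ultimately have "\<epsilon> * (N * N) / 2 ^ d \<le> N * C" by linarith
  then have "N * (\<epsilon> * N) \<le> N * (2 ^ d * C)" by (simp add: field_simps)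
  then have "\<epsilon> * N \<le> 2 ^ d * C" using N1 by simp
  then have "N \<le> 2 ^ d * C / \<epsilon>" using \<open>\<epsilon> > 0\<close> by (simp add: field_simps)
  then show ?thesis by (simp only: N_def)
qed

lemma tendsto_hform:
  assumes "\<And>i. (\<lambda>k. coeff (P k) i) \<longlonglongrightarrow> coeff P' i" "X \<longlonglongrightarrow> x" "Y \<longlonglongrightarrow> y"
  shows "(\<lambda>k. hform d (P k) (X k) (Y k)) \<longlonglongrightarrow> hform d P' x y"
  unfolding hform_def by (intro tendsto_intros assms)

text \<open>The bound on the matrices gives a convergent subsequence, and the equivariance is the
  vanishing of a continuous expression in the coefficients.\<close>

lemma conjugating_maps_converge:
  fixes P Q R S :: "nat \<Rightarrow> complex poly" and a b c e :: "nat \<Rightarrow> complex"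
  assumes d: "d \<ge> 2"
    and nd: "\<And>k. nondeg d (P k) (Q k)" "\<And>k. nondeg d (R k) (S k)" and nd': "nondeg d P' Q'" "nondeg d R' S'"
    and lim: "\<And>i. (\<lambda>k. coeff (P k) i) \<longlonglongrightarrow> coeff P' i" "\<And>i. (\<lambda>k. coeff (Q k) i) \<longlonglongrightarrow> coeff Q' i"
      "\<And>i. (\<lambda>k. coeff (R k) i) \<longlonglongrightarrow> coeff R' i" "\<And>i. (\<lambda>k. coeff (S k) i) \<longlonglongrightarrow> coeff S' i"
    and det: "\<And>k. a k * e k - b k * c k = 1"
    and eq: "\<And>k. quotient_fun d (P k) (Q k) \<circ> mob (a k) (b k) (c k) (e k) = mob (a k) (b k) (c k) (e k) \<circ> quotient_fun d (R k) (S k)"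
  obtains r a' b' c' e' where "strict_mono (r :: nat \<Rightarrow> nat)" "(a \<circ> r) \<longlonglongrightarrow> a'" "(b \<circ> r) \<longlonglongrightarrow> b'"
    "(c \<circ> r) \<longlonglongrightarrow> c'" "(e \<circ> r) \<longlonglongrightarrow> e'" "a' * e' - b' * c' = 1"
    "quotient_fun d P' Q' \<circ> mob a' b' c' e' = mob a' b' c' e' \<circ> quotient_fun d R' S'"
proof -
  have d1: "d \<ge> 1" using d by simp
  obtain \<epsilon>1 C1 where b1: "\<epsilon>1 > 0" "eventually (\<lambda>k. \<forall>x y. \<epsilon>1 * (norm x + norm y) ^ d \<le> norm (hform d (P k) x y) + norm (hform d (Q k) x y) \<and>
       norm (hform d (P k) x y) + norm (hform d (Q k) x y) \<le> C1 * (norm x + norm y) ^ d) sequentially"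
    using uniform_bounds[OF d1 nd'(1) lim(1,2)] by blast
  obtain \<epsilon>2 C2 where b2: "\<epsilon>2 > 0" "eventually (\<lambda>k. \<forall>x y. \<epsilon>2 * (norm x + norm y) ^ d \<le> norm (hform d (R k) x y) + norm (hform d (S k) x y) \<and>
       norm (hform d (R k) x y) + norm (hform d (S k) x y) \<le> C2 * (norm x + norm y) ^ d) sequentially"
    using uniform_bounds[OF d1 nd'(2) lim(3,4)] by blast
  define \<epsilon> C where "\<epsilon> = min \<epsilon>1 \<epsilon>2" and "C = max C1 C2"
  have weak: "\<epsilon> * (norm x + norm y) ^ d \<le> \<epsilon>1 * (norm x + norm y) ^ d" "\<epsilon> * (norm x + norm y) ^ d \<le> \<epsilon>2 * (norm x + norm y) ^ d"
    "C1 * (norm x + norm y) ^ d \<le> C * (norm x + norm y) ^ d" "C2 * (norm x + norm y) ^ d \<le> C * (norm x + norm y) ^ d"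
    for x y :: complex
    by (intro mult_right_mono; simp add: \<epsilon>_def C_def)+
  have "eventually (\<lambda>k. norm (a k) + norm (b k) + norm (c k) + norm (e k) \<le> 2 ^ d * C / \<epsilon>) sequentially"
    using b1(2) b2(2)
  proof eventually_elim
    case (elim k)
    have "a k * e k - b k * c k \<noteq> 0" using det[of k] by simp
    then obtain \<mu> where \<mu>: "\<mu> \<noteq> 0"
      "\<And>x y. hform d (P k) (a k * x + b k * y) (c k * x + e k * y) = \<mu> * (a k * hform d (R k) x y + b k * hform d (S k) x y)"
      "\<And>x y. hform d (Q k) (a k * x + b k * y) (c k * x + e k * y) = \<mu> * (c k * hform d (R k) x y + e k * hform d (S k) x y)"
      using equivariance_factor[OF nd(1)[of k] nd(2)[of k] _ _ eq[of k]] d by auto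
    show ?case
    proof (rule conjugating_matrix_bound[OF d det _ _ _ _ _ \<mu>])
      show "\<epsilon> > 0" using b1(1) b2(1) by (simp add: \<epsilon>_def)
    qed (use elim weak order_trans in blast)+
  qed
  then obtain K where K: "\<And>k. k \<ge> K \<Longrightarrow> norm (a k) + norm (b k) + norm (c k) + norm (e k) \<le> 2 ^ d * C / \<epsilon>"
    by (auto simp: eventually_sequentially)
  define f where "f k = (a (k + K), b (k + K), c (k + K), e (k + K))" for k
  have "norm (f k) \<le> 2 ^ d * C / \<epsilon>" for k
  proof -
    have "norm (f k) \<le> norm (a (k + K)) + (norm (b (k + K)) + (norm (c (k + K)) + norm (e (k + K))))"
      unfolding f_def by (intro order_trans[OF norm_Pair_le] add_mono order_refl)
    also have "\<dots> \<le> 2 ^ d * C / \<epsilon>" using K[of "k + K"] by simp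
    finally show ?thesis .
  qed
  then have "bounded (range f)" unfolding bounded_iff by blast
  then obtain l r where r: "strict_mono r" "(f \<circ> r) \<longlonglongrightarrow> l"
    using bounded_imp_convergent_subsequence by blast
  obtain a' b' c' e' where l: "l = (a', b', c', e')" by (cases l)
  define r' where "r' k = r k + K" for k
  have r': "strict_mono r'" using r(1) by (auto simp: r'_def strict_mono_def)
  have conv: "(a \<circ> r') \<longlonglongrightarrow> a'" "(b \<circ> r') \<longlonglongrightarrow> b'" "(c \<circ> r') \<longlonglongrightarrow> c'" "(e \<circ> r') \<longlonglongrightarrow> e'"
    using tendsto_fst[OF r(2)] tendsto_fst[OF tendsto_snd[OF r(2)]] tendsto_fst[OF tendsto_snd[OF tendsto_snd[OF r(2)]]]
      tendsto_snd[OF tendsto_snd[OF tendsto_snd[OF r(2)]]]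
    by (simp_all add: f_def r'_def l comp_def)
  have "(\<lambda>k. (a \<circ> r') k * (e \<circ> r') k - (b \<circ> r') k * (c \<circ> r') k) \<longlonglongrightarrow> a' * e' - b' * c'"
    by (intro tendsto_intros conv)
  then have det': "a' * e' - b' * c' = 1" using det by (simp add: LIMSEQ_const_iff)
  then have det0: "a' * e' - b' * c' \<noteq> 0" by simp
  have "quotient_fun d P' Q' \<circ> mob a' b' c' e' = mob a' b' c' e' \<circ> quotient_fun d R' S'"
  proof (rule sphere_fun_eqI)
    fix x y :: complex assume xy: "x \<noteq> 0 \<or> y \<noteq> 0"
    let ?w = "\<lambda>k. hform d (P (r' k)) ((a \<circ> r') k * x + (b \<circ> r') k * y) ((c \<circ> r') k * x + (e \<circ> r') k * y)
          * ((c \<circ> r') k * hform d (R (r' k)) x y + (e \<circ> r') k * hform d (S (r' k)) x y)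
       - ((a \<circ> r') k * hform d (R (r' k)) x y + (b \<circ> r') k * hform d (S (r' k)) x y)
          * hform d (Q (r' k)) ((a \<circ> r') k * x + (b \<circ> r') k * y) ((c \<circ> r') k * x + (e \<circ> r') k * y)"
    have sub: "(\<lambda>k. coeff (P (r' k)) i) \<longlonglongrightarrow> coeff P' i" "(\<lambda>k. coeff (Q (r' k)) i) \<longlonglongrightarrow> coeff Q' i"
       "(\<lambda>k. coeff (R (r' k)) i) \<longlonglongrightarrow> coeff R' i" "(\<lambda>k. coeff (S (r' k)) i) \<longlonglongrightarrow> coeff S' i" for i
      using LIMSEQ_subseq_LIMSEQ[OF lim(1)[of i] r'] LIMSEQ_subseq_LIMSEQ[OF lim(2)[of i] r']
        LIMSEQ_subseq_LIMSEQ[OF lim(3)[of i] r'] LIMSEQ_subseq_LIMSEQ[OF lim(4)[of i] r'] by (simp_all add: comp_def)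
    have "?w \<longlonglongrightarrow> hform d P' (a' * x + b' * y) (c' * x + e' * y) * (c' * hform d R' x y + e' * hform d S' x y)
       - (a' * hform d R' x y + b' * hform d S' x y) * hform d Q' (a' * x + b' * y) (c' * x + e' * y)"
      by (intro tendsto_intros tendsto_hform sub conv)
    moreover have "?w k = 0" for k
    proof -
      have det1: "a (r' k) * e (r' k) - b (r' k) * c (r' k) \<noteq> 0" using det[of "r' k"] by simp
      note nz = linear_nonzero[OF det1 xy] and nz' = nondeg_hform[OF nd(2)[of "r' k"] xy]
      show ?thesis
        using fun_cong[OF eq[of "r' k"], of "hpt x y"] nondeg_hform[OF nd(1) nz] linear_nonzero[OF det1 nz']
        by (simp add: mob_hpt[OF xy] quotient_fun_hpt[OF nondeg_degree[OF nd(1)[of "r' k"]] nz]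
            quotient_fun_hpt[OF nondeg_degree[OF nd(2)[of "r' k"]] xy] mob_hpt[OF nz'] hpt_eq_iff)
    qed
    ultimately have w: "hform d P' (a' * x + b' * y) (c' * x + e' * y) * (c' * hform d R' x y + e' * hform d S' x y)
       = (a' * hform d R' x y + b' * hform d S' x y) * hform d Q' (a' * x + b' * y) (c' * x + e' * y)"
      by (simp add: LIMSEQ_const_iff)
    note nz = linear_nonzero[OF det0 xy] and nz' = nondeg_hform[OF nd'(2) xy]
    show "(quotient_fun d P' Q' \<circ> mob a' b' c' e') (hpt x y) = (mob a' b' c' e' \<circ> quotient_fun d R' S') (hpt x y)"
      using w nondeg_hform[OF nd'(1) nz] linear_nonzero[OF det0 nz']
      by (simp add: mob_hpt[OF xy] quotient_fun_hpt[OF nondeg_degree[OF nd'(1)] nz]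
            quotient_fun_hpt[OF nondeg_degree[OF nd'(2)] xy] mob_hpt[OF nz'] hpt_eq_iff)
  qed
  with that r' conv det' show ?thesis by blast
qed

text \<open>The Chebyshev polynomials of the second kind at \<open>t / 2\<close>, with index shifted by one:
  \<open>chebyshev t k\<close> is \<open>U (k - 1) (t / 2)\<close>. A matrix \<open>M\<close> of determinant 1 and trace \<open>t\<close> satisfies
  \<open>M ^ (k + 1) = chebyshev t (k + 1) * M - chebyshev t k\<close>.\<close>

fun chebyshev :: "real \<Rightarrow> nat \<Rightarrow> real" where
  "chebyshev t 0 = 0"
| "chebyshev t (Suc 0) = 1"
| "chebyshev t (Suc (Suc k)) = t * chebyshev t (Suc k) - chebyshev t k"

lemma chebyshev_growth:
  assumes "t \<ge> 2" shows "chebyshev t k \<ge> real k \<and> chebyshev t (Suc k) \<ge> chebyshev t k + 1"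
proof (induction k)
  case (Suc k)
  have "t * chebyshev t (Suc k) \<ge> 2 * chebyshev t (Suc k)" using assms Suc by (intro mult_right_mono) auto
  moreover have "chebyshev t (Suc (Suc k)) = t * chebyshev t (Suc k) - chebyshev t k" by simp
  ultimately show ?case using Suc by linarith
qed simp

lemma bounded_linear_growth_zero:
  fixes b :: complex
  assumes "\<And>k. norm (of_real (s k) * b) \<le> B" "\<And>k. s k \<ge> real k"
  shows "b = 0"
proof (rule ccontr)
  assume "b \<noteq> 0"
  then have b: "norm b > 0" by simp
  obtain k :: nat where k: "real k > B / norm b" using reals_Archimedean2 by blast
  have "real k * norm b \<le> s k * norm b" using assms(2) by (intro mult_right_mono) auto
  also have "\<dots> \<le> \<bar>s k\<bar> * norm b" by (intro mult_right_mono) auto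
  also have "\<dots> \<le> B" using assms(1)[of k] by (simp add: norm_mult)
  finally show False using k b by (simp add: field_simps)
qed

text \<open>The case of a constant sequence: automorphisms of a fixed map have bounded matrices.\<close>

lemma commuting_maps_bounded:
  assumes d: "d \<ge> 2" and n: "nondeg d P Q"
  obtains B where "\<And>a b c e. a * e - b * c = 1 \<Longrightarrow> quotient_fun d P Q \<circ> mob a b c e = mob a b c e \<circ> quotient_fun d P Q
     \<Longrightarrow> norm a \<le> B \<and> norm b \<le> B \<and> norm c \<le> B \<and> norm e \<le> B"
proof -
  obtain \<epsilon> where e: "\<epsilon> > 0" "\<And>x y. \<epsilon> * (norm x + norm y) ^ d \<le> norm (hform d P x y) + norm (hform d Q x y)"
    using hform_lower[OF _ n] d by auto
  define C where "C = (\<Sum>i\<le>d. norm (coeff P i)) + (\<Sum>i\<le>d. norm (coeff Q i))"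
  have C: "norm (hform d P x y) + norm (hform d Q x y) \<le> C * (norm x + norm y) ^ d" for x y
    using hform_upper[of d P x y] hform_upper[of d Q x y] by (simp add: C_def distrib_right)
  have "norm a \<le> 2 ^ d * C / \<epsilon> \<and> norm b \<le> 2 ^ d * C / \<epsilon> \<and> norm c \<le> 2 ^ d * C / \<epsilon> \<and> norm f \<le> 2 ^ d * C / \<epsilon>"
    if det: "a * f - b * c = 1" and eq: "quotient_fun d P Q \<circ> mob a b c f = mob a b c f \<circ> quotient_fun d P Q" for a b c f
  proof -
    have "a * f - b * c \<noteq> 0" using det by simp
    then obtain \<mu> where \<mu>: "\<mu> \<noteq> 0"
      "\<And>x y. hform d P (a * x + b * y) (c * x + f * y) = \<mu> * (a * hform d P x y + b * hform d Q x y)"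
      "\<And>x y. hform d Q (a * x + b * y) (c * x + f * y) = \<mu> * (c * hform d P x y + f * hform d Q x y)"
      using equivariance_factor[OF n n _ _ eq] d by auto
    have "norm a + norm b + norm c + norm f \<le> 2 ^ d * C / \<epsilon>"
      by (rule conjugating_matrix_bound[OF d det e(1) e(2) C e(2) C \<mu>])
    then show ?thesis using norm_ge_zero[of a] norm_ge_zero[of b] norm_ge_zero[of c] norm_ge_zero[of f] by linarith
  qed
  then show ?thesis by (rule that)
qed

lemma comp_commutes:
  assumes "Q \<circ> \<phi> = \<phi> \<circ> Q" "R \<circ> \<phi> = \<phi> \<circ> R" shows "(Q \<circ> R) \<circ> \<phi> = \<phi> \<circ> (Q \<circ> R)"
  using fun_cong[OF assms(1)] fun_cong[OF assms(2)] by (simp add: fun_eq_iff)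

text \<open>The eigenvalues are \<open>l\<close> and \<open>1 / l\<close>, so the trace is at least 2 and the coefficients of the
  powers grow at least linearly. As all powers are automorphisms they stay bounded, which kills
  the off-diagonal entries and forces the diagonal ones to have modulus 1, whence \<open>l = 1\<close>.\<close>

lemma automorphism_positive_eigenvalue:
  assumes d: "d \<ge> 2" and n: "nondeg d P Q" and det: "a * e - b * c = 1"
    and comm: "quotient_fun d P Q \<circ> mob a b c e = mob a b c e \<circ> quotient_fun d P Q"
    and ev: "x \<noteq> 0 \<or> y \<noteq> 0" "a * x + b * y = of_real l * x" "c * x + e * y = of_real l * y" and l: "l > 0"
  shows "a = 1 \<and> b = 0 \<and> c = 0 \<and> e = 1"
proof -
  let ?\<phi> = "quotient_fun d P Q" and ?l = "complex_of_real l"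
  have "(a - ?l) * (e - ?l) - b * c = 0"
    using linear_nonzero[of "a - ?l" "e - ?l" b c x y] ev by (auto simp: algebra_simps)
  then have char: "?l * (a + e) = ?l * ?l + 1" using det by (simp add: algebra_simps)
  \<comment> \<open>The trace, which is at least 2 by the inequality of the means.\<close>
  define t where "t = l + 1 / l"
  have t2: "t \<ge> 2"
  proof -
    have "(l - 1) * (l - 1) / l = (l * l - 2 * l + 1) / l" by (simp add: algebra_simps)
    also have "\<dots> = t - 2" using l by (simp add: t_def add_divide_distrib diff_divide_distrib)
    finally show ?thesis using divide_nonneg_pos[OF zero_le_square l, of "l - 1"] by linarith
  qed
  have "?l * of_real t = ?l * ?l + 1" using l by (simp add: t_def distrib_left)
  then have "?l * (a + e) = ?l * of_real t" using char by simp
  then have tr: "a + e = of_real t" using l by simp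
  have CH: "a * a + b * c = of_real t * a - 1" "a * b + b * e = of_real t * b"
    "c * a + e * c = of_real t * c" "c * b + e * e = of_real t * e - 1"
    using det by (simp_all add: tr[symmetric] algebra_simps)
  define s where "s k = (of_real (chebyshev t k) :: complex)" for k
  have s_rec: "s (Suc (Suc k)) = of_real t * s (Suc k) - s k" for k by (simp add: s_def)
  \<comment> \<open>By Cayley-Hamilton the powers of the matrix have Chebyshev polynomials of its trace as coefficients.\<close>
  have powers: "(s (Suc k) * a - s k) * (s (Suc k) * e - s k) - (s (Suc k) * b) * (s (Suc k) * c) = 1 \<and>
      ?\<phi> \<circ> mob (s (Suc k) * a - s k) (s (Suc k) * b) (s (Suc k) * c) (s (Suc k) * e - s k)
      = mob (s (Suc k) * a - s k) (s (Suc k) * b) (s (Suc k) * c) (s (Suc k) * e - s k) \<circ> ?\<phi>" for k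
  proof (induction k)
    case 0
    then show ?case using det comm by (simp add: s_def)
  next
    case (Suc k)
    let ?a = "s (Suc k) * a - s k" and ?b = "s (Suc k) * b" and ?c = "s (Suc k) * c" and ?e = "s (Suc k) * e - s k"
    have det0: "a * e - b * c \<noteq> 0" using det by simp
    have entries: "?a * a + ?b * c = s (Suc (Suc k)) * a - s (Suc k)" "?a * b + ?b * e = s (Suc (Suc k)) * b"
      "?c * a + ?e * c = s (Suc (Suc k)) * c" "?c * b + ?e * e = s (Suc (Suc k)) * e - s (Suc k)"
    proof -
      have "?a * a + ?b * c = s (Suc k) * (a * a + b * c) - s k * a" "?a * b + ?b * e = s (Suc k) * (a * b + b * e) - s k * b"
        "?c * a + ?e * c = s (Suc k) * (c * a + e * c) - s k * c" "?c * b + ?e * e = s (Suc k) * (c * b + e * e) - s k * e"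
        by (simp_all add: algebra_simps)
      then show "?a * a + ?b * c = s (Suc (Suc k)) * a - s (Suc k)" "?a * b + ?b * e = s (Suc (Suc k)) * b"
      "?c * a + ?e * c = s (Suc (Suc k)) * c" "?c * b + ?e * e = s (Suc (Suc k)) * e - s (Suc k)"
        unfolding CH s_rec by (simp_all add: algebra_simps)
    qed
    have m: "mob ?a ?b ?c ?e \<circ> mob a b c e
      = mob (s (Suc (Suc k)) * a - s (Suc k)) (s (Suc (Suc k)) * b) (s (Suc (Suc k)) * c) (s (Suc (Suc k)) * e - s (Suc k))"
      by (subst mob_comp[OF det0]) (simp only: entries)
    have "(?a * a + ?b * c) * (?c * b + ?e * e) - (?a * b + ?b * e) * (?c * a + ?e * c) = (?a * ?e - ?b * ?c) * (a * e - b * c)"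
      by (simp add: algebra_simps)
    also have "\<dots> = 1" using Suc.IH det by simp
    finally have "(s (Suc (Suc k)) * a - s (Suc k)) * (s (Suc (Suc k)) * e - s (Suc k)) - (s (Suc (Suc k)) * b) * (s (Suc (Suc k)) * c) = 1"
      unfolding entries .
    moreover have "?\<phi> \<circ> (mob ?a ?b ?c ?e \<circ> mob a b c e) = (mob ?a ?b ?c ?e \<circ> mob a b c e) \<circ> ?\<phi>"
      by (rule comp_commutes[OF conjunct2[OF Suc.IH, symmetric] comm[symmetric], symmetric])
    ultimately show ?case unfolding m by blast
  qed
  obtain B where B: "\<And>a b c e. a * e - b * c = 1 \<Longrightarrow> ?\<phi> \<circ> mob a b c e = mob a b c e \<circ> ?\<phi>
     \<Longrightarrow> norm a \<le> B \<and> norm b \<le> B \<and> norm c \<le> B \<and> norm e \<le> B"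
    using commuting_maps_bounded[OF d n] by blast
  have bd: "norm (s (Suc k) * a - s k) \<le> B" "norm (s (Suc k) * b) \<le> B" "norm (s (Suc k) * c) \<le> B"
    "norm (s (Suc k) * e - s k) \<le> B" for k
    using B[OF conjunct1[OF powers] conjunct2[OF powers]] by blast+
  have grow: "chebyshev t (Suc k) \<ge> real k" for k using chebyshev_growth[OF t2, of k] by linarith
  have "b = 0" "c = 0"
    using bd(2,3) grow unfolding s_def by (intro bounded_linear_growth_zero[of "\<lambda>k. chebyshev t (Suc k)"]; blast)+
  have pow_bound: "norm z \<le> 1" if z: "z * z = of_real t * z - 1" and bz: "\<And>k. norm (s (Suc k) * z - s k) \<le> B" for z
  proof (rule ccontr)
    assume "\<not> norm z \<le> 1"
    then obtain k where k: "norm z ^ k > B" using real_arch_pow[of "norm z" B] by auto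
    have "s (Suc k) * z - s k = z ^ Suc k" for k
    proof (induction k)
      case (Suc k)
      have "z ^ Suc (Suc k) = (s (Suc k) * z - s k) * z" using Suc by simp
      also have "\<dots> = s (Suc k) * (z * z) - s k * z" by (simp add: algebra_simps)
      finally show ?case unfolding z s_rec by (simp add: algebra_simps)
    qed (simp add: s_def)
    then have "norm z ^ Suc k \<le> B" using bz[of k] by (simp add: norm_power norm_mult)
    moreover have "norm z ^ k \<le> norm z ^ Suc k" using \<open>\<not> norm z \<le> 1\<close> by (intro power_increasing) auto
    ultimately show False using k by linarith
  qed
  have na: "norm a \<le> 1" using CH(1) \<open>b = 0\<close> bd(1) by (intro pow_bound) auto
  have ne: "norm e \<le> 1" using CH(4) \<open>b = 0\<close> bd(4) by (intro pow_bound) auto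
  have ae: "a * e = 1" using det \<open>b = 0\<close> by simp
  have "norm a * norm e = 1" using ae by (simp flip: norm_mult)
  then have "norm a = 1 \<and> norm e = 1"
    using na ne mult_left_le[of "norm e" "norm a"] mult_left_le_one_le[of "norm e" "norm a"] by auto
  moreover have "a = ?l \<or> e = ?l" using ev \<open>b = 0\<close> \<open>c = 0\<close> by auto
  ultimately have "l = 1" using l by auto
  then have "a = 1 \<or> e = 1" using \<open>a = ?l \<or> e = ?l\<close> by simp
  then show ?thesis using ae \<open>b = 0\<close> \<open>c = 0\<close> by auto
qed

section \<open>Normal form of an antiholomorphic automorphism\<close>

lemma singular_matrix_kernel:
  fixes a b c e :: complex
  assumes "a * e - b * c = 0"
  shows "\<exists>x y. (x \<noteq> 0 \<or> y \<noteq> 0) \<and> a * x + b * y = 0 \<and> c * x + e * y = 0"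
proof (cases "a = 0 \<and> b = 0")
  case True
  show ?thesis
  proof (cases "c = 0 \<and> e = 0")
    case True with \<open>a = 0 \<and> b = 0\<close> show ?thesis by (intro exI[of _ 1]) auto
  next
    case False with \<open>a = 0 \<and> b = 0\<close> show ?thesis by (intro exI[of _ "- e"] exI[of _ c]) auto
  qed
next
  case False
  with assms show ?thesis by (intro exI[of _ "- b"] exI[of _ a]) (auto simp: algebra_simps)
qed

lemma eigenvector_exists:
  fixes a b c e :: complex
  obtains l x y where "x \<noteq> 0 \<or> y \<noteq> 0" "a * x + b * y = l * x" "c * x + e * y = l * y"
proof -
  have "\<not> constant (poly [: a * e - b * c, - (a + e), 1 :])" by (simp add: constant_degree)
  then obtain l where "poly [: a * e - b * c, - (a + e), 1 :] l = 0"
    using fundamental_theorem_of_algebra by blast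
  then have "(a - l) * (e - l) - b * c = 0" by (simp add: algebra_simps)
  from singular_matrix_kernel[OF this] obtain x y where
    "x \<noteq> 0 \<or> y \<noteq> 0" "(a - l) * x + b * y = 0" "c * x + (e - l) * y = 0" by blast
  then show ?thesis using that[of x y l] by (simp add: algebra_simps)
qed

lemma antiholomorphic_square:
  assumes "a * e - b * c = 1"
  shows "(mob a b c e \<circ> J) \<circ> (mob a b c e \<circ> J) =
    mob (a * cnj a + b * cnj c) (a * cnj b + b * cnj e) (c * cnj a + e * cnj c) (c * cnj b + e * cnj e)"
proof -
  have "cnj a * cnj e - cnj b * cnj c \<noteq> 0" using arg_cong[OF assms, of cnj] by simp
  then show ?thesis using J_mob[of a b c e] by (simp add: comp_assoc flip: mob_comp)
qed

text \<open>In the basis of \<open>v\<close> and its image under the antilinear map the matrix becomes antidiagonal,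
  provided that \<open>v\<close> is an eigenvector of the square and is independent of its image. If an
  eigenvector is parallel to its image, then its eigenvalue is positive, so the square is the
  identity by \<open>automorphism_positive_eigenvalue\<close>, and every vector is an eigenvector; one that is
  independent of its image can then be chosen.\<close>

lemma swapped_vector_exists:
  assumes d: "d \<ge> 2" and n: "nondeg d P Q" and det: "a * e - b * c = 1"
    and comm: "mob a b c e \<circ> J \<circ> quotient_fun d P Q = quotient_fun d P Q \<circ> (mob a b c e \<circ> J)"
  obtains x y l where "x * (c * cnj x + e * cnj y) - (a * cnj x + b * cnj y) * y \<noteq> 0" "l \<noteq> 0"
    "a * cnj (a * cnj x + b * cnj y) + b * cnj (c * cnj x + e * cnj y) = l * x"
    "c * cnj (a * cnj x + b * cnj y) + e * cnj (c * cnj x + e * cnj y) = l * y"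
proof -
  define a' b' c' e' where B: "a' = a * cnj a + b * cnj c" "b' = a * cnj b + b * cnj e"
    "c' = c * cnj a + e * cnj c" "e' = c * cnj b + e * cnj e"
  have cdet: "cnj a * cnj e - cnj b * cnj c = 1" using arg_cong[OF det, of cnj] by simp
  have "a' * e' - b' * c' = (a * e - b * c) * (cnj a * cnj e - cnj b * cnj c)" by (simp add: B algebra_simps)
  then have detB: "a' * e' - b' * c' = 1" using det cdet by simp
  have sq: "(mob a b c e \<circ> J) \<circ> (mob a b c e \<circ> J) = mob a' b' c' e'"
    unfolding B by (rule antiholomorphic_square[OF det])
  have commB: "quotient_fun d P Q \<circ> mob a' b' c' e' = mob a' b' c' e' \<circ> quotient_fun d P Q"
    unfolding sq[symmetric] by (rule comp_commutes[OF comm comm, symmetric])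
  have twice: "a * cnj (a * cnj x + b * cnj y) + b * cnj (c * cnj x + e * cnj y) = a' * x + b' * y"
    "c * cnj (a * cnj x + b * cnj y) + e * cnj (c * cnj x + e * cnj y) = c' * x + e' * y" for x y
    by (simp_all add: B algebra_simps)
  obtain l x y where ev: "x \<noteq> 0 \<or> y \<noteq> 0" "a' * x + b' * y = l * x" "c' * x + e' * y = l * y"
    by (rule eigenvector_exists)
  have "a' * x + b' * y \<noteq> 0 \<or> c' * x + e' * y \<noteq> 0"
    by (rule linear_nonzero[OF _ ev(1)]) (simp add: detB)
  then have "l * x \<noteq> 0 \<or> l * y \<noteq> 0" by (simp only: ev(2,3))
  then have "l \<noteq> 0" by (cases "l = 0") simp_all
  show ?thesis
  proof (cases "x * (c * cnj x + e * cnj y) - (a * cnj x + b * cnj y) * y = 0")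
    case False
    then show ?thesis using that[of x y l] \<open>l \<noteq> 0\<close> ev twice by simp
  next
    case True
    let ?p = "a * cnj x + b * cnj y" and ?q = "c * cnj x + e * cnj y"
    obtain k where k: "?p = k * x" "?q = k * y"
    proof (cases "x = 0")
      case False
      with True show ?thesis using that[of "?p / x"] by (simp add: field_simps)
    next
      case True': True
      with ev(1) have "y \<noteq> 0" by simp
      with True show ?thesis using that[of "?q / y"] True' by (simp add: field_simps)
    qed
    have kk: "k * cnj k = of_real ((norm k)\<^sup>2)" by (simp only: complex_norm_square)
    have cp: "cnj ?p = cnj k * cnj x" "cnj ?q = cnj k * cnj y" unfolding k by simp_all
    have "l * x = a * cnj ?p + b * cnj ?q" using twice(1)[of x y] ev(2) by simp
    also have "\<dots> = cnj k * ?p" unfolding cp by (simp only: distrib_left mult.left_commute)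
    also have "\<dots> = of_real ((norm k)\<^sup>2) * x" unfolding k(1) kk[symmetric] by simp
    finally have lx: "l * x = of_real ((norm k)\<^sup>2) * x" .
    have "l * y = c * cnj ?p + e * cnj ?q" using twice(2)[of x y] ev(3) by simp
    also have "\<dots> = cnj k * ?q" unfolding cp by (simp only: distrib_left mult.left_commute)
    also have "\<dots> = of_real ((norm k)\<^sup>2) * y" unfolding k(2) kk[symmetric] by simp
    finally have "l = of_real ((norm k)\<^sup>2)" using lx ev(1) by auto
    moreover from this \<open>l \<noteq> 0\<close> have "(norm k)\<^sup>2 > 0" by auto
    ultimately have "a' = 1 \<and> b' = 0 \<and> c' = 0 \<and> e' = 1"
      using automorphism_positive_eigenvalue[OF d n detB commB ev(1)] ev(2,3) by blast
    then have fix_all: "a * cnj (a * cnj x + b * cnj y) + b * cnj (c * cnj x + e * cnj y) = 1 * x"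
      "c * cnj (a * cnj x + b * cnj y) + e * cnj (c * cnj x + e * cnj y) = 1 * y" for x y
      unfolding twice by simp_all
    consider "c \<noteq> 0" | "b \<noteq> 0" | "c = 0" "b = 0" "a \<noteq> e" | "c = 0" "b = 0" "a = e" by blast
    then show ?thesis
    proof cases
      case 1 then show ?thesis by (intro that[OF _ _ fix_all(1)[of 1 0] fix_all(2)[of 1 0]]) simp_all
    next
      case 2 then show ?thesis by (intro that[OF _ _ fix_all(1)[of 0 1] fix_all(2)[of 0 1]]) simp_all
    next
      case 3 then show ?thesis by (intro that[OF _ _ fix_all(1)[of 1 1] fix_all(2)[of 1 1]]) simp_all
    next
      case 4
      then have "a \<noteq> 0" using det by auto
      with 4 have "1 * (c * cnj 1 + e * cnj \<i>) - (a * cnj 1 + b * cnj \<i>) * \<i> \<noteq> 0" by simp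
      then show ?thesis by (intro that[OF _ _ fix_all(1)[of 1 \<i>] fix_all(2)[of 1 \<i>]]) simp_all
    qed
  qed
qed

text \<open>Rescaling the first basis vector by the root of the modulus of the eigenvalue makes the
  remaining constant unimodular.\<close>

lemma antiholomorphic_normal_form:
  assumes d: "d \<ge> 2" and r: "is_rat d \<phi>" and T: "T \<in> PSL2" and comm: "T \<circ> J \<circ> \<phi> = \<phi> \<circ> (T \<circ> J)"
  obtains S c where "S \<in> PSL2" "norm c = 1" "S \<circ> (T \<circ> J) \<circ> Hilbert_Choice.inv S = mob 0 c 1 0 \<circ> J"
proof -
  obtain P Q where n: "nondeg d P Q" and \<phi>: "\<phi> = quotient_fun d P Q" using r by (auto simp: is_rat_def)
  obtain a b c e where det: "a * e - b * c = 1" and T: "T = mob a b c e" using T unfolding PSL2_iff by metis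
  obtain x y l where xy: "x * (c * cnj x + e * cnj y) - (a * cnj x + b * cnj y) * y \<noteq> 0" and l: "l \<noteq> 0"
    and sw: "a * cnj (a * cnj x + b * cnj y) + b * cnj (c * cnj x + e * cnj y) = l * x"
    "c * cnj (a * cnj x + b * cnj y) + e * cnj (c * cnj x + e * cnj y) = l * y"
    using swapped_vector_exists[OF d n det comm[unfolded T \<phi>]] by metis
  let ?p = "a * cnj x + b * cnj y" and ?q = "c * cnj x + e * cnj y"
  define r where "r = complex_of_real (sqrt (norm l))"
  define k where "k = l / of_real (norm l)"
  have r0: "r \<noteq> 0" and cr: "cnj r = r" using l by (simp_all add: r_def)
  have "r * r = complex_of_real (norm l)" unfolding r_def by (simp flip: of_real_mult)
  then have krr: "k * (r * r) = l" using l by (simp add: k_def)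
  have nk: "norm k = 1" using l by (simp add: k_def norm_divide)
  \<comment> \<open>In the basis of the vector and its image the map interchanges \<open>0\<close> and \<open>\<infinity>\<close>.\<close>
  define N where "N = mob (r * x) ?p (r * y) ?q"
  have "r * x * ?q - ?p * (r * y) = r * (x * ?q - ?p * y)" by (simp add: algebra_simps)
  then have detN: "r * x * ?q - ?p * (r * y) \<noteq> 0" using r0 xy by simp
  then have N: "N \<in> PSL2" unfolding N_def by (rule mob_in_PSL2)
  have swap: "T \<circ> J \<circ> N = N \<circ> (mob 0 k 1 0 \<circ> J)"
  proof (rule sphere_fun_eqI)
    fix u v :: complex assume uv: "u \<noteq> 0 \<or> v \<noteq> 0"
    define u' v' where uv': "u' = cnj u" "v' = cnj v"
    have uv'0: "u' \<noteq> 0 \<or> v' \<noteq> 0" and kv: "k * v' \<noteq> 0 \<or> u' \<noteq> 0" using uv nk by (auto simp: uv')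
    have det1: "r * cnj x * cnj ?q - cnj ?p * (r * cnj y) \<noteq> 0" using detN cr
      by (metis complex_cnj_cnj complex_cnj_diff complex_cnj_mult complex_cnj_zero_iff)
    have "(T \<circ> J \<circ> N) (hpt u v) = T (hpt (r * cnj x * u' + cnj ?p * v') (r * cnj y * u' + cnj ?q * v'))"
      unfolding N_def comp_def mob_hpt[OF uv] J_hpt by (simp add: uv' cr)
    also have "\<dots> = hpt (a * (r * cnj x * u' + cnj ?p * v') + b * (r * cnj y * u' + cnj ?q * v'))
        (c * (r * cnj x * u' + cnj ?p * v') + e * (r * cnj y * u' + cnj ?q * v'))"
      unfolding T by (rule mob_hpt) (rule linear_nonzero[OF det1 uv'0])
    also have "a * (r * cnj x * u' + cnj ?p * v') + b * (r * cnj y * u' + cnj ?q * v') = r * ?p * u' + (a * cnj ?p + b * cnj ?q) * v'"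
      by (simp add: algebra_simps)
    also have "c * (r * cnj x * u' + cnj ?p * v') + e * (r * cnj y * u' + cnj ?q * v') = r * ?q * u' + (c * cnj ?p + e * cnj ?q) * v'"
      by (simp add: algebra_simps)
    also have "hpt (r * ?p * u' + (a * cnj ?p + b * cnj ?q) * v') (r * ?q * u' + (c * cnj ?p + e * cnj ?q) * v')
        = hpt (r * (r * x * (k * v') + ?p * u')) (r * (r * y * (k * v') + ?q * u'))"
      unfolding sw krr[symmetric] by (simp add: algebra_simps)
    also have "\<dots> = hpt (r * x * (k * v') + ?p * u') (r * y * (k * v') + ?q * u')" by (rule hpt_scale[OF r0])
    also have "\<dots> = N (hpt (k * v') u')" unfolding N_def by (rule mob_hpt[OF kv, symmetric])
    also have "\<dots> = (N \<circ> (mob 0 k 1 0 \<circ> J)) (hpt u v)"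
      using uv'0 by (simp add: J_hpt mob_hpt uv')
    finally show "(T \<circ> J \<circ> N) (hpt u v) = (N \<circ> (mob 0 k 1 0 \<circ> J)) (hpt u v)" .
  qed
  define S where "S = Hilbert_Choice.inv N"
  have "bij N" using N by (rule PSL2_bij)
  then have "S \<circ> N = id" "Hilbert_Choice.inv S = N" unfolding S_def by (simp_all add: bij_is_inj inv_inv_eq)
  moreover have "S \<circ> (T \<circ> J) \<circ> N = (S \<circ> N) \<circ> (mob 0 k 1 0 \<circ> J)"
    using fun_cong[OF swap] by (simp add: fun_eq_iff)
  ultimately have "S \<circ> (T \<circ> J) \<circ> Hilbert_Choice.inv S = mob 0 k 1 0 \<circ> J" by simp
  moreover have "S \<in> PSL2" unfolding S_def by (rule PSL2_inv[OF N])
  ultimately show ?thesis using that nk by blast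
qed

lemma conj_commutes:
  assumes "bij S" "Q \<circ> \<phi> = \<phi> \<circ> Q"
  shows "(S \<circ> Q \<circ> Hilbert_Choice.inv S) \<circ> (S \<circ> \<phi> \<circ> Hilbert_Choice.inv S)
     = (S \<circ> \<phi> \<circ> Hilbert_Choice.inv S) \<circ> (S \<circ> Q \<circ> Hilbert_Choice.inv S)"
  using fun_cong[OF assms(2)] bij_is_inj[OF assms(1)] by (auto simp: fun_eq_iff)

section \<open>Maps commuting with a reflection\<close>

text \<open>Numerator and (for \<open>colin\<close>) denominator of the Blaschke product with zeros \<open>as\<close>.\<close>

definition lin :: "complex list \<Rightarrow> complex poly" where
  "lin as = prod_list (map (\<lambda>a. [:- a, 1:]) as)"

definition colin :: "complex list \<Rightarrow> complex poly" where
  "colin as = prod_list (map (\<lambda>a. [:1, - cnj a:]) as)"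

text \<open>The Blaschke product with zeros \<open>as\<close>, divided by the one with zeros \<open>bs\<close>, times \<open>u\<close>.\<close>

definition blaschke :: "complex \<Rightarrow> complex list \<Rightarrow> complex list \<Rightarrow> sphere \<Rightarrow> sphere" where
  "blaschke u as bs = quotient_fun (length as + length bs) (Polynomial.smult u (lin as * colin bs)) (colin as * lin bs)"

text \<open>Disjointness of \<open>as\<close> and \<open>bs\<close> prevents cancellation, so the degree is the number of
  entries.\<close>

definition blaschke_data :: "complex \<Rightarrow> complex list \<Rightarrow> complex list \<Rightarrow> bool" where
  "blaschke_data u as bs \<longleftrightarrow> norm u = 1 \<and> (\<forall>a\<in>set as. norm a < 1) \<and> (\<forall>b\<in>set bs. norm b < 1) \<and> set as \<inter> set bs = {}"

lemma degree_lin: "degree (lin as) \<le> length as"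
  unfolding lin_def using degree_prod_list_le[of "map (\<lambda>a. [:- a, 1:]) as"]
  by (simp add: comp_def sum_list_triv)

lemma degree_colin: "degree (colin as) \<le> length as"
proof (induction as)
  case (Cons a as)
  have "degree (colin (a # as)) \<le> degree [:1, - cnj a:] + degree (colin as)"
    using degree_mult_le[of "[:1, - cnj a:]" "colin as"] by (simp add: colin_def)
  also have "\<dots> \<le> 1 + length as" using Cons by (intro add_mono) auto
  finally show ?case by simp
qed (simp add: colin_def)

lemma hform_lin: "hform (length as) (lin as) x y = prod_list (map (\<lambda>a. x - a * y) as)"
proof (induction as)
  case (Cons a as)
  have "hform (1 + length as) ([:- a, 1:] * lin as) x y = hform 1 [:- a, 1:] x y * hform (length as) (lin as) x y"
    by (rule hform_mult) (auto simp: degree_lin)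
  then show ?case using Cons by (simp add: lin_def hform_linear[unfolded One_nat_def])
qed (simp add: lin_def hform_def)

lemma hform_colin: "hform (length as) (colin as) x y = prod_list (map (\<lambda>a. y - cnj a * x) as)"
proof (induction as)
  case (Cons a as)
  have "hform (1 + length as) ([:1, - cnj a:] * colin as) x y = hform 1 [:1, - cnj a:] x y * hform (length as) (colin as) x y"
    by (rule hform_mult) (auto simp: degree_colin)
  then show ?case using Cons by (simp add: colin_def hform_linear[unfolded One_nat_def])
qed (simp add: colin_def hform_def)

lemma hform_blaschke:
  "hform (length as + length bs) (lin as * colin bs) x y =
     prod_list (map (\<lambda>a. x - a * y) as) * prod_list (map (\<lambda>a. y - cnj a * x) bs)"
  "hform (length as + length bs) (colin as * lin bs) x y =
     prod_list (map (\<lambda>a. y - cnj a * x) as) * prod_list (map (\<lambda>a. x - a * y) bs)"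
  by (simp_all add: hform_mult degree_lin degree_colin hform_lin hform_colin)

lemma degree_blaschke:
  "degree (lin as * colin bs) \<le> length as + length bs" "degree (colin as * lin bs) \<le> length as + length bs"
  using degree_mult_le[of "lin as" "colin bs"] degree_mult_le[of "colin as" "lin bs"]
    degree_lin[of as] degree_colin[of bs] degree_lin[of bs] degree_colin[of as] by linarith+

lemma prod_list_cnj: "cnj (prod_list (map f xs)) = prod_list (map (\<lambda>x. cnj (f x)) xs)"
  by (induction xs) auto

lemma prod_list_zeroD: "prod_list (map f xs) = (0 :: complex) \<Longrightarrow> \<exists>x\<in>set xs. f x = 0"
  by (induction xs) auto

lemma contraction_zero:
  fixes x y :: complex
  assumes "x = a * y" "y = b * x" "norm a < 1" "norm b < 1" shows "x = 0 \<and> y = 0"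
proof -
  have "x = (a * b) * x" by (metis assms(1,2) mult.assoc)
  then have "(1 - a * b) * x = 0" by (simp add: algebra_simps)
  moreover have "norm (a * b) < 1" using assms(3,4) mult_left_le[of "norm b" "norm a"] by (simp add: norm_mult)
  then have "1 - a * b \<noteq> 0" by auto
  ultimately show ?thesis using assms(2) by simp
qed

text \<open>A zero inside the disc and a zero outside cannot coincide: composing the two relations would
  give a contraction.\<close>

lemma nondeg_blaschke:
  assumes "blaschke_data u as bs"
  shows "nondeg (length as + length bs) (Polynomial.smult u (lin as * colin bs)) (colin as * lin bs)"
  unfolding nondeg_def hform_smult hform_blaschke
proof (intro conjI allI impI)
  show "degree (Polynomial.smult u (lin as * colin bs)) \<le> length as + length bs"
    by (rule order_trans[OF degree_smult_le degree_blaschke(1)])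
  show "degree (colin as * lin bs) \<le> length as + length bs" by (rule degree_blaschke)
next
  fix x y
  assume h: "u * (prod_list (map (\<lambda>a. x - a * y) as) * prod_list (map (\<lambda>a. y - cnj a * x) bs)) = 0 \<and>
    prod_list (map (\<lambda>a. y - cnj a * x) as) * prod_list (map (\<lambda>a. x - a * y) bs) = 0"
  have "u \<noteq> 0" using assms by (auto simp: blaschke_data_def)
  with h have 1: "(\<exists>a\<in>set as. x = a * y) \<or> (\<exists>b\<in>set bs. y = cnj b * x)"
    using prod_list_zeroD[of "\<lambda>a. x - a * y" as] prod_list_zeroD[of "\<lambda>a. y - cnj a * x" bs] by auto
  from h have 2: "(\<exists>a\<in>set as. y = cnj a * x) \<or> (\<exists>b\<in>set bs. x = b * y)"
    using prod_list_zeroD[of "\<lambda>a. y - cnj a * x" as] prod_list_zeroD[of "\<lambda>a. x - a * y" bs] by auto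
  have lt: "norm c < 1" if "c \<in> set as \<union> set bs" for c using assms that by (auto simp: blaschke_data_def)
  have "x = 0 \<and> y = 0"
  proof -
    consider a a' where "a \<in> set as" "x = a * y" "a' \<in> set as" "y = cnj a' * x"
      | a b where "a \<in> set as" "x = a * y" "b \<in> set bs" "x = b * y"
      | a b where "b \<in> set bs" "y = cnj b * x" "a \<in> set as" "y = cnj a * x"
      | b b' where "b \<in> set bs" "y = cnj b * x" "b' \<in> set bs" "x = b' * y"
      using 1 2 by blast
    then show ?thesis
    proof cases
      case 1
      show ?thesis by (rule contraction_zero[OF 1(2) 1(4)]) (use lt[of a] lt[of a'] 1(1,3) in auto)
    next
      case 2
      have "a \<noteq> b" using assms 2(1,3) by (auto simp: blaschke_data_def)
      moreover have "a * y = b * y" by (rule trans[OF 2(2)[symmetric] 2(4)])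
      ultimately have "y = 0" by simp
      with 2(2) show ?thesis by simp
    next
      case 3
      have "a \<noteq> b" using assms 3(1,3) by (auto simp: blaschke_data_def)
      moreover have "cnj a * x = cnj b * x" by (rule trans[OF 3(4)[symmetric] 3(2)])
      ultimately have "x = 0" by simp
      with 3(2) show ?thesis by simp
    next
      case 4
      show ?thesis by (rule contraction_zero[OF 4(4) 4(2)]) (use lt[of b'] lt[of b] 4(1,3) in auto)
    qed
  qed
  then show "x = 0" "y = 0" by auto
qed

lemma blaschke_rat: "blaschke_data u as bs \<Longrightarrow> is_rat (length as + length bs) (blaschke u as bs)"
  unfolding blaschke_def by (rule is_ratI[OF nondeg_blaschke])

lemma blaschke_commutes:
  assumes v: "blaschke_data u as bs"
  shows "mob 0 1 1 0 \<circ> J \<circ> blaschke u as bs = blaschke u as bs \<circ> (mob 0 1 1 0 \<circ> J)"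
proof (rule sphere_fun_eqI)
  fix x y :: complex assume xy: "x \<noteq> 0 \<or> y \<noteq> 0"
  define f where "f x y = prod_list (map (\<lambda>a. x - a * y) as) * prod_list (map (\<lambda>a. y - cnj a * x) bs)" for x y
  define g where "g x y = prod_list (map (\<lambda>a. y - cnj a * x) as) * prod_list (map (\<lambda>a. x - a * y) bs)" for x y
  note nd = nondeg_blaschke[OF v]
  have b: "blaschke u as bs (hpt x y) = hpt (u * f x y) (g x y)" if "x \<noteq> 0 \<or> y \<noteq> 0" for x y
    unfolding blaschke_def quotient_fun_hpt[OF nondeg_degree[OF nd] that] hform_smult hform_blaschke f_def g_def ..
  have nz: "u * f x y \<noteq> 0 \<or> g x y \<noteq> 0"
    using nondeg_hform[OF nd xy] unfolding hform_smult hform_blaschke f_def g_def .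
  have xy': "cnj y \<noteq> 0 \<or> cnj x \<noteq> 0" using xy by auto
  have sym: "f (cnj y) (cnj x) = cnj (g x y)" "g (cnj y) (cnj x) = cnj (f x y)"
    by (simp_all add: f_def g_def prod_list_cnj)
  have uu: "u * cnj u = 1" using v by (simp add: blaschke_data_def flip: complex_norm_square)
  have "(mob 0 1 1 0 \<circ> J \<circ> blaschke u as bs) (hpt x y) = hpt (cnj (g x y)) (cnj u * cnj (f x y))"
    using nz by (simp add: b[OF xy] J_hpt mob_hpt)
  also have "\<dots> = hpt (u * cnj (g x y)) (u * (cnj u * cnj (f x y)))"
    using uu by (intro hpt_scale[symmetric]) auto
  also have "u * (cnj u * cnj (f x y)) = cnj (f x y)" using uu by (metis mult.assoc mult_1)
  also have "hpt (u * cnj (g x y)) (cnj (f x y)) = (blaschke u as bs \<circ> (mob 0 1 1 0 \<circ> J)) (hpt x y)"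
    using xy' xy by (simp add: J_hpt mob_hpt b[OF xy'] sym)
  finally show "(mob 0 1 1 0 \<circ> J \<circ> blaschke u as bs) (hpt x y) = (blaschke u as bs \<circ> (mob 0 1 1 0 \<circ> J)) (hpt x y)" .
qed

lemma blaschke_real_point:
  assumes "blaschke_data u as bs" "length as + length bs = d" "d \<ge> 1"
  shows "orbit (blaschke u as bs) \<in> real_points d"
  using blaschke_rat[OF assms(1)] blaschke_commutes[OF assms(1)] assms(2,3)
  by (intro real_pointI[of d _ "mob 0 1 1 0"] mob_in_PSL2) auto

lemma convex_affine_disc: "convex {z :: complex. norm (k + z * m) < 1}"
proof (rule convexI)
  fix x y :: complex and u v :: real
  assume h: "x \<in> {z. norm (k + z * m) < 1}" "y \<in> {z. norm (k + z * m) < 1}" "0 \<le> u" "0 \<le> v" "u + v = 1"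
  have "k = of_real (u + v) * k" using h by simp
  then have "k + (u *\<^sub>R x + v *\<^sub>R y) * m = u *\<^sub>R (k + x * m) + v *\<^sub>R (k + y * m)"
    by (simp add: scaleR_conv_of_real algebra_simps)
  also have "norm \<dots> \<le> u * norm (k + x * m) + v * norm (k + y * m)"
    using h by (intro order_trans[OF norm_triangle_ineq]) auto
  also have "\<dots> < 1" using h by (intro convex_bound_lt) auto
  finally show "u *\<^sub>R x + v *\<^sub>R y \<in> {z. norm (k + z * m) < 1}" by simp
qed

text \<open>All parameters are moved at once along \<open>a \<mapsto> z * a\<close> and \<open>b \<mapsto> 1 / 2 + z * (b - 1 / 2)\<close> with a
  complex parameter \<open>z\<close>, while \<open>u\<close> runs over the unit circle. The values of \<open>z\<close> that keep the
  parameters in the disc form a convex open set, and collisions between zeros and poles occur only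
  at finitely many \<open>z\<close>, whose removal leaves it connected. The choice of \<open>1 / 2\<close> keeps the two
  target points apart.\<close>

lemma blaschke_linked_base:
  assumes v: "blaschke_data u as bs" and d: "d = length as + length bs" "d \<ge> 1"
  shows "linked d (orbit (blaschke u as bs))
    (orbit (blaschke 1 (replicate (length as) 0) (replicate (length bs) (1 / 2))))"
proof -
  define U where "U = (\<Inter>a\<in>set as. {z. norm (0 + z * a) < 1}) \<inter> (\<Inter>b\<in>set bs. {z. norm (1 / 2 + z * (b - 1 / 2)) < 1})"
  define F where "F = (\<Union>a\<in>set as. \<Union>b\<in>set bs. {z. z * a = 1 / 2 + z * (b - 1 / 2)})"
  have "convex U" unfolding U_def by (intro convex_Int convex_INT convex_affine_disc)
  moreover have "open U" unfolding U_def
    by (intro open_Int open_INT finite_set ballI open_Collect_less continuous_intros)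
  moreover have "finite F" unfolding F_def
  proof (intro finite_UN_I finite_set)
    fix a b :: complex
    have "{z. z * a = 1 / 2 + z * (b - 1 / 2)} \<subseteq> {1 / 2 / (a - (b - 1 / 2))}"
    proof
      fix z assume "z \<in> {z. z * a = 1 / 2 + z * (b - 1 / 2)}"
      then have "z * (a - (b - 1 / 2)) = 1 / 2" by (simp add: algebra_simps)
      moreover from this have "a - (b - 1 / 2) \<noteq> 0" by auto
      ultimately show "z \<in> {1 / 2 / (a - (b - 1 / 2))}" by (metis nonzero_mult_div_cancel_right singleton_iff)
    qed
    then show "finite {z. z * a = 1 / 2 + z * (b - 1 / 2)}" by (rule finite_subset) simp
  qed
  ultimately have "connected (U - F)"
    by (intro connected_open_diff_countable convex_connected countable_finite) auto
  then have conn: "connected (sphere (0::complex) 1 \<times> (U - F))"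
    by (intro connected_Times connected_sphere) auto
  define as' where "as' z = map (\<lambda>a. z * a) as" for z
  define bs' where "bs' z = map (\<lambda>b. 1 / 2 + z * (b - 1 / 2)) bs" for z
  have v': "blaschke_data (fst t) (as' (snd t)) (bs' (snd t))" if "t \<in> sphere (0::complex) 1 \<times> (U - F)" for t
    using that by (auto simp: blaschke_data_def as'_def bs'_def U_def F_def)
  have len: "length (as' z) + length (bs' z) = d" for z by (simp add: as'_def bs'_def d)
  define P where "P t = Polynomial.smult (fst t) (lin (as' (snd t)) * colin (bs' (snd t)))" for t
  define Q where "Q t = colin (as' (snd t)) * lin (bs' (snd t))" for t :: "complex \<times> complex"
  have maps: "blaschke (fst t) (as' (snd t)) (bs' (snd t)) = quotient_fun d (P t) (Q t)" for t
    unfolding blaschke_def len P_def Q_def ..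
  have "linked d (orbit (quotient_fun d (P (u, 1)) (Q (u, 1)))) (orbit (quotient_fun d (P (1, 0)) (Q (1, 0))))"
  proof (rule linked_family[OF d(2) conn])
    show "cont_poly (sphere (0::complex) 1 \<times> (U - F)) P" "cont_poly (sphere (0::complex) 1 \<times> (U - F)) Q"
      unfolding P_def Q_def lin_def colin_def as'_def bs'_def map_map comp_def
      by (intro cont_poly_intros cont_poly_prod_list continuous_intros)+
    show "nondeg d (P t) (Q t)" if "t \<in> sphere (0::complex) 1 \<times> (U - F)" for t
      using nondeg_blaschke[OF v'[OF that]] unfolding len P_def Q_def .
    show "orbit (quotient_fun d (P t) (Q t)) \<in> real_points d" if "t \<in> sphere (0::complex) 1 \<times> (U - F)" for t
      using blaschke_real_point[OF v'[OF that] len d(2)] unfolding maps .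
    show "(u, 1) \<in> sphere (0::complex) 1 \<times> (U - F)" "(1, 0) \<in> sphere (0::complex) 1 \<times> (U - F)"
      using v by (auto simp: blaschke_data_def U_def F_def dist_norm)
  qed
  moreover have "as' 1 = as" "bs' 1 = bs" "as' 0 = replicate (length as) 0" "bs' 0 = replicate (length bs) (1 / 2)"
    by (simp_all add: as'_def bs'_def map_replicate_const)
  ultimately show ?thesis unfolding maps[symmetric] by simp
qed

text \<open>The chosen member of the connected family of Blaschke quotients with \<open>j\<close> poles in the disc.\<close>

definition base_point :: "nat \<Rightarrow> nat \<Rightarrow> (sphere \<Rightarrow> sphere) set" where
  "base_point d j = orbit (blaschke 1 (replicate (d - j) 0) (replicate j (1 / 2)))"

lemma blaschke_linked:
  assumes "blaschke_data u as bs" "length as + length bs = d" "d \<ge> 1"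
  shows "linked d (orbit (blaschke u as bs)) (base_point d (length bs))"
proof -
  have "d - length bs = length as" using assms(2) by simp
  then show ?thesis using blaschke_linked_base[OF assms(1) assms(2)[symmetric] assms(3)] by (simp add: base_point_def)
qed

section \<open>Passing between the families\<close>

lemma quotient_fun_smult: "c \<noteq> 0 \<Longrightarrow> quotient_fun d (Polynomial.smult c P) (Polynomial.smult c Q) = quotient_fun d P Q"
proof
  fix s assume "c \<noteq> 0"
  then show "quotient_fun d (Polynomial.smult c P) (Polynomial.smult c Q) s = quotient_fun d P Q s"
    by (cases s) auto
qed

lemma cpoly_mult: "cpoly (P * Q) = cpoly P * cpoly Q"
  by (rule poly_eqI) (simp add: coeff_mult)

lemma cpoly_power: "cpoly (P ^ n) = cpoly P ^ n"
  by (induction n) (simp_all add: cpoly_mult, simp add: cpoly_def)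

lemma cpoly_pCons: "cpoly (pCons a P) = pCons (cnj a) (cpoly P)"
  by (rule poly_eqI) (simp add: coeff_pCons split: nat.split)

lemma cpoly_0: "cpoly 0 = 0" by (simp add: cpoly_def)

lemma cpoly_1: "cpoly 1 = 1" by (simp add: cpoly_def)

lemma cpoly_add: "cpoly (P + Q) = cpoly P + cpoly Q" by (rule poly_eqI) simp

lemma cpoly_diff: "cpoly (P - Q) = cpoly P - cpoly Q" by (rule poly_eqI) simp

lemma cpoly_minus: "cpoly (- P) = - cpoly P" by (rule poly_eqI) simp

lemma cpoly_smult: "cpoly (Polynomial.smult c P) = Polynomial.smult (cnj c) (cpoly P)" by (rule poly_eqI) simp

lemma cpoly_monom: "cpoly (monom c n) = monom (cnj c) n" by (rule poly_eqI) (simp add: coeff_monom)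

lemmas cpoly_simps = cpoly_mult cpoly_power cpoly_pCons cpoly_0 cpoly_1 cpoly_add cpoly_diff cpoly_minus cpoly_smult cpoly_monom

lemma lin_replicate: "lin (replicate k a) = [:- a, 1:] ^ k"
  by (simp add: lin_def)

lemma colin_replicate: "colin (replicate k a) = [:1, - cnj a:] ^ k"
  by (simp add: colin_def)

lemma lin_append: "lin (as @ bs) = lin as * lin bs" by (simp add: lin_def)

lemma colin_append: "colin (as @ bs) = colin as * colin bs" by (simp add: colin_def)

lemma hform_one: "hform k 1 x y = y ^ k"
  using hform_linear_power[of k 1 0 x y] by (simp flip: one_pCons)

lemma hform_quadratic: "hform 2 [:a, b, c:] x y = a * y ^ 2 + b * x * y + c * x ^ 2"
  by (simp add: hform_def numeral_2_eq_2)

text \<open>Two zeros are moved out of the disc by a path of maps with real coefficients: the factor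
  \<open>(z^2 + s z + t) / (t z^2 - s z + 1)\<close> has both its zeros in the disc at \<open>t = 1 / 2\<close> and both its
  poles there at \<open>t = 2\<close>. The coefficient \<open>s = (t - 1 / 2) * (2 - t)\<close> vanishes at both ends and is
  nonzero at \<open>t = 1\<close>, where the factor would otherwise degenerate.\<close>

lemma base_points_two_apart_linked:
  assumes d: "d = k + j + 2"
  shows "linked d (base_point d j) (base_point d (j + 2))"
proof -
  define s :: "real \<Rightarrow> real" where "s t = (t - 1 / 2) * (2 - t)" for t
  define N where "N t = [:complex_of_real t, of_real (s t), 1:]" for t
  define D where "D t = [:1, - complex_of_real (s t), of_real t:]" for t
  define P where "P t = [:0, 1:] ^ k * [:1, - 1 / 2:] ^ j * N t" for t
  define Q where "Q t = [:- 1 / 2, 1:] ^ j * D t" for t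
  have hP: "hform d (P t) x y = x ^ k * (y - x / 2) ^ j * (of_real t * y ^ 2 + of_real (s t) * x * y + x ^ 2)" for t x y
  proof -
    have "hform ((k + j) + 2) (([:0, 1:] ^ k * [:1, - 1 / 2:] ^ j) * N t) x y
       = hform (k + j) ([:0, 1:] ^ k * [:1, - 1 / 2:] ^ j) x y * hform 2 (N t) x y"
    proof (rule hform_mult)
      show "degree ([:0, 1:] ^ k * [:1, - 1 / 2:] ^ j :: complex poly) \<le> k + j"
        by (intro order_trans[OF degree_mult_le] add_mono degree_linear_power)
    qed (simp add: N_def)
    also have "hform (k + j) ([:0, 1:] ^ k * [:1, - 1 / 2:] ^ j) x y = x ^ k * (y - x / 2) ^ j"
      by (subst hform_mult) (simp_all only: degree_linear_power hform_linear_power, simp)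
    finally show ?thesis by (simp add: P_def d N_def hform_quadratic)
  qed
  have hQ: "hform d (Q t) x y = y ^ k * (x - y / 2) ^ j * (y ^ 2 - of_real (s t) * x * y + of_real t * x ^ 2)" for t x y
  proof -
    have "hform ((k + j) + 2) ((1 * [:- 1 / 2, 1:] ^ j) * D t) x y
       = hform (k + j) (1 * [:- 1 / 2, 1:] ^ j) x y * hform 2 (D t) x y"
    proof (rule hform_mult)
      show "degree (1 * [:- 1 / 2, 1:] ^ j :: complex poly) \<le> k + j"
        using degree_linear_power[of "- 1 / 2 :: complex" 1 j] by simp
    qed (simp add: D_def)
    also have "hform (k + j) (1 * [:- 1 / 2, 1:] ^ j) x y = y ^ k * (x - y / 2) ^ j"
      by (subst hform_mult) (simp_all only: degree_linear_power hform_linear_power degree_1, simp_all add: hform_one)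
    finally show ?thesis by (simp add: Q_def d D_def hform_quadratic algebra_simps)
  qed
  have degs: "degree (P t) \<le> d" "degree (Q t) \<le> d" for t
  proof -
    have "degree (P t) \<le> (k + j) + 2" unfolding P_def
      by (intro order_trans[OF degree_mult_le] add_mono degree_linear_power) (simp add: N_def)
    then show "degree (P t) \<le> d" by (simp add: d)
    have "degree (Q t) \<le> j + 2" unfolding Q_def
      by (intro order_trans[OF degree_mult_le] add_mono degree_linear_power) (simp add: D_def)
    then show "degree (Q t) \<le> d" by (simp add: d)
  qed
  have nd: "nondeg d (P t) (Q t)" if t: "t \<in> {1 / 2..2}" for t
  proof -
    have s0: "s t \<ge> 0" using t by (simp add: s_def)
    have "0 \<le> (t - 5 / 4) ^ 2" by simp
    also have "(t - 5 / 4) ^ 2 = 9 / 16 - s t" by (simp add: s_def power2_eq_square field_simps)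
    finally have s1: "s t \<le> 9 / 16" by simp
    have pos1: "complex_of_real (4 * t + 2 * s t + 1) \<noteq> 0" and pos2: "complex_of_real (1 / 4 - s t / 2 + t) \<noteq> 0"
      using t s0 s1 by (simp_all only: of_real_eq_0_iff) auto
    have key: "x = 0 \<and> y = 0" if h: "hform d (P t) x y = 0 \<and> hform d (Q t) x y = 0" for x y
    proof -
    have P0: "x = 0 \<or> y = x / 2 \<or> of_real t * y ^ 2 + of_real (s t) * x * y + x ^ 2 = 0"
      using h unfolding hP by auto
    have Q0: "y = 0 \<or> x = y / 2 \<or> y ^ 2 - of_real (s t) * x * y + of_real t * x ^ 2 = 0"
      using h unfolding hQ by auto
    have t0: "complex_of_real t \<noteq> 0" using t by auto
    show ?thesis
    proof (cases "x = 0 \<or> y = 0")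
      case True
      then show ?thesis using P0 Q0 t0 by auto
    next
      case False
      then have xy: "x \<noteq> 0" "y \<noteq> 0" by auto
      consider "y = x / 2" "x = y / 2" | "y = x / 2" "y ^ 2 - of_real (s t) * x * y + of_real t * x ^ 2 = 0"
        | "x = y / 2" "of_real t * y ^ 2 + of_real (s t) * x * y + x ^ 2 = 0"
        | "of_real t * y ^ 2 + of_real (s t) * x * y + x ^ 2 = 0" "y ^ 2 - of_real (s t) * x * y + of_real t * x ^ 2 = 0"
        using P0 Q0 xy by blast
      then show ?thesis
      proof cases
        case 1 then show ?thesis using xy by (simp add: field_simps)
      next
        case 2
        have "complex_of_real (1 / 4 - s t / 2 + t) * x ^ 2 = y ^ 2 - of_real (s t) * x * y + of_real t * x ^ 2"
          unfolding 2(1) by (simp add: power2_eq_square field_simps)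
        then have "complex_of_real (1 / 4 - s t / 2 + t) * x ^ 2 = 0" unfolding 2(2) .
        then have "x ^ 2 = 0" using pos2 by (simp only: mult_eq_0_iff) blast
        with xy show ?thesis by simp
      next
        case 3
        have y: "y = 2 * x" using 3(1) by (simp add: field_simps)
        have "complex_of_real (4 * t + 2 * s t + 1) * x ^ 2 = of_real t * y ^ 2 + of_real (s t) * x * y + x ^ 2"
          unfolding y by (simp add: power2_eq_square algebra_simps)
        then have "complex_of_real (4 * t + 2 * s t + 1) * x ^ 2 = 0" unfolding 3(2) .
        then have "x ^ 2 = 0" using pos1 by (simp only: mult_eq_0_iff) blast
        with xy show ?thesis by simp
      next
        case 4
        have "complex_of_real (1 + t) * (x ^ 2 + y ^ 2) =
          (of_real t * y ^ 2 + of_real (s t) * x * y + x ^ 2) + (y ^ 2 - of_real (s t) * x * y + of_real t * x ^ 2)"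
          by (simp add: algebra_simps)
        then have "complex_of_real (1 + t) * (x ^ 2 + y ^ 2) = 0" unfolding 4 by simp
        moreover have "complex_of_real (1 + t) \<noteq> 0" using t by (simp only: of_real_eq_0_iff) auto
        ultimately have x2: "x ^ 2 = - (y ^ 2)" by (simp add: eq_neg_iff_add_eq_0)
        have "y * (complex_of_real (t - 1) * y + of_real (s t) * x) = 0"
          using 4(1) unfolding x2 by (simp add: power2_eq_square algebra_simps)
        then have lin: "complex_of_real (t - 1) * y = - (of_real (s t) * x)" using xy by (simp add: eq_neg_iff_add_eq_0)
        have "complex_of_real (t - 1) ^ 2 * y ^ 2 = (complex_of_real (t - 1) * y) ^ 2" by (simp add: power_mult_distrib)
        also have "\<dots> = - (of_real (s t) ^ 2 * y ^ 2)" unfolding lin by (simp add: power_mult_distrib x2)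
        finally have "complex_of_real ((t - 1) ^ 2 + (s t) ^ 2) * y ^ 2 = 0" by (simp add: algebra_simps)
        then have "complex_of_real ((t - 1) ^ 2 + (s t) ^ 2) = 0" using xy by simp
        then have "(t - 1) ^ 2 + (s t) ^ 2 = 0" by (simp only: of_real_eq_0_iff)
        then have "t - 1 = 0 \<and> s t = 0" by (simp only: sum_power2_eq_zero_iff)
        moreover have "s 1 = 1 / 2" by (simp add: s_def)
        ultimately show ?thesis by auto
      qed
    qed
    qed
    then show ?thesis unfolding nondeg_def using degs by blast
  qed
  have "linked d (orbit (quotient_fun d (P (1 / 2)) (Q (1 / 2)))) (orbit (quotient_fun d (P 2) (Q 2)))"
  proof (rule linked_real_family[of d "{1 / 2..2}" P Q])
    show "cont_poly {1 / 2..2} P" "cont_poly {1 / 2..2} Q" unfolding P_def Q_def N_def D_def s_def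
      by (intro cont_poly_intros continuous_intros)+
    show "cpoly (P t) = P t" "cpoly (Q t) = Q t" for t
      by (simp_all add: P_def Q_def N_def D_def cpoly_simps)
  qed (use d nd in auto)
  \<comment> \<open>At the two ends the quadratic factors have the zeros \<open>w\<close> and \<open>- w\<close> with \<open>w^2 = - 1 / 2\<close>.\<close>
  moreover define w where "w = \<i> / complex_of_real (sqrt 2)"
  have "complex_of_real (sqrt 2) * complex_of_real (sqrt 2) = complex_of_real (sqrt 2 * sqrt 2)" by (simp only: of_real_mult)
  then have ss: "complex_of_real (sqrt 2) * complex_of_real (sqrt 2) = 2" by simp
  then have ww: "w * w = - 1 / 2" by (simp add: w_def)
  have cw: "cnj w = - w" by (simp add: w_def)
  have nw: "norm w < 1" by (simp add: w_def norm_divide)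
  have w0: "w \<noteq> 0" by (simp add: w_def)
  have wh: "w \<noteq> 1 / 2" "- w \<noteq> 1 / 2"
  proof -
    have "False" if "w = c * (1 / 2)" "c * c = 1" for c :: complex
    proof -
      have "w * w = c * c * (1 / 4)" unfolding that(1) by simp
      then show False using ww that(2) by simp
    qed
    note no = this
    show "w \<noteq> 1 / 2" using no[of 1] by auto
    show "- w \<noteq> 1 / 2"
    proof
      assume "- w = 1 / 2"
      then have "w = (- 1) * (1 / 2)" by (metis minus_minus mult_minus1)
      then show False by (rule no) simp
    qed
  qed
  have lw: "lin [w, - w] = [:1 / 2, 0, 1:]" "colin [w, - w] = [:1, 0, 1 / 2:]"
    using ww by (simp_all add: lin_def colin_def cw)
  have ND: "N (1 / 2) = [:1 / 2, 0, 1:]" "D (1 / 2) = [:1, 0, 1 / 2:]"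
    "N 2 = Polynomial.smult 2 [:1, 0, 1 / 2:]" "D 2 = Polynomial.smult 2 [:1 / 2, 0, 1:]"
    by (simp_all add: N_def D_def s_def)
  have rep: "lin (replicate k 0) = [:0, 1:] ^ k" "colin (replicate k 0) = 1"
    "lin (replicate j (1 / 2)) = [:- 1 / 2, 1:] ^ j" "colin (replicate j (1 / 2)) = [:1, - 1 / 2:] ^ j"
    by (simp_all add: lin_replicate colin_replicate flip: one_pCons)
  have e1: "quotient_fun d (P (1 / 2)) (Q (1 / 2)) = blaschke 1 (replicate k 0 @ [w, - w]) (replicate j (1 / 2))"
  proof -
    have "P (1 / 2) = lin (replicate k 0 @ [w, - w]) * colin (replicate j (1 / 2))"
      "Q (1 / 2) = colin (replicate k 0 @ [w, - w]) * lin (replicate j (1 / 2))"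
      by (simp_all only: P_def Q_def ND lin_append colin_append rep lw mult_1 mult.assoc mult.commute mult.left_commute)
    moreover have "length (replicate k (0::complex) @ [w, - w]) + length (replicate j (1 / 2 :: complex)) = d"
      by (simp add: d)
    ultimately show ?thesis unfolding blaschke_def by (simp only: smult_1_left)
  qed
  have e2: "quotient_fun d (P 2) (Q 2) = blaschke 1 (replicate k 0) (replicate j (1 / 2) @ [w, - w])"
  proof -
    have "P 2 = Polynomial.smult 2 (lin (replicate k 0) * colin (replicate j (1 / 2) @ [w, - w]))"
      "Q 2 = Polynomial.smult 2 (colin (replicate k 0) * lin (replicate j (1 / 2) @ [w, - w]))"
      by (simp_all only: P_def Q_def ND lin_append colin_append rep lw mult_1 mult_smult_right mult.assoc mult.commute mult.left_commute)
    moreover have "length (replicate k (0::complex)) + length (replicate j (1 / 2 :: complex) @ [w, - w]) = d"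
      by (simp add: d)
    ultimately show ?thesis unfolding blaschke_def by (simp only: smult_1_left quotient_fun_smult[of 2, simplified])
  qed
  have v: "blaschke_data 1 (replicate k 0 @ [w, - w]) (replicate j (1 / 2))"
    "blaschke_data 1 (replicate k 0) (replicate j (1 / 2) @ [w, - w])"
    using nw w0 wh by (auto simp: blaschke_data_def)
  have "linked d (orbit (quotient_fun d (P (1 / 2)) (Q (1 / 2)))) (base_point d j)"
    using blaschke_linked[OF v(1), of d] d unfolding e1 by simp
  moreover have "linked d (orbit (quotient_fun d (P 2) (Q 2))) (base_point d (j + 2))"
    using blaschke_linked[OF v(2), of d] d unfolding e2 by simp
  ultimately show ?thesis by (blast intro: linked_trans linked_sym)
qed

lemma nondeg_power_one: "nondeg d ([:0, 1:] ^ d) 1"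
  unfolding nondeg_def hform_linear_power hform_one by (auto simp: degree_linear_power)

lemma blaschke_power:
  assumes "d \<ge> 1" "norm u = 1"
  shows "blaschke u (replicate d 0) [] = quotient_fun d (Polynomial.smult u ([:0, 1:] ^ d)) 1"
    "blaschke u [] (replicate d 0) = quotient_fun d (Polynomial.smult u 1) ([:0, 1:] ^ d)"
    "linked d (orbit (quotient_fun d (Polynomial.smult u ([:0, 1:] ^ d)) 1)) (base_point d 0)"
    "linked d (orbit (quotient_fun d (Polynomial.smult u 1) ([:0, 1:] ^ d))) (base_point d d)"
proof -
  show e: "blaschke u (replicate d 0) [] = quotient_fun d (Polynomial.smult u ([:0, 1:] ^ d)) 1"
    "blaschke u [] (replicate d 0) = quotient_fun d (Polynomial.smult u 1) ([:0, 1:] ^ d)"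
    unfolding blaschke_def lin_replicate colin_replicate by (simp_all add: lin_def colin_def flip: one_pCons)
  have "blaschke_data u (replicate d 0) []" "blaschke_data u [] (replicate d 0)"
    using assms by (auto simp: blaschke_data_def)
  then show "linked d (orbit (quotient_fun d (Polynomial.smult u ([:0, 1:] ^ d)) 1)) (base_point d 0)"
    "linked d (orbit (quotient_fun d (Polynomial.smult u 1) ([:0, 1:] ^ d))) (base_point d d)"
    using blaschke_linked[of u "replicate d 0" "[]" d] blaschke_linked[of u "[]" "replicate d 0" d] assms(1)
    unfolding e by simp_all
qed

text \<open>Composing \<open>z ^ d\<close> with the rotations from the identity to \<open>w \<mapsto> - 1 / w\<close>, all with real
  coefficients, turns it into \<open>- 1 / z ^ d\<close>.\<close>

lemma base_points_first_last_linked: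
  assumes d: "d \<ge> 1" shows "linked d (base_point d 0) (base_point d d)"
proof -
  define P where "P t = Polynomial.smult (of_real (1 - t)) ([:0, 1:] ^ d) + Polynomial.smult (- of_real t) (1 :: complex poly)" for t :: real
  define Q where "Q t = Polynomial.smult (of_real t) ([:0, 1:] ^ d) + Polynomial.smult (of_real (1 - t)) (1 :: complex poly)" for t :: real
  have nd: "nondeg d (P t) (Q t)" for t
    unfolding P_def Q_def
  proof (rule nondeg_postcompose[OF nondeg_power_one])
    have "(1 - t) * (1 - t) + t * t \<noteq> 0"
      by (metis add_cancel_right_left diff_zero sum_squares_eq_zero_iff zero_neq_one)
    then have "complex_of_real ((1 - t) * (1 - t) + t * t) \<noteq> 0" by (metis of_real_eq_0_iff)
    then show "complex_of_real (1 - t) * of_real (1 - t) - - of_real t * of_real t \<noteq> 0" by simp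
  qed
  have "linked d (orbit (quotient_fun d (P 0) (Q 0))) (orbit (quotient_fun d (P 1) (Q 1)))"
  proof (rule linked_real_family[of d "{0..1}" P Q])
    show "cont_poly {0..1} P" "cont_poly {0..1} Q" unfolding P_def Q_def
      by (intro cont_poly_intros continuous_intros)+
  qed (use d nd in \<open>auto simp: P_def Q_def cpoly_simps\<close>)
  moreover have "P 0 = Polynomial.smult 1 ([:0, 1:] ^ d)" "Q 0 = 1" "P 1 = Polynomial.smult (- 1) 1" "Q 1 = [:0, 1:] ^ d"
    by (simp_all add: P_def Q_def)
  ultimately show ?thesis
    using blaschke_power(3)[OF d, of 1] blaschke_power(4)[OF d, of "- 1"]
    by (auto intro: linked_trans linked_sym)
qed

text \<open>A first real path leads from \<open>z ^ d\<close> to \<open>(z ^ d + 1) / z ^ (d - 1)\<close>. This map is conjugate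
  over the complex numbers to \<open>(z ^ d - 1) / z ^ (d - 1)\<close>, from where a second real path leads to
  \<open>(z - 1 / 2) / (z ^ (d - 1) * (1 - z / 2))\<close>.\<close>

lemma base_points_first_penultimate_linked:
  assumes d: "d \<ge> 2" shows "linked d (base_point d 0) (base_point d (d - 1))"
proof -
  let ?X = "[:0, 1:] :: complex poly"
  have d1: "d \<ge> 1" and dS: "d = Suc (d - 1)" using d by auto
  have polyX: "poly (?X ^ n) z = z ^ n" for n z by (simp add: poly_power)
  have coeffX: "coeff (?X ^ n) i = (if i = n then 1 else 0)" for n i
    by (simp add: monom_altdef[of 1, simplified, symmetric] coeff_monom)
  have degX: "degree (?X ^ n) \<le> n" for n by (rule degree_linear_power)
  define P1 where "P1 t = ?X ^ d + [:of_real t:]" for t :: real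
  define Q1 where "Q1 t = [:of_real (1 - t):] + Polynomial.smult (of_real t) (?X ^ (d - 1))" for t :: real
  have nd1: "nondeg d (P1 t) (Q1 t)" if t: "t \<in> {0..1}" for t
    unfolding nondeg_iff
  proof (intro conjI allI impI)
    show "degree (P1 t) \<le> d" unfolding P1_def using degX[of d] by (intro degree_add_le) auto
    show "degree (Q1 t) \<le> d" unfolding Q1_def using degX[of "d - 1"]
      by (intro degree_add_le order_trans[OF degree_smult_le]) auto
    show "coeff (P1 t) d \<noteq> 0 \<or> coeff (Q1 t) d \<noteq> 0" using d by (simp add: P1_def coeffX coeff_pCons split: nat.split)
    fix z assume "poly (P1 t) z = 0"
    then have zd: "z ^ d = - of_real t" by (simp add: P1_def polyX add_eq_0_iff)
    show "poly (Q1 t) z \<noteq> 0"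
    proof
      assume "poly (Q1 t) z = 0"
      then have q: "of_real (1 - t) + of_real t * z ^ (d - 1) = 0" by (simp add: Q1_def polyX)
      have "z * (of_real (1 - t) + of_real t * z ^ (d - 1)) = of_real (1 - t) * z + of_real t * z ^ d"
        by (subst (2) dS) (simp add: algebra_simps)
      then have z1: "of_real (1 - t) * z = of_real (t * t)" unfolding q zd by (simp add: algebra_simps)
      show False
      proof (cases "t = 1")
        case True
        then have "z ^ (d - 1) = 0" using q by simp
        then have "z ^ d = 0" by (subst dS) simp
        then show False using zd True by simp
      next
        case False
        then have "complex_of_real (1 - t) \<noteq> 0" by (metis of_real_eq_0_iff eq_iff_diff_eq_0)
        then have "z = of_real (t * t) / of_real (1 - t)" using z1 by (simp add: field_simps)
        then have z: "z = of_real (t * t / (1 - t))" by simp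
        have "of_real ((t * t / (1 - t)) ^ d) = complex_of_real (- t)" using zd unfolding z by simp
        then have "(t * t / (1 - t)) ^ d = - t" by (simp only: of_real_eq_iff)
        moreover have "(t * t / (1 - t)) ^ d \<ge> 0" using t by simp
        ultimately have "t = 0" using t by simp
        then show False using q d by simp
      qed
    qed
  qed
  have "linked d (orbit (quotient_fun d (P1 0) (Q1 0))) (orbit (quotient_fun d (P1 1) (Q1 1)))"
  proof (rule linked_real_family[of d "{0..1}" P1 Q1])
    show "cont_poly {0..1} P1" "cont_poly {0..1} Q1" unfolding P1_def Q1_def
      by (intro cont_poly_intros continuous_intros)+
  qed (use d1 nd1 in \<open>auto simp: P1_def Q1_def cpoly_simps\<close>)
  moreover have "P1 0 = Polynomial.smult 1 (?X ^ d)" "Q1 0 = 1" by (simp_all add: P1_def Q1_def one_pCons)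
  ultimately have A: "linked d (base_point d 0) (orbit (quotient_fun d (P1 1) (Q1 1)))"
    using blaschke_power(3)[OF d1, of 1] by (auto intro: linked_trans linked_sym)
  define P2 where "P2 t = Polynomial.smult (of_real (1 - t)) (?X ^ d - 1) + Polynomial.smult (of_real t) [:- 1 / 2, 1:]" for t :: real
  define Q2 where "Q2 t = ?X ^ (d - 1) * [:1, - of_real (t / 2):]" for t :: real
  have nd2: "nondeg d (P2 t) (Q2 t)" if t: "t \<in> {0..1}" for t
  proof (rule nondeg_swap, unfold nondeg_iff, intro conjI allI impI)
    show "degree (P2 t) \<le> d" unfolding P2_def using degX[of d] d
      by (intro degree_add_le order_trans[OF degree_smult_le] degree_diff_le) auto
    have "degree (Q2 t) \<le> (d - 1) + 1" unfolding Q2_def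
      by (intro order_trans[OF degree_mult_le] add_mono degX) auto
    then show "degree (Q2 t) \<le> d" using d by simp
    have "coeff (Q2 t) ((d - 1) + 1) = coeff (?X ^ (d - 1)) (d - 1) * coeff [:1, - complex_of_real (t / 2):] 1"
      unfolding Q2_def by (rule coeff_mult_top[OF degX]) auto
    then have top: "coeff (Q2 t) d = - of_real (t / 2)" using d by (simp add: coeffX)
    show "coeff (Q2 t) d \<noteq> 0 \<or> coeff (P2 t) d \<noteq> 0"
    proof (cases "t = 0")
      case True
      then show ?thesis using d by (simp add: P2_def coeffX)
    qed (use top in auto)
    fix z assume "poly (Q2 t) z = 0"
    then consider "z = 0" | "z * of_real (t / 2) = 1" by (auto simp: Q2_def polyX)
    then show "poly (P2 t) z \<noteq> 0"
    proof cases
      case 1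
      then have "poly (P2 t) z = of_real (t / 2 - 1)" using d by (simp add: P2_def polyX algebra_simps)
      moreover have "t / 2 - 1 \<noteq> 0" using t by auto
      ultimately show ?thesis by (simp only: of_real_eq_0_iff not_False_eq_True)
    next
      case 2
      then have t0: "t > 0" using t by (cases "t = 0") auto
      then have z: "z = of_real (2 / t)" using 2 by (simp add: field_simps)
      have "poly (P2 t) z = of_real (1 - t) * (z ^ d - 1) + of_real t * (z - 1 / 2)"
        by (simp add: P2_def polyX algebra_simps)
      also have "\<dots> = of_real ((1 - t) * ((2 / t) ^ d - 1) + t * (2 / t - 1 / 2))"
        unfolding z by (simp only: of_real_add of_real_mult of_real_diff of_real_power of_real_1 of_real_divide of_real_numeral)
      finally have "poly (P2 t) z = of_real ((1 - t) * ((2 / t) ^ d - 1) + t * (2 / t - 1 / 2))" .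
      moreover have "(2 / t) ^ d \<ge> 1" by (rule one_le_power) (use t t0 in \<open>simp add: field_simps\<close>)
      then have "(1 - t) * ((2 / t) ^ d - 1) \<ge> 0" using t by (intro mult_nonneg_nonneg) auto
      moreover have "t * (2 / t - 1 / 2) > 0" using t t0 by (simp add: field_simps)
      ultimately show ?thesis using of_real_eq_0_iff[where 'a = complex] by (smt (verit))
    qed
  qed
  have B: "linked d (orbit (quotient_fun d (P2 0) (Q2 0))) (orbit (quotient_fun d (P2 1) (Q2 1)))"
  proof (rule linked_real_family[of d "{0..1}" P2 Q2])
    show "cont_poly {0..1} P2" "cont_poly {0..1} Q2" unfolding P2_def Q2_def
      by ((intro cont_poly_intros continuous_intros; simp)+)
  qed (use d1 nd2 in \<open>auto simp: P2_def Q2_def cpoly_simps\<close>)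
  have e: "quotient_fun d (P2 1) (Q2 1) = blaschke 1 [1 / 2] (replicate (d - 1) 0)"
  proof -
    have "P2 1 = lin [1 / 2] * colin (replicate (d - 1) 0)"
      by (simp add: P2_def lin_def colin_replicate flip: one_pCons)
    moreover have "colin [1 / 2] = [:1, - (1 / 2):]" "lin (replicate (d - 1) 0) = ?X ^ (d - 1)"
      by (simp_all add: colin_def lin_replicate)
    then have "Q2 1 = colin [1 / 2] * lin (replicate (d - 1) 0)"
      by (simp only: Q2_def of_real_divide of_real_1 of_real_numeral mult.commute)
    moreover have "length [1 / 2 :: complex] + length (replicate (d - 1) (0 :: complex)) = d" using d by simp
    ultimately show ?thesis unfolding blaschke_def by (simp only: smult_1_left)
  qed
  have "blaschke_data 1 [1 / 2] (replicate (d - 1) 0)" by (auto simp: blaschke_data_def)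
  then have C: "linked d (orbit (quotient_fun d (P2 1) (Q2 1))) (base_point d (d - 1))"
    unfolding e using blaschke_linked[of 1 "[1 / 2]" "replicate (d - 1) 0" d] d by simp
  \<comment> \<open>The rotation by \<open>w\<close> with \<open>w ^ d = - 1\<close> changes the sign of \<open>z ^ d\<close> and so conjugates the ends of the two paths.\<close>
  define w where "w = cis (pi / real d)"
  have wd: "w ^ d = - 1" using d by (simp add: w_def Complex.DeMoivre)
  have w0: "w \<noteq> 0" by (simp add: w_def)
  let ?T = "mob 1 0 0 w"
  have T: "?T \<in> PSL2" using w0 by (intro mob_in_PSL2) simp
  have "?T \<circ> quotient_fun d (P1 1) (Q1 1) \<circ> Hilbert_Choice.inv ?T = quotient_fun d (P2 0) (Q2 0)"
  proof (rule sphere_fun_eqI)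
    fix x y :: complex assume xy: "x \<noteq> 0 \<or> y \<noteq> 0"
    have nz: "w * x \<noteq> 0 \<or> y \<noteq> 0" using xy w0 by auto
    have inv: "Hilbert_Choice.inv ?T = mob w 0 0 1" using w0 by (subst inv_mob) auto
    have one: "hform d [:1:] x y = y ^ d" for x y using hform_one[of d] by (simp add: one_pCons)
    have X1: "hform ((d - 1) + 1) (?X ^ (d - 1) * 1) x y = x ^ (d - 1) * y" for x y
      by (subst hform_mult) (simp_all only: degX degree_1 hform_linear_power hform_one, simp_all)
    have h1: "hform d (P1 1) x y = x ^ d + y ^ d" "hform d (Q1 1) x y = x ^ (d - 1) * y" for x y
      using X1[of x y] d by (simp_all add: P1_def Q1_def hform_add hform_linear_power one)
    have "P2 0 = ?X ^ d + Polynomial.smult (- 1) 1" "Q2 0 = ?X ^ (d - 1) * 1"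
      by (simp_all add: P2_def Q2_def one_pCons)
    note PQ0 = this
    have h2: "hform d (P2 0) x y = x ^ d - y ^ d" "hform d (Q2 0) x y = x ^ (d - 1) * y" for x y
    proof -
      show "hform d (P2 0) x y = x ^ d - y ^ d"
        unfolding PQ0 hform_add hform_smult hform_linear_power hform_one by simp
      have "d - 1 + 1 = d" using d by simp
      then show "hform d (Q2 0) x y = x ^ (d - 1) * y" using X1[of x y] unfolding PQ0 by simp
    qed
    have "(?T \<circ> quotient_fun d (P1 1) (Q1 1) \<circ> Hilbert_Choice.inv ?T) (hpt x y)
       = ?T (quotient_fun d (P1 1) (Q1 1) (hpt (w * x) y))" unfolding inv using mob_hpt[OF xy, of w 0 0 1] by simp
    also have "\<dots> = ?T (hpt ((w * x) ^ d + y ^ d) ((w * x) ^ (d - 1) * y))"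
      using nondeg_degree[OF nd1[of 1]] by (simp add: quotient_fun_hpt[OF _ _ nz] h1)
    also have "\<dots> = hpt ((w * x) ^ d + y ^ d) (w * ((w * x) ^ (d - 1) * y))"
      using nondeg_hform[OF nd1[of 1] nz] by (subst mob_hpt) (simp_all add: h1)
    also have "(w * x) ^ d + y ^ d = (- 1) * (x ^ d - y ^ d)" by (simp add: power_mult_distrib wd)
    also have "w * ((w * x) ^ (d - 1) * y) = w ^ Suc (d - 1) * (x ^ (d - 1) * y)" by (simp add: power_mult_distrib)
    also have "\<dots> = (- 1) * (x ^ (d - 1) * y)" using dS wd by simp
    also have "hpt ((- 1) * (x ^ d - y ^ d)) ((- 1) * (x ^ (d - 1) * y)) = hpt (x ^ d - y ^ d) (x ^ (d - 1) * y)"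
      by (rule hpt_scale) simp
    also have "\<dots> = quotient_fun d (P2 0) (Q2 0) (hpt x y)"
      using nondeg_degree[OF nd2[of 0]] by (simp add: quotient_fun_hpt[OF _ _ xy] h2)
    finally show "(?T \<circ> quotient_fun d (P1 1) (Q1 1) \<circ> Hilbert_Choice.inv ?T) (hpt x y) = quotient_fun d (P2 0) (Q2 0) (hpt x y)" .
  qed
  then have "orbit (quotient_fun d (P1 1) (Q1 1)) = orbit (quotient_fun d (P2 0) (Q2 0))"
    using orbit_conj[OF T] by metis
  then show ?thesis using A B C by (auto intro: linked_trans)
qed

text \<open>Descending from \<open>d\<close> and \<open>d - 1\<close> in steps of two reaches every index of either parity.\<close>

lemma base_points_linked:
  assumes d: "d \<ge> 2" and "j \<le> d" shows "linked d (base_point d 0) (base_point d j)"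
  using assms(2)
proof (induction "d - j" arbitrary: j rule: less_induct)
  case less
  consider "j = d" | "j = d - 1" | "j + 2 \<le> d" using less.prems by linarith
  then show ?case
  proof cases
    case 1 then show ?thesis using base_points_first_last_linked[of d] d by simp
  next
    case 2 then show ?thesis using base_points_first_penultimate_linked[OF d] by simp
  next
    case 3
    then have "linked d (base_point d 0) (base_point d (j + 2))" by (intro less.hyps) auto
    moreover have "linked d (base_point d j) (base_point d (j + 2))"
      using 3 by (intro base_points_two_apart_linked[of d "d - j - 2" j]) simp
    ultimately show ?thesis by (blast intro: linked_trans linked_sym)
  qed
qed

lemma blaschke_linked_zero:
  assumes "blaschke_data u as bs" "length as + length bs = d" "d \<ge> 2"
  shows "linked d (base_point d 0) (orbit (blaschke u as bs))"
proof -
  have "linked d (orbit (blaschke u as bs)) (base_point d (length bs))"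
    by (rule blaschke_linked[OF assms(1,2)]) (use assms(3) in simp)
  moreover have "linked d (base_point d 0) (base_point d (length bs))"
    by (rule base_points_linked[OF assms(3)]) (use assms(2) in simp)
  ultimately show ?thesis by (blast intro: linked_trans linked_sym)
qed

section \<open>Maps commuting with an antiholomorphic rotation\<close>

text \<open>The map \<open>z \<mapsto> c / cnj z\<close>.\<close>

definition antirot :: "complex \<Rightarrow> sphere \<Rightarrow> sphere" where
  "antirot c = mob 0 c 1 0 \<circ> J"

lemma antirot_hpt: "x \<noteq> 0 \<or> y \<noteq> 0 \<Longrightarrow> antirot c (hpt x y) = hpt (c * cnj y) (cnj x)"
  by (simp add: antirot_def J_hpt mob_hpt)

lemma unit_cnj: "norm c = 1 \<Longrightarrow> c * cnj c = 1"
  by (simp flip: complex_norm_square)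

text \<open>The factor of \<open>equivariance_factor\<close> is unimodular: applying the symmetry twice multiplies
  each monomial of \<open>P\<close> by a power of \<open>c\<close>, and comparing moduli at one nonzero coefficient
  determines that of the factor. The same comparison gives the congruence for the exponents.\<close>

lemma commuting_forms:
  assumes d: "d \<ge> 1" and n: "nondeg d P Q" and c: "norm c = 1"
    and comm: "antirot c \<circ> quotient_fun d P Q = quotient_fun d P Q \<circ> antirot c"
  obtains \<mu> where "norm \<mu> = 1"
    "\<And>x y. hform d P (c * y) x = \<mu> * c * cnj (hform d Q (cnj x) (cnj y))"
    "\<And>x y. hform d Q (c * y) x = \<mu> * cnj (hform d P (cnj x) (cnj y))"
    "\<And>i. coeff P i \<noteq> 0 \<Longrightarrow> c ^ (2 * i) = c ^ (d + 1)"
proof -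
  let ?\<phi> = "quotient_fun d P Q"
  have c0: "c \<noteq> 0" using c by auto
  have cc: "c * cnj c = 1" using c by (rule unit_cnj)
  have "?\<phi> \<circ> mob 0 c 1 0 = mob 0 c 1 0 \<circ> quotient_fun d (cpoly P) (cpoly Q)"
  proof -
    have "?\<phi> \<circ> mob 0 c 1 0 = (?\<phi> \<circ> antirot c) \<circ> J" by (simp add: antirot_def comp_assoc J_J)
    also have "\<dots> = mob 0 c 1 0 \<circ> (J \<circ> ?\<phi> \<circ> J)" unfolding comm[symmetric] by (simp add: antirot_def comp_assoc)
    finally show ?thesis unfolding J_quotient_fun[OF n] .
  qed
  moreover have "0 * 0 - c * 1 \<noteq> 0" using c0 by simp
  ultimately obtain \<mu> where \<mu>: "\<mu> \<noteq> 0"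
    "\<And>x y. hform d P (0 * x + c * y) (1 * x + 0 * y) = \<mu> * (0 * hform d (cpoly P) x y + c * hform d (cpoly Q) x y)"
    "\<And>x y. hform d Q (0 * x + c * y) (1 * x + 0 * y) = \<mu> * (1 * hform d (cpoly P) x y + 0 * hform d (cpoly Q) x y)"
    using equivariance_factor[OF n nondeg_cpoly[OF n] d] by metis
  have A: "hform d P (c * y) x = \<mu> * c * cnj (hform d Q (cnj x) (cnj y))"
    and B: "hform d Q (c * y) x = \<mu> * cnj (hform d P (cnj x) (cnj y))" for x y
    using \<mu>(2)[of x y] \<mu>(3)[of x y] by (simp_all add: hform_cpoly)
  have inv: "hform d P (c * (c * X)) Y = \<mu> * cnj \<mu> * c ^ (d + 1) * hform d P X Y" for X Y
  proof -
    have "c * (cnj c * cnj Y) = cnj Y" by (simp only: mult.assoc[symmetric] cc mult_1)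
    then have "hform d Q (cnj Y) (cnj (c * X)) = hform d Q (c * (cnj c * cnj Y)) (cnj (c * X))" by (simp only:)
    also have "\<dots> = \<mu> * cnj (hform d P (c * X) (c * Y))" unfolding B by simp
    also have "\<dots> = \<mu> * cnj (c ^ d * hform d P X Y)" by (simp add: hform_scale)
    finally show ?thesis unfolding A by simp
  qed
  have "poly (pcompose P [:0, c * c:]) z = poly (Polynomial.smult (\<mu> * cnj \<mu> * c ^ (d + 1)) P) z" for z
    using inv[of z 1] nondeg_degree[OF n] by (simp add: hform_affine poly_pcompose mult_ac)
  then have "pcompose P [:0, c * c:] = Polynomial.smult (\<mu> * cnj \<mu> * c ^ (d + 1)) P"
    by (simp add: poly_eq_poly_eq_iff[symmetric] fun_eq_iff)
  then have co: "(c * c) ^ i * coeff P i = \<mu> * cnj \<mu> * c ^ (d + 1) * coeff P i" for i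
    by (metis coeff_pcompose_linear coeff_smult)
  have "P \<noteq> 0"
  proof
    assume "P = 0"
    then have "hform d P x y = 0" for x y by (simp add: hform_def)
    moreover from this have "hform d Q (c * 1) 1 = 0" unfolding B by simp
    ultimately show False using nondeg_hform[OF n, of "c * 1" 1] by simp
  qed
  then obtain i where "coeff P i \<noteq> 0" by (metis leading_coeff_0_iff)
  then have "(c * c) ^ i = \<mu> * cnj \<mu> * c ^ (d + 1)" using co[of i] by simp
  then have "norm ((c * c) ^ i) = norm (\<mu> * cnj \<mu> * c ^ (d + 1))" by simp
  then have "(norm \<mu>) ^ 2 = 1" using c by (simp add: norm_mult norm_power power2_eq_square)
  then have n\<mu>: "norm \<mu> = 1" by (simp add: power2_eq_1_iff) (smt (verit) norm_ge_zero)
  then have "\<mu> * cnj \<mu> = 1" by (rule unit_cnj)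
  then have "c ^ (2 * i) = c ^ (d + 1)" if "coeff P i \<noteq> 0" for i
    using co[of i] that by (simp add: power_mult power2_eq_square)
  with that n\<mu> A B show ?thesis by blast
qed

lemma lin_partition: "lin (filter p as) * lin (filter (\<lambda>a. \<not> p a) as) = lin as"
proof (induction as)
  case (Cons a as)
  then show ?case by (cases "p a") (simp_all only: lin_def filter.simps list.map prod_list.Cons if_True if_False not_True_eq_False
      not_False_eq_True mult.assoc mult.left_commute)
qed (simp add: lin_def)

lemma lin_inverse_points:
  "(\<And>a. a \<in> set as \<Longrightarrow> a \<noteq> 0) \<Longrightarrow> \<exists>k. k \<noteq> 0 \<and> lin as = Polynomial.smult k (colin (map (\<lambda>a. 1 / cnj a) as))"
proof (induction as)
  case (Cons a as)
  then obtain k where k: "k \<noteq> 0" "lin as = Polynomial.smult k (colin (map (\<lambda>a. 1 / cnj a) as))" by auto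
  have "[:- a, 1:] = Polynomial.smult (- a) [:1, - cnj (1 / cnj a):]" using Cons.prems[of a] by simp
  moreover have "lin (a # as) = [:- a, 1:] * lin as" by (simp only: lin_def list.map prod_list.Cons)
  moreover have "colin (map (\<lambda>a. 1 / cnj a) (a # as)) = [:1, - cnj (1 / cnj a):] * colin (map (\<lambda>a. 1 / cnj a) as)"
    by (simp only: colin_def list.map prod_list.Cons)
  ultimately have "lin (a # as) = Polynomial.smult (k * - a) (colin (map (\<lambda>a. 1 / cnj a) (a # as)))"
    unfolding k(2) by (simp only: mult_smult_left mult_smult_right smult_smult)
  then show ?case using k(1) Cons.prems[of a] by (intro exI[of _ "k * - a"]) simp
qed (auto intro!: exI[of _ 1] simp: lin_def colin_def)

lemma poly_lin_zero: "a \<in> set as \<Longrightarrow> poly (lin as) a = 0"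
  by (induction as) (auto simp: lin_def)

text \<open>The zeros of \<open>P\<close> in the disc become the entries of \<open>as\<close>, the reflections of the other ones
  those of \<open>bs\<close>; a deficit in the degree of \<open>P\<close> stands for zeros at infinity, whose reflections
  are at \<open>0\<close>. A zero on the circle is its own reflection and would be a common zero.\<close>

lemma reflection_commuting_is_blaschke:
  assumes d: "d \<ge> 1" and n: "nondeg d P Q"
    and comm: "antirot 1 \<circ> quotient_fun d P Q = quotient_fun d P Q \<circ> antirot 1"
  shows "\<exists>u as bs. blaschke_data u as bs \<and> length as + length bs = d \<and> quotient_fun d P Q = blaschke u as bs"
proof -
  obtain \<mu> where \<mu>: "norm \<mu> = 1"
    "\<And>x y. hform d P (1 * y) x = \<mu> * 1 * cnj (hform d Q (cnj x) (cnj y))"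
    "\<And>x y. hform d Q (1 * y) x = \<mu> * cnj (hform d P (cnj x) (cnj y))"
    using commuting_forms[OF d n norm_one comm] by metis
  have \<mu>0: "\<mu> \<noteq> 0" using \<mu>(1) by auto
  have unit: "norm a \<noteq> 1" if "poly P a = 0" for a
  proof
    assume a: "norm a = 1"
    have P0: "hform d P a 1 = 0" using that nondeg_degree[OF n] by (simp add: hform_affine)
    then have "hform d Q 1 (cnj a) = 0" using \<mu>(2)[of a 1] \<mu>0 by simp
    moreover have "hform d Q (cnj a * a) (cnj a * 1) = cnj a ^ d * hform d Q a 1" by (rule hform_scale)
    moreover have "cnj a * a = 1" using unit_cnj[OF a] by (simp add: mult.commute)
    moreover have "a \<noteq> 0" using a by auto
    ultimately have "hform d Q a 1 = 0" by simp
    with P0 show False using nondeg_hform[OF n, of a 1] by simp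
  qed
  obtain \<alpha>s where \<alpha>: "Polynomial.smult (lead_coeff P) (lin \<alpha>s) = P" "length \<alpha>s = degree P"
    using fundamental_theorem_algebra_factorized[of P] unfolding lin_def by blast
  have "P \<noteq> 0"
  proof
    assume "P = 0"
    then have "hform d P x y = 0" for x y by (simp add: hform_def)
    moreover from this have "hform d Q (1 * 1) 1 = 0" unfolding \<mu>(3) by simp
    ultimately show False using nondeg_hform[OF n, of 1 1] by simp
  qed
  then have lc: "lead_coeff P \<noteq> 0" by simp
  have unit': "norm a \<noteq> 1" if "a \<in> set \<alpha>s" for a
  proof -
    have "poly (Polynomial.smult (lead_coeff P) (lin \<alpha>s)) a = 0" using poly_lin_zero[OF that] by simp
    then show ?thesis using unit[of a] unfolding \<alpha>(1) by simp
  qed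
  define as \<beta>s where "as = filter (\<lambda>a. norm a < 1) \<alpha>s" and "\<beta>s = filter (\<lambda>a. \<not> norm a < 1) \<alpha>s"
  \<comment> \<open>The zeros outside the disc are reflected; the missing ones lie at \<open>\<infinity>\<close> and are reflected to \<open>0\<close>.\<close>
  define bs where "bs = map (\<lambda>a. 1 / cnj a) \<beta>s @ replicate (d - degree P) 0"
  have \<beta>: "norm b > 1" if "b \<in> set \<beta>s" for b using that unit'[of b] by (auto simp: \<beta>s_def)
  then have "\<And>b. b \<in> set \<beta>s \<Longrightarrow> b \<noteq> 0" by force
  then obtain k where k: "k \<noteq> 0" "lin \<beta>s = Polynomial.smult k (colin (map (\<lambda>a. 1 / cnj a) \<beta>s))"
    using lin_inverse_points by blast
  have "colin (replicate (d - degree P) 0) = 1" by (simp add: colin_replicate flip: one_pCons)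
  then have "lin \<beta>s = Polynomial.smult k (colin bs)" unfolding k(2) bs_def colin_append by simp
  then have "lin \<alpha>s = lin as * Polynomial.smult k (colin bs)"
    using lin_partition[of "\<lambda>a. norm a < 1" \<alpha>s] by (simp add: as_def \<beta>s_def)
  then have P: "P = Polynomial.smult (lead_coeff P * k) (lin as * colin bs)" using \<alpha>(1) by simp
  define e where "e = lead_coeff P * k"
  have e0: "e \<noteq> 0" using lc k(1) by (simp add: e_def)
  have len: "length as + length bs = d"
    using \<alpha>(2) nondeg_degree(1)[OF n] sum_length_filter_compl[of "\<lambda>a. norm a < 1" \<alpha>s]
    by (simp add: as_def bs_def \<beta>s_def)
  have "poly Q z = poly (Polynomial.smult (\<mu> * cnj e) (colin as * lin bs)) z" for z
  proof -
    have "poly Q z = hform d Q (1 * z) 1" using nondeg_degree[OF n] by (simp add: hform_affine)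
    also have "\<dots> = \<mu> * cnj (hform d P 1 (cnj z))" unfolding \<mu>(3) by simp
    also have "hform d P 1 (cnj z) = e * hform d (lin as * colin bs) 1 (cnj z)"
      by (subst P) (simp add: hform_smult e_def)
    also have "cnj \<dots> = cnj e * hform d (colin as * lin bs) z 1"
      unfolding len[symmetric] hform_blaschke by (simp add: prod_list_cnj)
    also have "hform d (colin as * lin bs) z 1 = poly (colin as * lin bs) z"
      by (rule hform_affine) (use degree_blaschke(2)[of as bs] len in simp)
    finally show ?thesis by simp
  qed
  then have Q: "Q = Polynomial.smult (\<mu> * cnj e) (colin as * lin bs)"
    by (simp add: poly_eq_poly_eq_iff[symmetric] fun_eq_iff)
  define u where "u = e / (\<mu> * cnj e)"
  have m0: "\<mu> * cnj e \<noteq> 0" using \<mu>0 e0 by simp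
  have "P = Polynomial.smult (\<mu> * cnj e) (Polynomial.smult u (lin as * colin bs))"
    using P m0 by (simp add: u_def e_def)
  then have "quotient_fun d P Q = quotient_fun d (Polynomial.smult u (lin as * colin bs)) (colin as * lin bs)"
    using Q quotient_fun_smult[OF m0] by metis
  then have eq: "quotient_fun d P Q = blaschke u as bs" unfolding blaschke_def len .
  have "blaschke_data u as bs"
    unfolding blaschke_data_def
  proof (intro conjI ballI)
    show "norm u = 1" using e0 \<mu>(1) by (simp add: u_def norm_divide norm_mult)
    show "norm a < 1" if "a \<in> set as" for a using that by (simp add: as_def)
    have "norm (1 / cnj a) < 1" if "a \<in> set \<beta>s" for a using \<beta>[OF that] by (simp add: norm_divide divide_less_eq)
    then show "norm b < 1" if "b \<in> set bs" for b using that by (auto simp: bs_def)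
    show "set as \<inter> set bs = {}"
    proof (rule ccontr)
      assume "set as \<inter> set bs \<noteq> {}"
      then obtain a where "a \<in> set as" "a \<in> set bs" by blast
      then have "poly P a = 0" "poly Q a = 0" by (subst P Q, simp add: poly_lin_zero)+
      then show False using n by (auto simp: nondeg_iff)
    qed
  qed
  with len eq show ?thesis by blast
qed

text \<open>The square of \<open>antirot c\<close> is the rotation by \<open>c^2\<close>, so \<open>antirot (c ^ (2 * k + 1))\<close> is its
  iterate number \<open>2 * k + 1\<close>.\<close>

lemma antirot_odd_power_commutes:
  assumes c: "norm c = 1" and comm: "antirot c \<circ> \<phi> = \<phi> \<circ> antirot c"
  shows "antirot (c ^ (2 * k + 1)) \<circ> \<phi> = \<phi> \<circ> antirot (c ^ (2 * k + 1))"
proof (induction k)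
  case (Suc k)
  have "antirot (c ^ (2 * Suc k + 1)) = (antirot c \<circ> antirot c) \<circ> antirot (c ^ (2 * k + 1))"
  proof (rule sphere_fun_eqI)
    fix x y :: complex assume xy: "x \<noteq> 0 \<or> y \<noteq> 0"
    have c0: "c \<noteq> 0" using c by auto
    let ?e = "c ^ (2 * k + 1)"
    have nz: "?e * cnj y \<noteq> 0 \<or> cnj x \<noteq> 0" "c * cnj (cnj x) \<noteq> 0 \<or> cnj (?e * cnj y) \<noteq> 0"
      "cnj c * (c * cnj (cnj (?e * cnj y))) \<noteq> 0 \<or> cnj x \<noteq> 0" using xy c0 by auto
    have "((antirot c \<circ> antirot c) \<circ> antirot ?e) (hpt x y) = hpt (c * cnj (cnj (?e * cnj y))) (cnj (c * cnj (cnj x)))"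
      by (simp only: comp_apply antirot_hpt[OF xy] antirot_hpt[OF nz(1)] antirot_hpt[OF nz(2)])
    also have "\<dots> = hpt (c * (c * cnj (cnj (?e * cnj y)))) (c * cnj (c * cnj (cnj x)))"
      by (rule hpt_scale[OF c0, symmetric])
    also have "c * (c * cnj (cnj (?e * cnj y))) = c ^ (2 * Suc k + 1) * cnj y" by simp
    also have "c * cnj (c * cnj (cnj x)) = cnj x" using unit_cnj[OF c] by (simp flip: mult.assoc)
    finally show "antirot (c ^ (2 * Suc k + 1)) (hpt x y) = ((antirot c \<circ> antirot c) \<circ> antirot ?e) (hpt x y)"
      using antirot_hpt[OF xy] by simp
  qed
  note step = this
  show ?case unfolding step by (rule comp_commutes[OF comp_commutes[OF comm comm] Suc.IH])
qed (simp add: comm)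

text \<open>With a single monomial in the numerator, the symmetry leaves a single one in the
  denominator, and the two coefficients have equal modulus; such a power map commutes with the
  reflection in the unit circle.\<close>

lemma monomial_commutes_with_reflection:
  assumes d: "d \<ge> 1" and n: "nondeg d P Q" and c: "norm c = 1"
    and comm: "antirot c \<circ> quotient_fun d P Q = quotient_fun d P Q \<circ> antirot c"
    and mono: "\<And>i j. coeff P i \<noteq> 0 \<Longrightarrow> coeff P j \<noteq> 0 \<Longrightarrow> i = j"
  shows "antirot 1 \<circ> quotient_fun d P Q = quotient_fun d P Q \<circ> antirot 1"
proof -
  obtain \<mu> where \<mu>: "norm \<mu> = 1"
    "\<And>x y. hform d Q (c * y) x = \<mu> * cnj (hform d P (cnj x) (cnj y))"
    using commuting_forms[OF d n c comm] by metis
  define m where "m = degree P"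
  define p where "p = coeff P m"
  have m: "m \<le> d" using nondeg_degree[OF n] by (simp add: m_def)
  have co: "coeff P i = (if i = m then p else 0)" for i
  proof (cases "i = m \<or> coeff P i = 0")
    case False
    then have "P \<noteq> 0" by auto
    then have "coeff P m \<noteq> 0" unfolding m_def by (simp only: leading_coeff_0_iff not_False_eq_True)
    then show ?thesis using mono[of i m] False by blast
  qed (auto simp: p_def)
  have hP: "hform d P x y = p * x ^ m * y ^ (d - m)" for x y
    unfolding hform_def co using m by (simp add: if_distrib[of "\<lambda>t. t * _"] cong: if_cong)
  have cc: "c * cnj c = 1" using c by (rule unit_cnj)
  have hQ: "hform d Q x y = \<mu> * cnj p * cnj c ^ (d - m) * y ^ m * x ^ (d - m)" for x y
  proof -
    have "c * (cnj c * x) = x" by (simp only: mult.assoc[symmetric] cc mult_1)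
    then have "hform d Q x y = hform d Q (c * (cnj c * x)) y" by (simp only:)
    also have "\<dots> = \<mu> * cnj (p * cnj y ^ m * cnj (cnj c * x) ^ (d - m))" unfolding \<mu>(2) hP ..
    finally show ?thesis by (simp add: power_mult_distrib)
  qed
  define q' where "q' = \<mu> * cnj p * cnj c ^ (d - m)"
  have "norm q' = norm p" using \<mu>(1) c by (simp add: q'_def norm_mult norm_power)
  then have qp: "q' * cnj q' = p * cnj p" by (simp flip: complex_norm_square)
  have hQ': "hform d Q x y = q' * y ^ m * x ^ (d - m)" for x y using hQ by (simp add: q'_def)
  show ?thesis
  proof (rule sphere_fun_eqI)
    fix x y :: complex assume xy: "x \<noteq> 0 \<or> y \<noteq> 0"
    have xy': "1 * cnj y \<noteq> 0 \<or> cnj x \<noteq> 0" using xy by auto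
    note nz = nondeg_hform[OF n xy] nondeg_hform[OF n xy']
    have nz1: "1 * cnj (hform d Q x y) \<noteq> 0 \<or> cnj (hform d P x y) \<noteq> 0" using nz by auto
    have L: "(antirot 1 \<circ> quotient_fun d P Q) (hpt x y) = hpt (1 * cnj (hform d Q x y)) (cnj (hform d P x y))"
      by (simp only: comp_apply quotient_fun_hpt[OF nondeg_degree[OF n] xy] antirot_hpt[OF nz(1)])
    have R: "(quotient_fun d P Q \<circ> antirot 1) (hpt x y) = hpt (hform d P (1 * cnj y) (cnj x)) (hform d Q (1 * cnj y) (cnj x))"
      by (simp only: comp_apply antirot_hpt[OF xy] quotient_fun_hpt[OF nondeg_degree[OF n] xy'])
    have "1 * cnj (hform d Q x y) * hform d Q (1 * cnj y) (cnj x)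
        = (q' * cnj q') * (cnj y ^ m * cnj x ^ (d - m) * cnj x ^ m * cnj y ^ (d - m))"
      unfolding hQ' by simp
    also have "\<dots> = hform d P (1 * cnj y) (cnj x) * cnj (hform d P x y)"
      unfolding hP qp by simp
    finally show "(antirot 1 \<circ> quotient_fun d P Q) (hpt x y) = (quotient_fun d P Q \<circ> antirot 1) (hpt x y)"
      unfolding L R by (subst hpt_eq_iff[OF nz1 nz(2)])
  qed
qed

lemma order_of_root_of_unity:
  fixes c :: complex
  assumes "c ^ K = 1" "K > 0"
  obtains N where "N > 0" "c ^ N = 1" "\<And>k. c ^ k = 1 \<Longrightarrow> N dvd k"
proof -
  define N where "N = (LEAST k. k > 0 \<and> c ^ k = 1)"
  have N: "N > 0 \<and> c ^ N = 1" unfolding N_def by (rule LeastI[of _ K]) (use assms in simp)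
  have "N dvd k" if "c ^ k = 1" for k
  proof (rule ccontr)
    assume "\<not> N dvd k"
    then have "k mod N > 0" by (simp add: dvd_eq_mod_eq_0)
    have "c ^ k = (c ^ N) ^ (k div N) * c ^ (k mod N)" by (simp flip: power_mult power_add)
    then have "c ^ (k mod N) = 1" using that N by simp
    with \<open>k mod N > 0\<close> have "N \<le> k mod N" unfolding N_def by (intro Least_le) simp
    then show False using N mod_less_divisor[of N k] by linarith
  qed
  with N that show ?thesis by blast
qed

text \<open>Two exponents \<open>i\<close>, \<open>j\<close> in \<open>P\<close> satisfy \<open>c ^ (2 * (j - i)) = 1\<close>, so \<open>c\<close> is a root of unity
  unless \<open>P\<close> is a monomial, and a monomial map commutes with the reflection. If the order is odd,
  an odd iterate of \<open>antirot c\<close> is the reflection; so the order is \<open>2 * n\<close> and \<open>c ^ n = - 1\<close>.\<close>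

lemma commuting_dichotomy:
  assumes d: "d \<ge> 1" and n: "nondeg d P Q" and c: "norm c = 1"
    and comm: "antirot c \<circ> quotient_fun d P Q = quotient_fun d P Q \<circ> antirot c"
    and noref: "antirot 1 \<circ> quotient_fun d P Q \<noteq> quotient_fun d P Q \<circ> antirot 1"
  obtains n where "n \<ge> 1" "c ^ n = - 1" "\<And>i j. coeff P i \<noteq> 0 \<Longrightarrow> coeff P j \<noteq> 0 \<Longrightarrow> i \<le> j \<Longrightarrow> n dvd (j - i)"
proof -
  have c0: "c \<noteq> 0" using c by auto
  have "\<And>i. coeff P i \<noteq> 0 \<Longrightarrow> c ^ (2 * i) = c ^ (d + 1)"
    using commuting_forms[OF d n c comm] by metis
  then have diff: "c ^ (2 * (j - i)) = 1" if "coeff P i \<noteq> 0" "coeff P j \<noteq> 0" "i \<le> j" for i j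
  proof -
    have "2 * i + 2 * (j - i) = 2 * j" using that(3) by simp
    then have "c ^ (2 * i) * c ^ (2 * (j - i)) = c ^ (2 * j)" by (metis power_add)
    also have "\<dots> = c ^ (2 * i)" using that \<open>\<And>i. coeff P i \<noteq> 0 \<Longrightarrow> c ^ (2 * i) = c ^ (d + 1)\<close> by metis
    finally show ?thesis using c0 by simp
  qed
  obtain i j where ij: "coeff P i \<noteq> 0" "coeff P j \<noteq> 0" "i < j"
    using monomial_commutes_with_reflection[OF d n c comm] noref by (metis linorder_neqE_nat)
  have "c ^ (2 * (j - i)) = 1" using diff[of i j] ij by simp
  then obtain N where N: "N > 0" "c ^ N = 1" "\<And>k. c ^ k = 1 \<Longrightarrow> N dvd k"
    using order_of_root_of_unity[of c "2 * (j - i)"] ij(3) by auto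
  have "even N"
  proof (rule ccontr)
    assume "odd N"
    then obtain k where "N = 2 * k + 1" by (rule oddE)
    then show False using antirot_odd_power_commutes[OF c comm, of k] N(2) noref by simp
  qed
  then obtain n where n: "N = 2 * n" by (rule evenE)
  have "(c ^ n) ^ 2 = 1" using N(2) unfolding n by (simp add: mult.commute flip: power_mult)
  moreover have "c ^ n \<noteq> 1" using N(1) N(3)[of n] unfolding n by (auto dest: dvd_imp_le)
  ultimately have "c ^ n = - 1" by (simp add: power2_eq_1_iff)
  moreover have "n dvd (j - i)" if "coeff P i \<noteq> 0" "coeff P j \<noteq> 0" "i \<le> j" for i j
    using N(3)[OF diff[OF that]] unfolding n by simp
  ultimately show ?thesis using that[of n] N(1) n by simp
qed

text \<open>With \<open>c ^ n = - 1\<close> the map \<open>antirot c\<close> sends the solutions of \<open>z ^ n = A\<close> to those of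
  \<open>z ^ n = - 1 / cnj A\<close>, so it carries the nonzero zeros of \<open>orb_poly\<close> to the zeros of
  \<open>coorb_poly\<close>.\<close>

definition orb_poly :: "nat \<Rightarrow> nat \<Rightarrow> complex list \<Rightarrow> complex poly" where
  "orb_poly n m As = [:0, 1:] ^ m * prod_list (map (\<lambda>A. [:0, 1:] ^ n - [:A:]) As)"

definition coorb_poly :: "nat \<Rightarrow> complex list \<Rightarrow> complex poly" where
  "coorb_poly n As = prod_list (map (\<lambda>A. 1 + Polynomial.smult (cnj A) ([:0, 1:] ^ n)) As)"

lemma hform_orb:
  "degree (orb_poly n m As) \<le> m + n * length As \<and>
   hform (m + n * length As) (orb_poly n m As) x y = x ^ m * prod_list (map (\<lambda>A. x ^ n - A * y ^ n) As)"
proof (induction As)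
  case Nil
  show ?case by (simp add: orb_poly_def degree_linear_power hform_linear_power)
next
  case (Cons A As)
  let ?z = "[:0, 1:] ^ n - [:A:]"
  have z: "degree ?z \<le> n" by (intro degree_diff_le degree_linear_power) simp
  have "?z = [:0, 1:] ^ n + Polynomial.smult (- A) 1" by (simp add: one_pCons)
  then have hz: "hform n ?z x y = x ^ n - A * y ^ n"
    by (simp only: hform_add hform_smult hform_one hform_linear_power) simp
  have e: "orb_poly n m (A # As) = ?z * orb_poly n m As"
    by (simp only: orb_poly_def list.map prod_list.Cons mult.left_commute)
  have l: "m + n * length (A # As) = n + (m + n * length As)" by simp
  show ?case unfolding e l
  proof
    show "degree (?z * orb_poly n m As) \<le> n + (m + n * length As)"
      using order_trans[OF degree_mult_le add_mono[OF z conjunct1[OF Cons]]] .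
    show "hform (n + (m + n * length As)) (?z * orb_poly n m As) x y = x ^ m * prod_list (map (\<lambda>A. x ^ n - A * y ^ n) (A # As))"
      using Cons hform_mult[OF z conjunct1[OF Cons]] by (simp add: hz)
  qed
qed

lemma hform_coorb:
  "degree (coorb_poly n As) \<le> m + n * length As \<and>
   hform (m + n * length As) (coorb_poly n As) x y = y ^ m * prod_list (map (\<lambda>A. y ^ n + cnj A * x ^ n) As)"
proof (induction As)
  case Nil
  show ?case by (simp add: coorb_poly_def hform_one)
next
  case (Cons A As)
  let ?z = "1 + Polynomial.smult (cnj A) ([:0, 1:] ^ n)"
  have z: "degree ?z \<le> n" by (intro degree_add_le order_trans[OF degree_smult_le] degree_linear_power) simp
  have hz: "hform n ?z x y = y ^ n + cnj A * x ^ n"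
    by (simp only: hform_add hform_smult hform_one hform_linear_power) simp
  have e: "coorb_poly n (A # As) = ?z * coorb_poly n As"
    by (simp only: coorb_poly_def list.map prod_list.Cons)
  have l: "m + n * length (A # As) = n + (m + n * length As)" by simp
  show ?case unfolding e l
  proof
    show "degree (?z * coorb_poly n As) \<le> n + (m + n * length As)"
      using order_trans[OF degree_mult_le add_mono[OF z conjunct1[OF Cons]]] .
    show "hform (n + (m + n * length As)) (?z * coorb_poly n As) x y = y ^ m * prod_list (map (\<lambda>A. y ^ n + cnj A * x ^ n) (A # As))"
      using Cons hform_mult[OF z conjunct1[OF Cons]] by (simp add: hz)
  qed
qed

text \<open>The relation \<open>A * cnj B = - 1\<close> says that \<open>A\<close> and \<open>B\<close> are antipodal points of the sphere; in
  particular they are then distinct.\<close>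

definition antipode_free :: "complex list \<Rightarrow> bool" where
  "antipode_free As \<longleftrightarrow> (\<forall>A\<in>set As. \<forall>B\<in>set As. A * cnj B \<noteq> - 1)"

text \<open>The flag \<open>sw\<close> selects the family of the reciprocals.\<close>

definition orb_num :: "bool \<Rightarrow> complex \<Rightarrow> nat \<Rightarrow> nat \<Rightarrow> complex list \<Rightarrow> complex poly" where
  "orb_num sw u n m As = Polynomial.smult u (if sw then coorb_poly n As else orb_poly n m As)"

definition orb_den :: "bool \<Rightarrow> nat \<Rightarrow> nat \<Rightarrow> complex list \<Rightarrow> complex poly" where
  "orb_den sw n m As = (if sw then orb_poly n m As else coorb_poly n As)"

lemma nondeg_smult_left: "u \<noteq> 0 \<Longrightarrow> nondeg d (Polynomial.smult u P) Q \<longleftrightarrow> nondeg d P Q"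
  by (simp add: nondeg_def hform_smult)

lemma nondeg_orb:
  assumes "n \<ge> 1" "u \<noteq> 0" "antipode_free As"
  shows "nondeg (m + n * length As) (orb_num sw u n m As) (orb_den sw n m As)"
proof -
  let ?d = "m + n * length As"
  have "nondeg ?d (Polynomial.smult u (orb_poly n m As)) (coorb_poly n As)"
    unfolding nondeg_def hform_smult
  proof (intro conjI allI impI)
    show "degree (Polynomial.smult u (orb_poly n m As)) \<le> ?d"
      by (rule order_trans[OF degree_smult_le conjunct1[OF hform_orb]])
    show "degree (coorb_poly n As) \<le> ?d" by (rule conjunct1[OF hform_coorb])
  next
    fix x y assume h: "u * hform ?d (orb_poly n m As) x y = 0 \<and> hform ?d (coorb_poly n As) x y = 0"
    have 1: "x = 0 \<or> (\<exists>A\<in>set As. x ^ n = A * y ^ n)"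
    proof -
      have "x ^ m * prod_list (map (\<lambda>A. x ^ n - A * y ^ n) As) = 0" using h assms(2) hform_orb[of n m As x y] by simp
      then show ?thesis using prod_list_zeroD[of "\<lambda>A. x ^ n - A * y ^ n" As] by auto
    qed
    have 2: "y = 0 \<or> (\<exists>A\<in>set As. y ^ n + cnj A * x ^ n = 0)"
    proof -
      have "y ^ m * prod_list (map (\<lambda>A. y ^ n + cnj A * x ^ n) As) = 0" using h hform_coorb[of n As m x y] by simp
      then show ?thesis using prod_list_zeroD[of "\<lambda>A. y ^ n + cnj A * x ^ n" As] by auto
    qed
    have n0: "n \<noteq> 0" using assms(1) by simp
    have "x = 0 \<and> y = 0"
    proof (cases "x = 0 \<or> y = 0")
      case True
      then show ?thesis using 1 2 n0 by (auto simp: power_0_left)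
    next
      case False
      then obtain A B where AB: "A \<in> set As" "x ^ n = A * y ^ n" "B \<in> set As" "y ^ n + cnj B * x ^ n = 0" using 1 2 by blast
      have "(1 + A * cnj B) * y ^ n = y ^ n + cnj B * x ^ n" unfolding AB(2) by (simp add: algebra_simps)
      then have "(1 + A * cnj B) * y ^ n = 0" unfolding AB(4) .
      then have "A * cnj B = - 1" using False by (simp add: add_eq_0_iff)
      then show ?thesis using assms(3) AB(1,3) by (auto simp: antipode_free_def)
    qed
    then show "x = 0" "y = 0" by auto
  qed
  then have *: "nondeg ?d (Polynomial.smult u (orb_poly n m As)) (coorb_poly n As)" .
  show ?thesis
  proof (cases sw)
    case False
    then show ?thesis using * by (simp add: orb_num_def orb_den_def)
  next
    case True
    have "nondeg ?d (Polynomial.smult u (coorb_poly n As)) (orb_poly n m As)"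
      using * by (simp only: nondeg_smult_left[OF assms(2)] nondeg_swap)
    with True show ?thesis by (simp add: orb_num_def orb_den_def)
  qed
qed

lemma prod_list_scale: "prod_list (map (\<lambda>x. k * f x) xs) = k ^ length xs * prod_list (map f xs)"
  for k :: complex
  by (induction xs) (auto simp: algebra_simps)

text \<open>The symmetry exchanges the two forms; the hypothesis \<open>sym\<close> says that the scalars picked up
  on the way cancel.\<close>

lemma orb_commutes:
  assumes n: "n \<ge> 1" and u: "norm u = 1" and af: "antipode_free As" and c: "norm c = 1" "c ^ n = - 1"
    and sym: "if sw then c * (c ^ m * (- 1) ^ length As) = 1 else c ^ m * (- 1) ^ length As = c"
    and d: "d = m + n * length As"
  shows "antirot c \<circ> quotient_fun d (orb_num sw u n m As) (orb_den sw n m As) =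
    quotient_fun d (orb_num sw u n m As) (orb_den sw n m As) \<circ> antirot c"
proof (rule sphere_fun_eqI)
  fix x y :: complex assume xy: "x \<noteq> 0 \<or> y \<noteq> 0"
  have u0: "u \<noteq> 0" using u by auto
  have uu: "u * cnj u = 1" using u by (rule unit_cnj)
  have c0: "c \<noteq> 0" using c by auto
  let ?N = "orb_num sw u n m As" and ?D = "orb_den sw n m As"
  note nd = nondeg_orb[OF n u0 af, of m sw, folded d]
  define F where "F x y = x ^ m * prod_list (map (\<lambda>A. x ^ n - A * y ^ n) As)" for x y
  define G where "G x y = y ^ m * prod_list (map (\<lambda>A. y ^ n + cnj A * x ^ n) As)" for x y
  have hF: "hform d (orb_poly n m As) x y = F x y" for x y using hform_orb[of n m As x y] by (simp add: F_def d)
  have hG: "hform d (coorb_poly n As) x y = G x y" for x y using hform_coorb[of n As m x y] by (simp add: G_def d)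
  define s where "s = c ^ m * (- 1) ^ length As"
  have FG: "F (c * cnj y) (cnj x) = s * cnj (G x y)"
  proof -
    have "F (c * cnj y) (cnj x) = c ^ m * cnj y ^ m * prod_list (map (\<lambda>A. - 1 * (cnj y ^ n + A * cnj x ^ n)) As)"
      unfolding F_def power_mult_distrib c(2) by (simp add: algebra_simps)
    also have "\<dots> = s * (cnj y ^ m * prod_list (map (\<lambda>A. cnj y ^ n + A * cnj x ^ n) As))"
      unfolding prod_list_scale s_def by (simp only: mult_ac)
    finally show ?thesis by (simp add: G_def prod_list_cnj)
  qed
  have GF: "G (c * cnj y) (cnj x) = cnj (F x y)"
    unfolding F_def G_def power_mult_distrib c(2) by (simp add: prod_list_cnj)
  have N: "hform d ?N x y = u * (if sw then G x y else F x y)" and D: "hform d ?D x y = (if sw then F x y else G x y)" for x y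
    by (simp_all add: orb_num_def orb_den_def hform_smult hF hG)
  have xy': "c * cnj y \<noteq> 0 \<or> cnj x \<noteq> 0" using xy c0 by auto
  note nz = nondeg_hform[OF nd xy] nondeg_hform[OF nd xy']
  have nz1: "c * cnj (hform d ?D x y) \<noteq> 0 \<or> cnj (hform d ?N x y) \<noteq> 0" using nz c0 by auto
  have L: "(antirot c \<circ> quotient_fun d ?N ?D) (hpt x y) = hpt (c * cnj (hform d ?D x y)) (cnj (hform d ?N x y))"
    by (simp only: comp_apply quotient_fun_hpt[OF nondeg_degree[OF nd] xy] antirot_hpt[OF nz(1)])
  have R: "(quotient_fun d ?N ?D \<circ> antirot c) (hpt x y) = hpt (hform d ?N (c * cnj y) (cnj x)) (hform d ?D (c * cnj y) (cnj x))"
    by (simp only: comp_apply antirot_hpt[OF xy] quotient_fun_hpt[OF nondeg_degree[OF nd] xy'])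
  have "c * cnj (hform d ?D x y) * hform d ?D (c * cnj y) (cnj x) = hform d ?N (c * cnj y) (cnj x) * cnj (hform d ?N x y)"
  proof (cases sw)
    case True
    have cs: "c * s = 1" using sym True by (simp add: s_def)
    have ND: "hform d ?N x y = u * G x y" "hform d ?D x y = F x y" for x y using N[of x y] D[of x y] True by simp_all
    have "c * cnj (F x y) * (s * cnj (G x y)) = (c * s) * (cnj (F x y) * cnj (G x y))" by (simp only: mult_ac)
    also have "\<dots> = (u * cnj u) * (cnj (F x y) * cnj (G x y))" unfolding cs uu ..
    also have "\<dots> = u * cnj (F x y) * cnj (u * G x y)" by (simp only: complex_cnj_mult mult_ac)
    finally show ?thesis unfolding ND FG GF .
  next
    case False
    have cs: "s = c" using sym False by (simp add: s_def)
    have ND: "hform d ?N x y = u * F x y" "hform d ?D x y = G x y" for x y using N[of x y] D[of x y] False by simp_all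
    have "c * cnj (G x y) * cnj (F x y) = (u * cnj u) * (s * (cnj (F x y) * cnj (G x y)))"
      unfolding cs uu by (simp only: mult_ac mult_1)
    also have "\<dots> = u * (s * cnj (G x y)) * cnj (u * F x y)" by (simp only: complex_cnj_mult mult_ac)
    finally show ?thesis unfolding ND FG GF .
  qed
  then show "(antirot c \<circ> quotient_fun d ?N ?D) (hpt x y) = (quotient_fun d ?N ?D \<circ> antirot c) (hpt x y)"
    unfolding L R by (subst hpt_eq_iff[OF nz1 nz(2)])
qed

lemma antirot_real_point:
  assumes "d \<ge> 1" "nondeg d P Q" "norm c = 1" "antirot c \<circ> quotient_fun d P Q = quotient_fun d P Q \<circ> antirot c"
  shows "orbit (quotient_fun d P Q) \<in> real_points d"
proof (rule real_pointI[OF assms(1) is_ratI[OF assms(2)]])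
  show "mob 0 c 1 0 \<in> PSL2" using assms(3) by (intro mob_in_PSL2) auto
qed (use assms(4) in \<open>simp add: antirot_def\<close>)

text \<open>A parameter \<open>A\<close> is free to move in the plane without the finitely many antipodes of the
  other ones, which is connected; at \<open>A = 0\<close> its factor \<open>z ^ n\<close> joins the power in front.\<close>

lemma orb_linked:
  fixes c :: complex
  assumes "n \<ge> 1" "norm u = 1" "antipode_free As" "norm c = 1" "c ^ n = - 1"
    and "if sw then c * (c ^ m * (- 1) ^ length As) = 1 else c ^ m * (- 1) ^ length As = c"
    and "d = m + n * length As" "d \<ge> 1"
  shows "linked d (orbit (quotient_fun d (orb_num sw u n m As) (orb_den sw n m As)))
    (orbit (quotient_fun d (orb_num sw u n d []) (orb_den sw n d [])))"
  using assms(3,6,7)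
proof (induction As arbitrary: m)
  case Nil
  then have "m = d" by simp
  moreover have "u \<noteq> 0" using assms(2) by auto
  then have "nondeg d (orb_num sw u n d []) (orb_den sw n d [])"
    using nondeg_orb[of n u "[]" d sw] assms(1) by (simp add: antipode_free_def)
  ultimately show ?case
    using linked_family[of d "{0::complex}" "\<lambda>_. orb_num sw u n d []" "\<lambda>_. orb_den sw n d []" 0 0] assms(8)
      antirot_real_point[OF assms(8) _ assms(4) orb_commutes[OF assms(1,2) Nil(1) assms(4,5) Nil(2,3)]]
    by (simp add: cont_poly_const)
next
  case (Cons A As)
  \<comment> \<open>The positions that the first parameter may take, given the other ones.\<close>
  define S where "S = - (\<Union>B\<in>set As. {z. z * cnj B = - 1})"
  have "finite (\<Union>B\<in>set As. {z. z * cnj B = - 1})"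
  proof (intro finite_UN_I finite_set)
    fix B :: complex
    have "{z. z * cnj B = - 1} \<subseteq> {- 1 / cnj B}"
    proof
      fix z assume "z \<in> {z. z * cnj B = - 1}"
      then have z: "z * cnj B = - 1" by simp
      then have "cnj B \<noteq> 0" by auto
      with z show "z \<in> {- 1 / cnj B}" by (metis nonzero_mult_div_cancel_right singleton_iff)
    qed
    then show "finite {z. z * cnj B = - 1}" by (rule finite_subset) simp
  qed
  then have conn: "connected S" unfolding S_def Compl_eq_Diff_UNIV
    by (intro connected_open_diff_countable countable_finite) auto
  have af: "antipode_free (z # As)" if z: "z \<in> S" for z
    unfolding antipode_free_def
  proof (intro ballI)
    fix B C assume "B \<in> set (z # As)" "C \<in> set (z # As)"
    then consider "B = z" "C = z" | "B = z" "C \<in> set As" | "B \<in> set As" "C = z" | "B \<in> set As" "C \<in> set As" by auto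
    then show "B * cnj C \<noteq> - 1"
    proof cases
      case 1
      have "z * cnj z = of_real ((norm z)\<^sup>2)" by (simp only: complex_norm_square)
      moreover have "(norm z)\<^sup>2 \<noteq> - 1" by (smt (verit) zero_le_power2)
      then have "complex_of_real ((norm z)\<^sup>2) \<noteq> - 1" by (metis of_real_1 of_real_eq_iff of_real_minus)
      ultimately show ?thesis using 1 by simp
    next
      case 2 then show ?thesis using z by (auto simp: S_def)
    next
      case 3
      then have "z * cnj B \<noteq> - 1" using z by (auto simp: S_def)
      then have "cnj (z * cnj B) \<noteq> cnj (- 1)" by (simp only: complex_cnj_cancel_iff not_False_eq_True)
      then show ?thesis using 3 by (simp add: mult.commute)
    next
      case 4 then show ?thesis using Cons.prems(1) by (auto simp: antipode_free_def)
    qed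
  qed
  have u0: "u \<noteq> 0" using assms(2) by auto
  let ?P = "\<lambda>z. orb_num sw u n m (z # As)" and ?Q = "\<lambda>z. orb_den sw n m (z # As)"
  have nd: "nondeg d (?P z) (?Q z)" if "z \<in> S" for z
    using nondeg_orb[OF assms(1) u0 af[OF that], of m sw] Cons.prems(3) by simp
  have "linked d (orbit (quotient_fun d (?P A) (?Q A))) (orbit (quotient_fun d (?P 0) (?Q 0)))"
  proof (rule linked_family[OF assms(8) conn, of ?P ?Q])
    show "cont_poly S ?P" "cont_poly S ?Q"
      unfolding orb_num_def orb_den_def orb_poly_def coorb_poly_def list.map prod_list.Cons
      by (cases sw; simp only: if_True if_False; intro cont_poly_intros continuous_intros)+
    show "orbit (quotient_fun d (?P z) (?Q z)) \<in> real_points d" if "z \<in> S" for z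
      by (rule antirot_real_point[OF assms(8) nd[OF that] assms(4) orb_commutes[OF assms(1,2) af[OF that] assms(4,5)]])
        (use Cons.prems in auto)
    show "A \<in> S" using Cons.prems(1) by (auto simp: S_def antipode_free_def)
    show "0 \<in> S" by (auto simp: S_def)
  qed (rule nd)
  moreover have "?P 0 = orb_num sw u n (m + n) As" "?Q 0 = orb_den sw n (m + n) As"
    by (simp_all add: orb_num_def orb_den_def orb_poly_def coorb_poly_def power_add mult.assoc)
  moreover have "linked d (orbit (quotient_fun d (orb_num sw u n (m + n) As) (orb_den sw n (m + n) As)))
    (orbit (quotient_fun d (orb_num sw u n d []) (orb_den sw n d [])))"
  proof (rule Cons.IH)
    show "antipode_free As" using Cons.prems(1) by (auto simp: antipode_free_def)
    have "c ^ (m + n) * (- 1) ^ length As = c ^ m * (- 1) ^ length (A # As)"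
      using assms(5) by (simp add: power_add)
    then show "if sw then c * (c ^ (m + n) * (- 1) ^ length As) = 1 else c ^ (m + n) * (- 1) ^ length As = c"
      using Cons.prems(2) by (simp only:)
    show "d = m + n + n * length As" using Cons.prems(3) by simp
  qed
  ultimately show ?case by (auto intro: linked_trans)
qed

lemma orb_linked_base:
  fixes c :: complex
  assumes "n \<ge> 1" "norm u = 1" "antipode_free As" "norm c = 1" "c ^ n = - 1"
    and "if sw then c * (c ^ m * (- 1) ^ length As) = 1 else c ^ m * (- 1) ^ length As = c"
    and "d = m + n * length As" "d \<ge> 2"
  shows "linked d (base_point d 0) (orbit (quotient_fun d (orb_num sw u n m As) (orb_den sw n m As)))"
proof -
  have d1: "d \<ge> 1" using assms(8) by simp
  have "linked d (orbit (quotient_fun d (orb_num sw u n d []) (orb_den sw n d []))) (base_point d (if sw then d else 0))"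
    using blaschke_power(3,4)[OF d1 assms(2)] by (cases sw) (simp_all add: orb_num_def orb_den_def orb_poly_def coorb_poly_def)
  moreover have "linked d (base_point d 0) (base_point d (if sw then d else 0))"
    by (rule base_points_linked[OF assms(8)]) simp
  ultimately show ?thesis using orb_linked[OF assms(1-7) d1] by (blast intro: linked_trans linked_sym)
qed

lemma poly_orb: "poly (orb_poly n m As) z = z ^ m * prod_list (map (\<lambda>A. z ^ n - A) As)"
  using hform_orb[of n m As z 1] hform_affine[OF conjunct1[OF hform_orb[of n m As z 1]], of z] by simp

lemma poly_coorb: "poly (coorb_poly n As) z = prod_list (map (\<lambda>A. 1 + cnj A * z ^ n) As)"
  using hform_coorb[of n As 0 z 1] hform_affine[OF conjunct1[OF hform_coorb[of n As 0 z 1]], of z] by simp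

lemma prod_list_zero: "x \<in> set xs \<Longrightarrow> f x = (0 :: complex) \<Longrightarrow> prod_list (map f xs) = 0"
  by (induction xs) auto

text \<open>An antipodal pair of parameters would produce a common zero of \<open>orb_poly\<close> and \<open>coorb_poly\<close>.\<close>

lemma antipode_free_if_coprime:
  assumes "n \<ge> 1" and no: "\<And>z. \<not> (poly (orb_poly n m As) z = 0 \<and> poly (coorb_poly n As) z = 0)"
  shows "antipode_free As"
  unfolding antipode_free_def
proof (intro ballI notI)
  fix A B assume AB: "A \<in> set As" "B \<in> set As" "A * cnj B = - 1"
  obtain z where z: "A = z ^ n" using exists_complex_root[of n A] assms(1) by auto
  have "1 + cnj B * z ^ n = 0" using AB(3) unfolding z by (simp add: mult.commute)
  then have "poly (coorb_poly n As) z = 0" unfolding poly_coorb using prod_list_zero[OF AB(2)] by simp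
  moreover have "poly (orb_poly n m As) z = 0"
    unfolding poly_orb using prod_list_zero[OF AB(1), of "\<lambda>A. z ^ n - A"] z by simp
  ultimately show False using no by blast
qed

text \<open>Replacing the parameters by their antipodes exchanges the roles of the two polynomials.\<close>

lemma orb_invert:
  assumes "\<And>A. A \<in> set As \<Longrightarrow> A \<noteq> 0"
  shows "\<exists>e f. e \<noteq> 0 \<and> norm e = norm f \<and>
    orb_poly n 0 As = Polynomial.smult e (coorb_poly n (map (\<lambda>A. - 1 / cnj A) As)) \<and>
    [:0, 1:] ^ k * coorb_poly n As = Polynomial.smult f (orb_poly n k (map (\<lambda>A. - 1 / cnj A) As))"
  using assms
proof (induction As)
  case Nil
  then show ?case by (intro exI[of _ 1]) (simp add: orb_poly_def coorb_poly_def)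
next
  case (Cons A As)
  then obtain e f where ef: "e \<noteq> 0" "norm e = norm f"
    "orb_poly n 0 As = Polynomial.smult e (coorb_poly n (map (\<lambda>A. - 1 / cnj A) As))"
    "[:0, 1:] ^ k * coorb_poly n As = Polynomial.smult f (orb_poly n k (map (\<lambda>A. - 1 / cnj A) As))" by auto
  have A: "A \<noteq> 0" using Cons.prems by simp
  let ?X = "[:0, 1:] ^ n :: complex poly" and ?Bs = "map (\<lambda>A. - 1 / cnj A) As" and ?B = "- 1 / cnj A"
  have lin1: "?X - [:A:] = Polynomial.smult (- A) (1 + Polynomial.smult (cnj ?B) ?X)"
  proof -
    have "Polynomial.smult (- A) (1 + Polynomial.smult (cnj ?B) ?X) = Polynomial.smult (- A) 1 + Polynomial.smult (- A * cnj ?B) ?X"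
      by (simp only: smult_add_right smult_smult)
    also have "- A * cnj ?B = 1" using A by simp
    finally show ?thesis by (simp add: one_pCons)
  qed
  have lin2: "1 + Polynomial.smult (cnj A) ?X = Polynomial.smult (cnj A) (?X - [:?B:])"
    using A by (simp add: smult_diff_right one_pCons)
  have o: "orb_poly n 0 (A # As) = (?X - [:A:]) * orb_poly n 0 As" "coorb_poly n (A # As) = (1 + Polynomial.smult (cnj A) ?X) * coorb_poly n As"
    "coorb_poly n (map (\<lambda>A. - 1 / cnj A) (A # As)) = (1 + Polynomial.smult (cnj ?B) ?X) * coorb_poly n ?Bs"
    "orb_poly n k (map (\<lambda>A. - 1 / cnj A) (A # As)) = (?X - [:?B:]) * orb_poly n k ?Bs"
    by (simp_all only: orb_poly_def coorb_poly_def list.map prod_list.Cons mult.left_commute)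
  have "orb_poly n 0 (A # As) = Polynomial.smult (e * - A) (coorb_poly n (map (\<lambda>A. - 1 / cnj A) (A # As)))"
    unfolding o ef(3) lin1 by (simp only: mult_smult_left mult_smult_right smult_smult)
  moreover have "[:0, 1:] ^ k * coorb_poly n (A # As) = (1 + Polynomial.smult (cnj A) ?X) * ([:0, 1:] ^ k * coorb_poly n As)"
    unfolding o by (simp only: mult.left_commute)
  then have "[:0, 1:] ^ k * coorb_poly n (A # As) = Polynomial.smult (f * cnj A) (orb_poly n k (map (\<lambda>A. - 1 / cnj A) (A # As)))"
    unfolding o(4) ef(4) lin2 by (simp only: mult_smult_left mult_smult_right smult_smult)
  moreover have "e * - A \<noteq> 0" "norm (e * - A) = norm (f * cnj A)" using A ef(1,2) by (simp_all add: norm_mult)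
  ultimately show ?case by blast
qed

text \<open>The support condition makes \<open>P\<close> a polynomial in \<open>z ^ n\<close> times a power of \<open>z\<close>, and the
  symmetry determines \<open>Q\<close> from \<open>P\<close>. If the degrees leave a deficit \<open>k\<close>, then \<open>Q\<close> vanishes at \<open>0\<close>
  and \<open>P\<close> does not; passing to the antipodal parameters then exhibits the reciprocal family.\<close>

lemma commuting_is_orb:
  assumes d: "d \<ge> 1" and nd: "nondeg d P Q" and c: "norm c = 1"
    and comm: "antirot c \<circ> quotient_fun d P Q = quotient_fun d P Q \<circ> antirot c"
    and n: "n \<ge> 1" "c ^ n = - 1"
    and supp: "\<And>i j. coeff P i \<noteq> 0 \<Longrightarrow> coeff P j \<noteq> 0 \<Longrightarrow> i \<le> j \<Longrightarrow> n dvd (j - i)"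
  shows "\<exists>sw u m As. norm u = 1 \<and> antipode_free As \<and> d = m + n * length As \<and>
    (if sw then c * (c ^ m * (- 1) ^ length As) = 1 else c ^ m * (- 1) ^ length As = c) \<and>
    quotient_fun d P Q = quotient_fun d (orb_num sw u n m As) (orb_den sw n m As)"
proof -
  obtain \<mu> where \<mu>: "norm \<mu> = 1"
    "\<And>x y. hform d Q (c * y) x = \<mu> * cnj (hform d P (cnj x) (cnj y))"
    "\<And>i. coeff P i \<noteq> 0 \<Longrightarrow> c ^ (2 * i) = c ^ (d + 1)"
    using commuting_forms[OF d nd c comm] by metis
  have cc: "c * cnj c = 1" using c by (rule unit_cnj)
  have c0: "c \<noteq> 0" using c by auto
  have "\<exists>i. coeff P i \<noteq> 0"
  proof (rule ccontr)
    assume "\<nexists>i. coeff P i \<noteq> 0"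
    then have "hform d P x y = 0" for x y by (simp add: hform_def)
    moreover from this have "hform d Q (c * 1) 1 = 0" unfolding \<mu>(2) by simp
    ultimately show False using nondeg_hform[OF nd, of "c * 1" 1] by simp
  qed
  define m where "m = (LEAST i. coeff P i \<noteq> 0)"
  have m: "coeff P m \<noteq> 0" unfolding m_def using \<open>\<exists>i. coeff P i \<noteq> 0\<close> by (rule LeastI_ex)
  have m_least: "m \<le> i" if "coeff P i \<noteq> 0" for i unfolding m_def using that by (rule Least_le)
  define D where "D = degree P"
  \<comment> \<open>\<open>R\<close> collects the coefficients along the progression \<open>m, m + n, m + 2 n, ...\<close>, which contains all exponents.\<close>
  define R where "R = (\<Sum>j\<le>D. monom (coeff P (m + n * j)) j)"
  have PR: "poly P z = z ^ m * poly R (z ^ n)" for z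
  proof -
    have inj: "inj_on (\<lambda>j. m + n * j) {..D}" using n(1) by (auto simp: inj_on_def)
    have out: "coeff P i = 0" if "i \<notin> (\<lambda>j. m + n * j) ` {..D}" for i
    proof (rule ccontr)
      assume i: "coeff P i \<noteq> 0"
      from supp[OF m i m_least[OF i]] obtain j where j: "i - m = n * j" by (rule dvdE)
      then have ij: "i = m + n * j" using m_least[OF i] by simp
      have "j \<le> n * j" using n(1) by simp
      also have "n * j \<le> i" using ij by simp
      also have "i \<le> D" unfolding D_def using i by (rule le_degree)
      finally show False using that ij by auto
    qed
    have "poly P z = (\<Sum>i\<le>D. coeff P i * z ^ i)" unfolding D_def by (rule poly_altdef)
    also have "\<dots> = (\<Sum>i\<in>{..D} \<union> (\<lambda>j. m + n * j) ` {..D}. coeff P i * z ^ i)"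
      by (rule sum.mono_neutral_left) (auto simp: D_def coeff_eq_0)
    also have "\<dots> = (\<Sum>i\<in>(\<lambda>j. m + n * j) ` {..D}. coeff P i * z ^ i)"
      by (rule sum.mono_neutral_right) (use out in auto)
    also have "\<dots> = (\<Sum>j\<le>D. coeff P (m + n * j) * z ^ (m + n * j))"
      using sum.reindex[OF inj] by simp
    also have "\<dots> = z ^ m * (\<Sum>j\<le>D. coeff P (m + n * j) * (z ^ n) ^ j)"
      unfolding sum_distrib_left power_add power_mult by (simp only: mult.left_commute)
    finally show ?thesis by (simp add: R_def poly_sum poly_monom)
  qed
  have R0: "poly R 0 \<noteq> 0" using m by (simp add: R_def poly_sum poly_monom power_0_left if_distrib cong: if_cong)
  obtain As where As: "Polynomial.smult (lead_coeff R) (lin As) = R" "length As = degree R"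
    using fundamental_theorem_algebra_factorized[of R] unfolding lin_def by blast
  define r where "r = lead_coeff R"
  have r0: "r \<noteq> 0" using R0 by (auto simp: r_def)
  have A0: "A \<noteq> 0" if "A \<in> set As" for A
  proof
    assume "A = 0"
    then have "poly (lin As) 0 = 0" using poly_lin_zero that by blast
    then have "poly (Polynomial.smult (lead_coeff R) (lin As)) 0 = 0" by simp
    then show False using R0 unfolding As(1) by simp
  qed
  have polyR: "poly R w = r * prod_list (map (\<lambda>A. w - A) As)" for w
    using hform_lin[of As w 1] hform_affine[OF degree_lin, of As w] arg_cong[OF As(1), of "\<lambda>p. poly p w"]
    by (simp add: r_def)
  have "poly P z = poly (Polynomial.smult r (orb_poly n m As)) z" for z
    unfolding PR polyR by (simp add: poly_orb)
  then have P: "P = Polynomial.smult r (orb_poly n m As)" by (simp add: poly_eq_poly_eq_iff[symmetric] fun_eq_iff)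
  let ?s = "length As"
  have "coeff (orb_poly n m As) (m + n * ?s) = hform (m + n * ?s) (orb_poly n m As) 1 0" by (simp add: hform_infinity)
  also have "\<dots> = 1"
  proof -
    have "prod_list (map (\<lambda>A. 1 ^ n - A * 0 ^ n) As) = (1 :: complex)" using n(1) by (induction As) (auto simp: power_0_left)
    then show ?thesis using hform_orb[of n m As 1 0] by simp
  qed
  finally have "coeff P (m + n * ?s) \<noteq> 0" unfolding P using r0 by simp
  then have "m + n * ?s \<le> degree P" by (rule le_degree)
  then have ms: "m + n * ?s \<le> d" using nondeg_degree(1)[OF nd] by linarith
  define k where "k = d - (m + n * ?s)"
  have dk: "d = k + (m + n * ?s)" using ms by (simp add: k_def)
  have hP: "hform d P x y = r * (y ^ k * (x ^ m * prod_list (map (\<lambda>A. x ^ n - A * y ^ n) As)))" for x y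
  proof -
    have "hform (k + (m + n * ?s)) (1 * orb_poly n m As) x y = hform k 1 x y * hform (m + n * ?s) (orb_poly n m As) x y"
      by (rule hform_mult) (use conjunct1[OF hform_orb] in auto)
    then show ?thesis unfolding P hform_smult dk using hform_orb[of n m As x y] by (simp add: hform_one)
  qed
  define q where "q = \<mu> * cnj r * cnj c ^ k"
  have "poly Q z = poly (Polynomial.smult q ([:0, 1:] ^ k * coorb_poly n As)) z" for z
  proof -
    have "c * (cnj c * z) = z" by (simp only: mult.assoc[symmetric] cc mult_1)
    then have "poly Q z = hform d Q (c * (cnj c * z)) 1"
      using nondeg_degree(2)[OF nd] by (simp only: hform_affine)
    also have "\<dots> = \<mu> * cnj (hform d P (cnj 1) (cnj (cnj c * z)))" by (rule \<mu>(2))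
    also have "hform d P (cnj 1) (cnj (cnj c * z)) = r * ((c * cnj z) ^ k * (1 ^ m * prod_list (map (\<lambda>A. 1 ^ n - A * (c * cnj z) ^ n) As)))"
      unfolding hP by simp
    also have "\<dots> = r * (c ^ k * (cnj z ^ k * prod_list (map (\<lambda>A. 1 + A * cnj z ^ n) As)))"
      unfolding power_mult_distrib n(2) by (simp add: mult_ac)
    also have "\<mu> * cnj \<dots> = q * (z ^ k * prod_list (map (\<lambda>A. 1 + cnj A * z ^ n) As))"
      by (simp add: q_def prod_list_cnj)
    finally show ?thesis by (simp add: poly_coorb poly_power)
  qed
  then have Q: "Q = Polynomial.smult q ([:0, 1:] ^ k * coorb_poly n As)"
    by (simp add: poly_eq_poly_eq_iff[symmetric] fun_eq_iff)
  have nq: "norm q = norm r" using \<mu>(1) c by (simp add: q_def norm_mult norm_power)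
  then have q0: "q \<noteq> 0" using r0 by auto
  have af: "antipode_free As"
  proof (rule antipode_free_if_coprime[OF n(1), of m])
    fix z show "\<not> (poly (orb_poly n m As) z = 0 \<and> poly (coorb_poly n As) z = 0)"
    proof
      assume "poly (orb_poly n m As) z = 0 \<and> poly (coorb_poly n As) z = 0"
      then have "poly P z = 0" "poly Q z = 0" by (simp_all add: P Q)
      then show False using nd by (auto simp: nondeg_iff)
    qed
  qed
  have cm: "c ^ (2 * m) = c ^ (d + 1)" by (rule \<mu>(3)[OF m])
  have cn: "c ^ (n * ?s) = (- 1) ^ ?s" using n(2) by (simp add: power_mult)
  show ?thesis
  proof (cases "k = 0")
    case True
    define u where "u = r / q"
    have u: "norm u = 1" using nq r0 by (simp add: u_def norm_divide)
    have "P = Polynomial.smult q (orb_num False u n m As)" "Q = Polynomial.smult q (orb_den False n m As)"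
      using q0 True by (simp_all add: orb_num_def orb_den_def u_def P Q)
    then have eq: "quotient_fun d P Q = quotient_fun d (orb_num False u n m As) (orb_den False n m As)"
      using quotient_fun_smult[OF q0] by metis
    have "c ^ m * c ^ m = c ^ (m + n * ?s + 1)"
      using cm unfolding dk True mult_2 power_add by simp
    also have "\<dots> = c ^ m * (c * (- 1) ^ ?s)" by (simp only: power_add cn power_one_right mult_ac)
    finally have "c ^ m * c ^ m = c ^ m * (c * (- 1) ^ ?s)" .
    then have "c ^ m = c * (- 1) ^ ?s" using c0 by simp
    then have "c ^ m * (- 1) ^ ?s = c * ((- 1) ^ ?s * (- 1) ^ ?s)" by simp
    also have "(- 1 :: complex) ^ ?s * (- 1) ^ ?s = 1" by (simp flip: power_mult_distrib)
    finally have "c ^ m * (- 1) ^ ?s = c" by simp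
    then show ?thesis using u af eq dk True by (intro exI[of _ False] exI[of _ u] exI[of _ m] exI[of _ As]) simp
  next
    case False
    then have "poly Q 0 = 0" by (simp add: Q poly_power)
    then have "poly P 0 \<noteq> 0" using nd by (auto simp: nondeg_iff)
    then have m0: "m = 0" by (cases m) (simp_all add: P poly_orb)
    let ?Bs = "map (\<lambda>A. - 1 / cnj A) As"
    obtain e f where ef: "e \<noteq> 0" "norm e = norm f"
      "orb_poly n 0 As = Polynomial.smult e (coorb_poly n ?Bs)"
      "[:0, 1:] ^ k * coorb_poly n As = Polynomial.smult f (orb_poly n k ?Bs)"
      using orb_invert[OF A0] by blast
    have f0: "f \<noteq> 0" using ef(1,2) by auto
    define u where "u = r * e / (q * f)"
    have u: "norm u = 1" using nq r0 f0 ef(1,2) by (simp add: u_def norm_divide norm_mult)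
    have "P = Polynomial.smult (q * f) (orb_num True u n k ?Bs)" "Q = Polynomial.smult (q * f) (orb_den True n k ?Bs)"
      using q0 f0 by (simp_all add: orb_num_def orb_den_def u_def P Q m0 ef(3,4))
    moreover have "q * f \<noteq> 0" using q0 f0 by simp
    ultimately have eq: "quotient_fun d P Q = quotient_fun d (orb_num True u n k ?Bs) (orb_den True n k ?Bs)"
      using quotient_fun_smult by metis
    have "antipode_free ?Bs"
      unfolding antipode_free_def
    proof (intro ballI notI)
      fix A' B' assume "A' \<in> set ?Bs" "B' \<in> set ?Bs" "A' * cnj B' = - 1"
      then obtain A B where AB: "A \<in> set As" "B \<in> set As" "(- 1 / cnj A) * cnj (- 1 / cnj B) = - 1" by auto
      then have "1 / (cnj A * B) = - 1" by simp
      moreover have "B * cnj A = 1 / (1 / (cnj A * B))" by simp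
      ultimately have "B * cnj A = - 1" by simp
      then show False using af AB(1,2) by (auto simp: antipode_free_def)
    qed
    moreover have "c * (c ^ k * (- 1) ^ ?s) = 1" using cm dk m0 cn by (simp add: power_add mult_ac)
    ultimately show ?thesis using u eq dk m0
      by (intro exI[of _ True] exI[of _ u] exI[of _ k] exI[of _ ?Bs]) simp
  qed
qed

section \<open>Connectedness of the real points\<close>

lemma normal_form_representative:
  assumes d: "d \<ge> 2" and r: "is_rat d \<phi>" and T: "T \<in> PSL2" and comm: "T \<circ> J \<circ> \<phi> = \<phi> \<circ> (T \<circ> J)"
  obtains S c P Q where "S \<in> PSL2" "norm c = 1" "S \<circ> (T \<circ> J) \<circ> Hilbert_Choice.inv S = antirot c"
    "nondeg d P Q" "S \<circ> \<phi> \<circ> Hilbert_Choice.inv S = quotient_fun d P Q"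
    "antirot c \<circ> quotient_fun d P Q = quotient_fun d P Q \<circ> antirot c"
proof -
  obtain S c where S: "S \<in> PSL2" "norm c = 1" "S \<circ> (T \<circ> J) \<circ> Hilbert_Choice.inv S = antirot c"
    using antiholomorphic_normal_form[OF assms] unfolding antirot_def by metis
  obtain P Q where PQ: "nondeg d P Q" "S \<circ> \<phi> \<circ> Hilbert_Choice.inv S = quotient_fun d P Q"
    using is_rat_conj[OF r S(1)] by (auto simp: is_rat_def)
  have "antirot c \<circ> quotient_fun d P Q = quotient_fun d P Q \<circ> antirot c"
    using conj_commutes[OF PSL2_bij[OF S(1)] comm] unfolding S(3) PQ(2) .
  with that S PQ show ?thesis by blast
qed

lemma real_point_linked:
  assumes d: "d \<ge> 2" and C: "C \<in> real_points d"
  shows "linked d (base_point d 0) C"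
proof -
  have d1: "d \<ge> 1" using d by simp
  obtain \<phi> T where phi: "is_rat d \<phi>" "C = orbit \<phi>" "T \<in> PSL2" "T \<circ> J \<circ> \<phi> = \<phi> \<circ> (T \<circ> J)"
    using real_pointD[OF d1 C] by metis
  obtain S c P Q where S: "S \<in> PSL2" "norm c = 1" "S \<circ> (T \<circ> J) \<circ> Hilbert_Choice.inv S = antirot c"
    and nd: "nondeg d P Q" "S \<circ> \<phi> \<circ> Hilbert_Choice.inv S = quotient_fun d P Q"
    and comm: "antirot c \<circ> quotient_fun d P Q = quotient_fun d P Q \<circ> antirot c"
    using normal_form_representative[OF d phi(1,3,4)] by metis
  have C': "C = orbit (quotient_fun d P Q)" using orbit_conj[OF S(1), of \<phi>] phi(2) nd(2) by simp
  show ?thesis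
  proof (cases "antirot 1 \<circ> quotient_fun d P Q = quotient_fun d P Q \<circ> antirot 1")
    case True
    then show ?thesis
      using reflection_commuting_is_blaschke[OF d1 nd(1)] blaschke_linked_zero[OF _ _ d] unfolding C' by metis
  next
    case False
    obtain n where n: "n \<ge> 1" "c ^ n = - 1"
      "\<And>i j. coeff P i \<noteq> 0 \<Longrightarrow> coeff P j \<noteq> 0 \<Longrightarrow> i \<le> j \<Longrightarrow> n dvd (j - i)"
      using commuting_dichotomy[OF d1 nd(1) S(2) comm False] by metis
    obtain sw u m As where "norm u = 1" "antipode_free As" "d = m + n * length As"
      "if sw then c * (c ^ m * (- 1) ^ length As) = 1 else c ^ m * (- 1) ^ length As = c"
      "quotient_fun d P Q = quotient_fun d (orb_num sw u n m As) (orb_den sw n m As)"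
      using commuting_is_orb[OF d1 nd(1) S(2) comm n] by blast
    then show ?thesis using orb_linked_base[OF n(1) _ _ S(2) n(2) _ _ d] unfolding C' by simp
  qed
qed

lemma real_points_connected:
  assumes d: "d \<ge> 2" shows "connectedin (moduli_space d) (real_points d)"
proof -
  have "connected_component_of (subtopology (moduli_space d) (real_points d)) C C'"
    if "C \<in> real_points d" "C' \<in> real_points d" for C C'
    using real_point_linked[OF d that(1)] real_point_linked[OF d that(2)] linked_sym linked_trans
    unfolding linked_def by metis
  moreover have "real_points d \<subseteq> topspace (moduli_space d)" by (auto simp: real_points_def)
  ultimately show ?thesis
    unfolding connectedin_def connected_space_iff_connected_component by auto
qed

section \<open>Pseudo-real maps\<close>

lemma extended_moebius_iff:
  "Q \<in> extended_moebius \<longleftrightarrow> (\<exists>a b c e. a * e - b * c = 1 \<and> Q = mob a b c e \<circ> J)"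
  unfolding extended_moebius_def PSL2_iff by blast

lemma extended_moebius_bij: "Q \<in> extended_moebius \<Longrightarrow> bij Q"
  unfolding extended_moebius_def using bij_comp[OF J_bij PSL2_bij] by blast

lemma antiholomorphic_automorphism_iff:
  "antiholomorphic_automorphism \<phi> Q \<longleftrightarrow> Q \<in> extended_moebius \<and> Q \<circ> \<phi> = \<phi> \<circ> Q"
proof -
  have "Q \<circ> \<phi> \<circ> Hilbert_Choice.inv Q = \<phi> \<longleftrightarrow> Q \<circ> \<phi> = \<phi> \<circ> Q" if "Q \<in> extended_moebius"
  proof
    have inj: "Hilbert_Choice.inv Q \<circ> Q = id" and surj: "Q \<circ> Hilbert_Choice.inv Q = id"
      using extended_moebius_bij[OF that] by (auto simp: bij_def surj_iff)
    show "Q \<circ> \<phi> = \<phi> \<circ> Q" if h: "Q \<circ> \<phi> \<circ> Hilbert_Choice.inv Q = \<phi>"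
    proof -
      have "\<phi> \<circ> Q = (Q \<circ> \<phi> \<circ> Hilbert_Choice.inv Q) \<circ> Q" unfolding h ..
      also have "\<dots> = Q \<circ> \<phi> \<circ> (Hilbert_Choice.inv Q \<circ> Q)" by (simp only: comp_assoc)
      finally show ?thesis unfolding inj by simp
    qed
    show "Q \<circ> \<phi> \<circ> Hilbert_Choice.inv Q = \<phi>" if h: "Q \<circ> \<phi> = \<phi> \<circ> Q"
      unfolding h comp_assoc surj by simp
  qed
  then show ?thesis by (auto simp: antiholomorphic_automorphism_def)
qed

definition has_reflection :: "(sphere \<Rightarrow> sphere) \<Rightarrow> bool" where
  "has_reflection \<phi> \<longleftrightarrow> (\<exists>Q. reflection Q \<and> Q \<circ> \<phi> = \<phi> \<circ> Q)"

text \<open>For a map without commuting reflection, such a \<open>Q\<close> is conjugate to the antipodal map.\<close>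

definition has_anti_involution :: "(sphere \<Rightarrow> sphere) \<Rightarrow> bool" where
  "has_anti_involution \<phi> \<longleftrightarrow> (\<exists>Q\<in>extended_moebius. Q \<circ> Q = id \<and> Q \<circ> \<phi> = \<phi> \<circ> Q)"

definition has_half_turn :: "(sphere \<Rightarrow> sphere) \<Rightarrow> bool" where
  "has_half_turn \<phi> \<longleftrightarrow> (\<exists>S\<in>PSL2. S \<noteq> id \<and> S \<circ> S = id \<and> S \<circ> \<phi> = \<phi> \<circ> S)"

lemma pseudo_real_iff:
  "pseudo_real \<phi> \<longleftrightarrow> (\<exists>Q\<in>extended_moebius. Q \<circ> \<phi> = \<phi> \<circ> Q) \<and> \<not> has_reflection \<phi>"
  unfolding pseudo_real_def antiholomorphic_automorphism_iff has_reflection_def reflection_def by blast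

lemma extended_moebius_conj:
  assumes "S \<in> PSL2" "Q \<in> extended_moebius" shows "S \<circ> Q \<circ> Hilbert_Choice.inv S \<in> extended_moebius"
proof -
  obtain T where T: "T \<in> PSL2" "Q = T \<circ> J" using assms(2) by (auto simp: extended_moebius_def)
  have "S \<circ> Q \<circ> Hilbert_Choice.inv S = (S \<circ> T \<circ> (J \<circ> Hilbert_Choice.inv S \<circ> J)) \<circ> J"
    unfolding T(2) by (simp add: comp_assoc J_J)
  moreover have "S \<circ> T \<circ> (J \<circ> Hilbert_Choice.inv S \<circ> J) \<in> PSL2"
    by (intro PSL2_comp PSL2_J PSL2_inv assms(1) T(1))
  ultimately show ?thesis unfolding extended_moebius_def by blast
qed

lemma conj_involution:
  assumes "bij S" "Q \<circ> Q = id" shows "(S \<circ> Q \<circ> Hilbert_Choice.inv S) \<circ> (S \<circ> Q \<circ> Hilbert_Choice.inv S) = id"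
  using fun_cong[OF assms(2)] assms(1) by (auto simp: fun_eq_iff bij_def surj_f_inv_f)

lemma conj_back:
  assumes "bij S" shows "Hilbert_Choice.inv S \<circ> (S \<circ> \<phi> \<circ> Hilbert_Choice.inv S) \<circ> Hilbert_Choice.inv (Hilbert_Choice.inv S) = \<phi>"
  using assms by (auto simp: fun_eq_iff inv_inv_eq bij_def)

lemma has_reflection_conj:
  assumes S: "S \<in> PSL2" and r: "has_reflection \<phi>" shows "has_reflection (S \<circ> \<phi> \<circ> Hilbert_Choice.inv S)"
proof -
  obtain Q x where Q: "Q \<in> extended_moebius" "Q \<circ> Q = id" "Q x = x" "Q \<circ> \<phi> = \<phi> \<circ> Q"
    using r by (auto simp: has_reflection_def reflection_def)
  note b = PSL2_bij[OF S]
  let ?Q = "S \<circ> Q \<circ> Hilbert_Choice.inv S"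
  have "?Q (S x) = S x" using Q(3) b by (simp add: bij_def)
  then have "reflection ?Q"
    using extended_moebius_conj[OF S Q(1)] conj_involution[OF b Q(2)] unfolding reflection_def by blast
  then show ?thesis using conj_commutes[OF b Q(4)] unfolding has_reflection_def by blast
qed

lemma has_reflection_conj_iff:
  assumes S: "S \<in> PSL2" shows "has_reflection (S \<circ> \<phi> \<circ> Hilbert_Choice.inv S) \<longleftrightarrow> has_reflection \<phi>"
  using has_reflection_conj[OF S, of \<phi>]
    has_reflection_conj[OF PSL2_inv[OF S], of "S \<circ> \<phi> \<circ> Hilbert_Choice.inv S"] conj_back[OF PSL2_bij[OF S], of \<phi>] by auto

lemma has_anti_involution_conj:
  assumes S: "S \<in> PSL2" and r: "has_anti_involution \<phi>" shows "has_anti_involution (S \<circ> \<phi> \<circ> Hilbert_Choice.inv S)"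
proof -
  obtain Q where Q: "Q \<in> extended_moebius" "Q \<circ> Q = id" "Q \<circ> \<phi> = \<phi> \<circ> Q"
    using r by (auto simp: has_anti_involution_def)
  note b = PSL2_bij[OF S]
  show ?thesis unfolding has_anti_involution_def
    using extended_moebius_conj[OF S Q(1)] conj_involution[OF b Q(2)] conj_commutes[OF b Q(3)] by blast
qed

lemma has_half_turn_conj:
  assumes S: "S \<in> PSL2" and r: "has_half_turn \<phi>" shows "has_half_turn (S \<circ> \<phi> \<circ> Hilbert_Choice.inv S)"
proof -
  obtain T where T: "T \<in> PSL2" "T \<noteq> id" "T \<circ> T = id" "T \<circ> \<phi> = \<phi> \<circ> T"
    using r by (auto simp: has_half_turn_def)
  note b = PSL2_bij[OF S]
  have "S \<circ> T \<circ> Hilbert_Choice.inv S \<noteq> id"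
  proof
    assume h: "S \<circ> T \<circ> Hilbert_Choice.inv S = id"
    have "S (T x) = S x" for x using fun_cong[OF h, of "S x"] b by (simp add: bij_def)
    then have "T = id" using b by (auto simp: fun_eq_iff bij_def dest: injD)
    with T(2) show False ..
  qed
  moreover have "S \<circ> T \<circ> Hilbert_Choice.inv S \<in> PSL2" by (intro PSL2_comp PSL2_inv S T(1))
  ultimately show ?thesis unfolding has_half_turn_def
    using conj_involution[OF b T(3)] conj_commutes[OF b T(4)] by blast
qed

lemma mob_eq_id_iff: "a * e - b * c \<noteq> 0 \<Longrightarrow> mob a b c e = id \<longleftrightarrow> b = 0 \<and> c = 0 \<and> a = e"
proof
  assume det: "a * e - b * c \<noteq> 0" and id: "mob a b c e = id"
  have col: "a \<noteq> 0 \<or> c \<noteq> 0" "b \<noteq> 0 \<or> e \<noteq> 0" "a + b \<noteq> 0 \<or> c + e \<noteq> 0"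
    using linear_nonzero[OF det, of 1 0] linear_nonzero[OF det, of 0 1] linear_nonzero[OF det, of 1 1] by auto
  have "hpt a c = hpt 1 0" "hpt b e = hpt 0 1" "hpt (a + b) (c + e) = hpt 1 1"
    using fun_cong[OF id, of "hpt 1 0"] fun_cong[OF id, of "hpt 0 1"] fun_cong[OF id, of "hpt 1 1"]
    by (simp_all add: mob_hpt)
  then have "a * 0 = 1 * c" "b * 1 = 0 * e" "(a + b) * 1 = 1 * (c + e)"
    using col by (simp_all add: hpt_eq_iff)
  then show "b = 0 \<and> c = 0 \<and> a = e" by simp
next
  assume "a * e - b * c \<noteq> 0" "b = 0 \<and> c = 0 \<and> a = e"
  then show "mob a b c e = id" using mob_id[of a] by auto
qed

text \<open>By Cayley-Hamilton the square of a matrix with trace \<open>t\<close> and determinant 1 is \<open>t\<close> times the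
  matrix minus the identity.\<close>

lemma half_turn_iff_trace:
  assumes det: "a * e - b * c = 1"
  shows "mob a b c e \<noteq> id \<and> mob a b c e \<circ> mob a b c e = id \<longleftrightarrow> a + e = 0"
proof -
  have det0: "a * e - b * c \<noteq> 0" using det by simp
  have "(a * a + b * c) * (c * b + e * e) - (a * b + b * e) * (c * a + e * c) = (a * e - b * c) * (a * e - b * c)"
    by (simp add: algebra_simps)
  then have "(a * a + b * c) * (c * b + e * e) - (a * b + b * e) * (c * a + e * c) \<noteq> 0" unfolding det by simp
  from mob_eq_id_iff[OF this]
  have sq: "mob a b c e \<circ> mob a b c e = id \<longleftrightarrow> b * (a + e) = 0 \<and> c * (a + e) = 0 \<and> (a - e) * (a + e) = 0"
    unfolding mob_comp[OF det0] by (auto simp: algebra_simps)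
  show ?thesis
  proof
    assume "mob a b c e \<noteq> id \<and> mob a b c e \<circ> mob a b c e = id"
    then show "a + e = 0" unfolding sq mob_eq_id_iff[OF det0] by auto
  next
    assume t: "a + e = 0"
    have "mob a b c e \<noteq> id"
    proof
      assume "mob a b c e = id"
      then have "b = 0" "a = e" using mob_eq_id_iff[OF det0] by auto
      moreover from this t have "a = 0" by simp
      ultimately show False using det by simp
    qed
    with sq t show "mob a b c e \<noteq> id \<and> mob a b c e \<circ> mob a b c e = id" by simp
  qed
qed

lemma anti_involution_iff:
  assumes det: "a * e - b * c = 1"
  shows "(mob a b c e \<circ> J) \<circ> (mob a b c e \<circ> J) = id \<longleftrightarrow>
    a * cnj b + b * cnj e = 0 \<and> c * cnj a + e * cnj c = 0 \<and> a * cnj a + b * cnj c = c * cnj b + e * cnj e"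
proof -
  have "(a * cnj a + b * cnj c) * (c * cnj b + e * cnj e) - (a * cnj b + b * cnj e) * (c * cnj a + e * cnj c)
    = (a * e - b * c) * cnj (a * e - b * c)" by (simp add: algebra_simps)
  also have "\<dots> \<noteq> 0" unfolding det by simp
  finally show ?thesis unfolding antiholomorphic_square[OF det] by (rule mob_eq_id_iff)
qed

text \<open>An antilinear map whose square is exactly the identity, not merely a scalar, is a real
  structure and has fixed vectors.\<close>

lemma anti_identity_is_reflection:
  assumes det: "a * e - b * c = 1" and sq: "a * cnj a + b * cnj c = 1" "a * cnj b + b * cnj e = 0"
    "c * cnj a + e * cnj c = 0" "c * cnj b + e * cnj e = 1"
  shows "reflection (mob a b c e \<circ> J)"
proof -
  have inv: "(mob a b c e \<circ> J) \<circ> (mob a b c e \<circ> J) = id" using anti_involution_iff[OF det] sq by simp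
  have fixp: "(mob a b c e \<circ> J) (hpt x y) = hpt x y"
    if "x \<noteq> 0 \<or> y \<noteq> 0" "a * cnj x + b * cnj y = x" "c * cnj x + e * cnj y = y" for x y
    using that by (simp add: J_hpt mob_hpt)
  \<comment> \<open>For every vector \<open>w\<close> the sum of \<open>w\<close> and its image is fixed; one of \<open>(1, 0)\<close>, \<open>(\<i>, 0)\<close> gives a nonzero sum.\<close>
  have "\<exists>s. (mob a b c e \<circ> J) s = s"
  proof (cases "1 + a = 0 \<and> c = 0")
    case False
    have "a * cnj (1 + a) + b * cnj c = 1 + a" "c * cnj (1 + a) + e * cnj c = c"
      using sq(1,3) by (simp_all add: algebra_simps)
    then show ?thesis using fixp[of "1 + a" c] False by blast
  next
    case True
    then have "a = - 1" "c = 0" by (simp_all add: add_eq_0_iff)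
    then have "a * cnj \<i> + b * cnj 0 = \<i>" "c * cnj \<i> + e * cnj 0 = 0" by simp_all
    then show ?thesis using fixp[of \<i> 0] by auto
  qed
  moreover have "mob a b c e \<circ> J \<in> extended_moebius" using det extended_moebius_iff by blast
  ultimately show ?thesis using inv by (simp add: reflection_def)
qed

lemma antirot_one_reflection: "reflection (antirot 1)"
proof -
  have "reflection (mob 0 \<i> \<i> 0 \<circ> J)" by (rule anti_identity_is_reflection) simp_all
  moreover have "mob 0 \<i> \<i> 0 = mob 0 1 1 0" using mob_scale[of \<i> 0 1 1 0] by simp
  ultimately show ?thesis by (simp add: antirot_def)
qed

lemma antirot_extended: "norm c = 1 \<Longrightarrow> antirot c \<in> extended_moebius"
  unfolding extended_moebius_def antirot_def using mob_in_PSL2[of 0 0 c 1] by fastforce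

lemma antirot_square:
  assumes "norm c = 1" shows "antirot c \<circ> antirot c = mob (c * c) 0 0 1"
proof (rule sphere_fun_eqI)
  fix x y :: complex assume xy: "x \<noteq> 0 \<or> y \<noteq> 0"
  have c0: "c \<noteq> 0" using assms by auto
  have nz: "c * cnj y \<noteq> 0 \<or> cnj x \<noteq> 0" using xy c0 by auto
  have "(antirot c \<circ> antirot c) (hpt x y) = hpt (c * x) (cnj c * y)"
    by (simp only: comp_apply antirot_hpt[OF xy] antirot_hpt[OF nz] complex_cnj_cnj complex_cnj_mult)
  also have "\<dots> = hpt (c * (c * x)) (c * (cnj c * y))" by (rule hpt_scale[OF c0, symmetric])
  also have "c * (cnj c * y) = y" using unit_cnj[OF assms] by (simp only: mult.assoc[symmetric] mult_1)
  finally show "(antirot c \<circ> antirot c) (hpt x y) = mob (c * c) 0 0 1 (hpt x y)" using xy by (simp add: mob_hpt mult.assoc)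
qed

lemma antirot_even_power_commutes:
  assumes c: "norm c = 1" and comm: "antirot c \<circ> \<phi> = \<phi> \<circ> antirot c"
  shows "mob (c ^ (2 * k)) 0 0 1 \<circ> \<phi> = \<phi> \<circ> mob (c ^ (2 * k)) 0 0 1"
proof (induction k)
  case 0
  then show ?case using mob_id[of 1] by simp
next
  case (Suc k)
  have "c ^ (2 * k) \<noteq> 0" using c by auto
  then have "mob (c ^ (2 * Suc k)) 0 0 1 = (antirot c \<circ> antirot c) \<circ> mob (c ^ (2 * k)) 0 0 1"
    unfolding antirot_square[OF c] by (subst mob_comp) (simp_all add: mult.assoc)
  note step = this
  show ?case unfolding step by (rule comp_commutes[OF comp_commutes[OF comm comm] Suc.IH])
qed

lemma antipode_is_anti_involution: "antirot (- 1) \<circ> antirot (- 1) = id"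
  using antirot_square[of "- 1"] mob_id[of 1] by simp

lemma minus_is_half_turn: "mob (- 1) 0 0 1 \<in> PSL2" "mob (- 1) 0 0 1 \<noteq> id" "mob (- 1) 0 0 1 \<circ> mob (- 1) 0 0 1 = id"
proof -
  show "mob (- 1) 0 0 1 \<in> PSL2" by (rule mob_in_PSL2) simp
  show "mob (- 1) 0 0 1 \<noteq> id" using mob_eq_id_iff[of "- 1" 1 0 0] by simp
  show "mob (- 1) 0 0 1 \<circ> mob (- 1) 0 0 1 = id" using mob_comp[of "- 1" 1 0 0 "- 1" 0 0 1] mob_id[of 1] by simp
qed

text \<open>The \<open>n\<close>-th iterate of \<open>antirot c\<close> is \<open>antirot (- 1)\<close> or \<open>z \<mapsto> - z\<close>, according to the parity
  of \<open>n\<close>.\<close>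

lemma commuting_antirot_parity:
  assumes "norm c = 1" "antirot c \<circ> \<phi> = \<phi> \<circ> antirot c" "c ^ n = - 1"
  shows "if odd n then has_anti_involution \<phi> else has_half_turn \<phi>"
proof (cases "odd n")
  case True
  then obtain k where k: "n = 2 * k + 1" by (rule oddE)
  have "antirot (- 1) \<circ> \<phi> = \<phi> \<circ> antirot (- 1)"
    using antirot_odd_power_commutes[OF assms(1,2), of k] assms(3) unfolding k by simp
  then show ?thesis using True antirot_extended[of "- 1"] antipode_is_anti_involution
    unfolding has_anti_involution_def by auto
next
  case False
  then obtain k where k: "n = 2 * k" by auto
  have "mob (- 1) 0 0 1 \<circ> \<phi> = \<phi> \<circ> mob (- 1) 0 0 1"
    using antirot_even_power_commutes[OF assms(1,2), of k] assms(3) unfolding k by simp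
  then show ?thesis using False minus_is_half_turn unfolding has_half_turn_def by auto
qed

lemma pseudo_real_cover:
  assumes d: "d \<ge> 2" and r: "is_rat d \<phi>" and p: "pseudo_real \<phi>"
  shows "\<exists>\<psi>. is_rat d \<psi> \<and> orbit \<psi> = orbit \<phi> \<and> (has_anti_involution \<psi> \<or> has_half_turn \<psi>)"
proof -
  have d1: "d \<ge> 1" using d by simp
  obtain T where T: "T \<in> PSL2" "(T \<circ> J) \<circ> \<phi> = \<phi> \<circ> (T \<circ> J)"
    using p by (auto simp: pseudo_real_iff extended_moebius_def)
  obtain S c P Q where S: "S \<in> PSL2" "norm c = 1"
    and nd: "nondeg d P Q" "S \<circ> \<phi> \<circ> Hilbert_Choice.inv S = quotient_fun d P Q"
    and comm: "antirot c \<circ> quotient_fun d P Q = quotient_fun d P Q \<circ> antirot c"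
    using normal_form_representative[OF d r T] by metis
  have "\<not> has_reflection (quotient_fun d P Q)"
    using p has_reflection_conj_iff[OF S(1), of \<phi>] unfolding nd(2) pseudo_real_iff by blast
  then have "antirot 1 \<circ> quotient_fun d P Q \<noteq> quotient_fun d P Q \<circ> antirot 1"
    using antirot_one_reflection unfolding has_reflection_def by blast
  then obtain n where "n \<ge> 1" "c ^ n = - 1"
    using commuting_dichotomy[OF d1 nd(1) S(2) comm] by metis
  then have "has_anti_involution (quotient_fun d P Q) \<or> has_half_turn (quotient_fun d P Q)"
    using commuting_antirot_parity[OF S(2) comm] by (metis (full_types))
  moreover have "orbit (quotient_fun d P Q) = orbit \<phi>" using orbit_conj[OF S(1), of \<phi>] nd(2) by simp
  ultimately show ?thesis using is_ratI[OF nd(1)] by blast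
qed

text \<open>For a symmetric matrix \<open>A\<close> the square of the antilinear map is \<open>A\<close> times its adjoint, which
  is positive definite. It represents an automorphism, hence is the identity by
  \<open>automorphism_positive_eigenvalue\<close>.\<close>

lemma symmetric_anti_automorphism_is_reflection:
  assumes d: "d \<ge> 2" and n: "nondeg d P Q" and det: "a * e - b * b = 1"
    and comm: "(mob a b b e \<circ> J) \<circ> quotient_fun d P Q = quotient_fun d P Q \<circ> (mob a b b e \<circ> J)"
  shows "reflection (mob a b b e \<circ> J)"
proof -
  define a' b' c' e' where B: "a' = a * cnj a + b * cnj b" "b' = a * cnj b + b * cnj e"
    "c' = b * cnj a + e * cnj b" "e' = b * cnj b + e * cnj e"
  have sq: "(mob a b b e \<circ> J) \<circ> (mob a b b e \<circ> J) = mob a' b' c' e'"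
    unfolding B by (rule antiholomorphic_square[OF det])
  have commB: "quotient_fun d P Q \<circ> mob a' b' c' e' = mob a' b' c' e' \<circ> quotient_fun d P Q"
    unfolding sq[symmetric] by (rule comp_commutes[OF comm comm, symmetric])
  have "a' * e' - b' * c' = (a * e - b * b) * cnj (a * e - b * b)" by (simp add: B algebra_simps)
  then have detB: "a' * e' - b' * c' = 1" unfolding det by simp
  obtain l x y where ev: "x \<noteq> 0 \<or> y \<noteq> 0" "a' * x + b' * y = l * x" "c' * x + e' * y = l * y"
    by (rule eigenvector_exists)
  have "a' * x + b' * y \<noteq> 0 \<or> c' * x + e' * y \<noteq> 0"
    by (rule linear_nonzero[OF _ ev(1)]) (simp add: detB)
  then have "l * x \<noteq> 0 \<or> l * y \<noteq> 0" by (simp only: ev(2,3))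
  then have l0: "l \<noteq> 0" by (cases "l = 0") simp_all
  \<comment> \<open>The square is \<open>A A*\<close> for a symmetric matrix \<open>A\<close>, hence positive definite.\<close>
  define R where "R = (norm x)\<^sup>2 + (norm y)\<^sup>2"
  define L where "L = (norm (cnj a * x + cnj b * y))\<^sup>2 + (norm (cnj b * x + cnj e * y))\<^sup>2"
  have "l * of_real R = l * x * cnj x + l * y * cnj y"
    by (simp only: R_def of_real_add complex_norm_square) (simp add: algebra_simps)
  also have "\<dots> = (a' * x + b' * y) * cnj x + (c' * x + e' * y) * cnj y" unfolding ev(2,3) ..
  also have "\<dots> = of_real L"
    by (simp only: L_def of_real_add complex_norm_square) (simp add: B algebra_simps)
  finally have lR: "l * of_real R = of_real L" .
  have R0: "R > 0" using ev(1) by (auto simp: R_def add_pos_nonneg add_nonneg_pos)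
  then have l: "l = of_real (L / R)" using lR by (simp add: field_simps)
  have "L \<ge> 0" by (simp add: L_def)
  moreover have "L \<noteq> 0" using l l0 by auto
  ultimately have "L / R > 0" using R0 by simp
  then have "a' = 1 \<and> b' = 0 \<and> c' = 0 \<and> e' = 1"
    using automorphism_positive_eigenvalue[OF d n detB commB ev(1)] ev(2,3) l by blast
  then show ?thesis by (intro anti_identity_is_reflection det) (simp_all add: B)
qed

text \<open>In normal form the involution is the reflection or the antipodal map \<open>z \<mapsto> - 1 / cnj z\<close>. In
  the second case a matrix of trace zero times the matrix of the antipodal map is symmetric, so
  the composition with the half turn is a reflection.\<close>

lemma anti_involution_half_turn_reflection:
  assumes d: "d \<ge> 2" and r: "is_rat d \<phi>" and ai: "has_anti_involution \<phi>" and ht: "has_half_turn \<phi>"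
  shows "has_reflection \<phi>"
proof -
  obtain Q0 where Q0: "Q0 \<in> extended_moebius" "Q0 \<circ> Q0 = id" "Q0 \<circ> \<phi> = \<phi> \<circ> Q0"
    using ai by (auto simp: has_anti_involution_def)
  obtain T where T: "T \<in> PSL2" "Q0 = T \<circ> J" using Q0(1) by (auto simp: extended_moebius_def)
  obtain S c P Q where S: "S \<in> PSL2" "norm c = 1" "S \<circ> (T \<circ> J) \<circ> Hilbert_Choice.inv S = antirot c"
    and nd: "nondeg d P Q" "S \<circ> \<phi> \<circ> Hilbert_Choice.inv S = quotient_fun d P Q"
    and comm: "antirot c \<circ> quotient_fun d P Q = quotient_fun d P Q \<circ> antirot c"
    using normal_form_representative[OF d r T(1) Q0(3)[unfolded T(2)]] by metis
  have c0: "c \<noteq> 0" using S(2) by auto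
  have "antirot c \<circ> antirot c = id"
    using conj_involution[OF PSL2_bij[OF S(1)] Q0(2)] unfolding T(2) S(3) .
  then have "c * c = 1" unfolding antirot_square[OF S(2)] using mob_eq_id_iff[of "c * c" 1 0 0] c0 by simp
  then consider "c = 1" | "c = - 1" by (auto simp: square_eq_1_iff)
  then have "has_reflection (quotient_fun d P Q)"
  proof cases
    case 1
    then show ?thesis using comm antirot_one_reflection unfolding has_reflection_def by blast
  next
    case 2
    have "has_half_turn (quotient_fun d P Q)" using has_half_turn_conj[OF S(1) ht] unfolding nd(2) .
    then obtain U where U: "U \<in> PSL2" "U \<noteq> id" "U \<circ> U = id" "U \<circ> quotient_fun d P Q = quotient_fun d P Q \<circ> U"
      by (auto simp: has_half_turn_def)
    obtain a b f e where det: "a * e - b * f = 1" and Um: "U = mob a b f e" using U(1) unfolding PSL2_iff by metis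
    have "a + e = 0" using half_turn_iff_trace[OF det] U(2,3) unfolding Um by blast
    then have e: "e = - a" by (simp add: eq_neg_iff_add_eq_0 add.commute)
    have "U \<circ> antirot c = mob b (- a) (- a) (- f) \<circ> J"
    proof -
      have "mob a b f e \<circ> mob 0 c 1 0 = mob b (- a) (- a) (- f)"
        using 2 by (subst mob_comp) (simp_all add: e)
      then show ?thesis unfolding antirot_def Um by (metis comp_assoc)
    qed
    moreover have "b * (- f) - (- a) * (- a) = 1" using det e by (simp add: algebra_simps)
    moreover have "(U \<circ> antirot c) \<circ> quotient_fun d P Q = quotient_fun d P Q \<circ> (U \<circ> antirot c)"
      by (rule comp_commutes[OF U(4) comm])
    ultimately show ?thesis using symmetric_anti_automorphism_is_reflection[OF d nd(1)] unfolding has_reflection_def by metis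
  qed
  then show ?thesis using has_reflection_conj_iff[OF S(1), of \<phi>] unfolding nd(2) by blast
qed

text \<open>Commuting with \<open>M \<circ> J\<close> is the same as \<open>M\<close> conjugating the complex conjugate map to the map
  itself; this reduces antiholomorphic automorphisms to conjugating matrices.\<close>

lemma anti_commutes_iff:
  fixes \<phi> M :: "sphere \<Rightarrow> sphere"
  shows "\<phi> \<circ> M = M \<circ> (J \<circ> \<phi> \<circ> J) \<longleftrightarrow> (M \<circ> J) \<circ> \<phi> = \<phi> \<circ> (M \<circ> J)"
proof
    assume h: "\<phi> \<circ> M = M \<circ> (J \<circ> \<phi> \<circ> J)"
    have "\<phi> \<circ> (M \<circ> J) = (M \<circ> (J \<circ> \<phi> \<circ> J)) \<circ> J" using h by (simp add: comp_assoc[symmetric])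
    then show "(M \<circ> J) \<circ> \<phi> = \<phi> \<circ> (M \<circ> J)" by (simp add: comp_assoc J_J)
  next
    assume h: "(M \<circ> J) \<circ> \<phi> = \<phi> \<circ> (M \<circ> J)"
    have "M \<circ> (J \<circ> \<phi> \<circ> J) = (\<phi> \<circ> (M \<circ> J)) \<circ> J" unfolding h[symmetric] by (simp add: comp_assoc)
    then show "\<phi> \<circ> M = M \<circ> (J \<circ> \<phi> \<circ> J)" by (simp add: comp_assoc J_J)
qed

lemma commuting_anti_maps_converge:
  fixes P Q :: "nat \<Rightarrow> complex poly" and a b c e :: "nat \<Rightarrow> complex"
  assumes d: "d \<ge> 2" and nd: "\<And>k. nondeg d (P k) (Q k)" and nd': "nondeg d P' Q'"
    and lim: "\<And>i. (\<lambda>k. coeff (P k) i) \<longlonglongrightarrow> coeff P' i" "\<And>i. (\<lambda>k. coeff (Q k) i) \<longlonglongrightarrow> coeff Q' i"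
    and det: "\<And>k. a k * e k - b k * c k = 1"
    and comm: "\<And>k. (mob (a k) (b k) (c k) (e k) \<circ> J) \<circ> quotient_fun d (P k) (Q k) = quotient_fun d (P k) (Q k) \<circ> (mob (a k) (b k) (c k) (e k) \<circ> J)"
  obtains r a' b' c' e' where "strict_mono (r :: nat \<Rightarrow> nat)" "(a \<circ> r) \<longlonglongrightarrow> a'" "(b \<circ> r) \<longlonglongrightarrow> b'"
    "(c \<circ> r) \<longlonglongrightarrow> c'" "(e \<circ> r) \<longlonglongrightarrow> e'" "a' * e' - b' * c' = 1"
    "(mob a' b' c' e' \<circ> J) \<circ> quotient_fun d P' Q' = quotient_fun d P' Q' \<circ> (mob a' b' c' e' \<circ> J)"
proof -
  have eq: "quotient_fun d (P k) (Q k) \<circ> mob (a k) (b k) (c k) (e k) = mob (a k) (b k) (c k) (e k) \<circ> quotient_fun d (cpoly (P k)) (cpoly (Q k))" for k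
    unfolding J_quotient_fun[OF nd, symmetric] anti_commutes_iff by (rule comm)
  have lim': "(\<lambda>k. coeff (cpoly (P k)) i) \<longlonglongrightarrow> coeff (cpoly P') i" "(\<lambda>k. coeff (cpoly (Q k)) i) \<longlonglongrightarrow> coeff (cpoly Q') i" for i
    unfolding coeff_cpoly by (intro tendsto_cnj lim)+
  obtain r a' b' c' e' where *: "strict_mono (r :: nat \<Rightarrow> nat)" "(a \<circ> r) \<longlonglongrightarrow> a'" "(b \<circ> r) \<longlonglongrightarrow> b'"
    "(c \<circ> r) \<longlonglongrightarrow> c'" "(e \<circ> r) \<longlonglongrightarrow> e'" "a' * e' - b' * c' = 1"
    "quotient_fun d P' Q' \<circ> mob a' b' c' e' = mob a' b' c' e' \<circ> quotient_fun d (cpoly P') (cpoly Q')"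
    by (rule conjugating_maps_converge[OF d nd nondeg_cpoly[OF nd] nd' nondeg_cpoly[OF nd'] lim lim' det eq])
  from *(7) have "(mob a' b' c' e' \<circ> J) \<circ> quotient_fun d P' Q' = quotient_fun d P' Q' \<circ> (mob a' b' c' e' \<circ> J)"
    unfolding J_quotient_fun[OF nd', symmetric] anti_commutes_iff .
  with * that show ?thesis by blast
qed

text \<open>Being an involution is a system of equations for the matrix, so it passes to the limits
  provided by \<open>commuting_anti_maps_converge\<close>.\<close>

lemma closed_anti_involution:
  assumes d: "d \<ge> 2" shows "closedin (moduli_space d) {orbit \<phi> | \<phi>. is_rat d \<phi> \<and> has_anti_involution \<phi>}"
proof (rule closedin_moduli)
  show "d \<ge> 1" using d by simp
  show "has_anti_involution (T \<circ> \<phi> \<circ> Hilbert_Choice.inv T)" if "T \<in> PSL2" "has_anti_involution \<phi>" for \<phi> T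
    using has_anti_involution_conj that .
next
  fix P Q :: "nat \<Rightarrow> complex poly" and P' Q'
  assume nd: "\<And>k. nondeg d (P k) (Q k)" and nd': "nondeg d P' Q'"
    and lim: "\<And>i. (\<lambda>k. coeff (P k) i) \<longlonglongrightarrow> coeff P' i" "\<And>i. (\<lambda>k. coeff (Q k) i) \<longlonglongrightarrow> coeff Q' i"
    and R: "\<And>k. has_anti_involution (quotient_fun d (P k) (Q k))"
  have "\<exists>a b c e. a * e - b * c = 1 \<and> (mob a b c e \<circ> J) \<circ> (mob a b c e \<circ> J) = id \<and>
    (mob a b c e \<circ> J) \<circ> quotient_fun d (P k) (Q k) = quotient_fun d (P k) (Q k) \<circ> (mob a b c e \<circ> J)" for k
  proof -
    obtain Q0 where Q0: "Q0 \<in> extended_moebius" "Q0 \<circ> Q0 = id" "Q0 \<circ> quotient_fun d (P k) (Q k) = quotient_fun d (P k) (Q k) \<circ> Q0"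
      using R[of k] unfolding has_anti_involution_def by blast
    obtain a b c e where m: "a * e - b * c = 1" "Q0 = mob a b c e \<circ> J"
      using Q0(1) unfolding extended_moebius_iff by blast
    show ?thesis using m(1) Q0(2,3) unfolding m(2) by blast
  qed
  then obtain a b c e where det: "\<And>k. a k * e k - b k * c k = 1"
    and sq: "\<And>k. (mob (a k) (b k) (c k) (e k) \<circ> J) \<circ> (mob (a k) (b k) (c k) (e k) \<circ> J) = id"
    and comm: "\<And>k. (mob (a k) (b k) (c k) (e k) \<circ> J) \<circ> quotient_fun d (P k) (Q k) = quotient_fun d (P k) (Q k) \<circ> (mob (a k) (b k) (c k) (e k) \<circ> J)"
    by metis
  obtain r a' b' c' e' where *: "strict_mono (r :: nat \<Rightarrow> nat)" "(a \<circ> r) \<longlonglongrightarrow> a'" "(b \<circ> r) \<longlonglongrightarrow> b'"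
    "(c \<circ> r) \<longlonglongrightarrow> c'" "(e \<circ> r) \<longlonglongrightarrow> e'" "a' * e' - b' * c' = 1"
    "(mob a' b' c' e' \<circ> J) \<circ> quotient_fun d P' Q' = quotient_fun d P' Q' \<circ> (mob a' b' c' e' \<circ> J)"
    by (rule commuting_anti_maps_converge[OF d nd nd' lim det comm])
  have rel: "(a \<circ> r) k * cnj ((b \<circ> r) k) + (b \<circ> r) k * cnj ((e \<circ> r) k) = 0"
    "(c \<circ> r) k * cnj ((a \<circ> r) k) + (e \<circ> r) k * cnj ((c \<circ> r) k) = 0"
    "(a \<circ> r) k * cnj ((a \<circ> r) k) + (b \<circ> r) k * cnj ((c \<circ> r) k) - ((c \<circ> r) k * cnj ((b \<circ> r) k) + (e \<circ> r) k * cnj ((e \<circ> r) k)) = 0" for k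
    using sq[of "r k"] anti_involution_iff[OF det[of "r k"]] by simp_all
  have "(\<lambda>k. (a \<circ> r) k * cnj ((b \<circ> r) k) + (b \<circ> r) k * cnj ((e \<circ> r) k)) \<longlonglongrightarrow> a' * cnj b' + b' * cnj e'"
    "(\<lambda>k. (c \<circ> r) k * cnj ((a \<circ> r) k) + (e \<circ> r) k * cnj ((c \<circ> r) k)) \<longlonglongrightarrow> c' * cnj a' + e' * cnj c'"
    "(\<lambda>k. (a \<circ> r) k * cnj ((a \<circ> r) k) + (b \<circ> r) k * cnj ((c \<circ> r) k) - ((c \<circ> r) k * cnj ((b \<circ> r) k) + (e \<circ> r) k * cnj ((e \<circ> r) k)))
      \<longlonglongrightarrow> a' * cnj a' + b' * cnj c' - (c' * cnj b' + e' * cnj e')"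
    by (intro tendsto_intros tendsto_cnj *)+
  then have "a' * cnj b' + b' * cnj e' = 0" "c' * cnj a' + e' * cnj c' = 0"
    "a' * cnj a' + b' * cnj c' - (c' * cnj b' + e' * cnj e') = 0"
    unfolding rel by (simp_all only: LIMSEQ_const_iff)
  then have "(mob a' b' c' e' \<circ> J) \<circ> (mob a' b' c' e' \<circ> J) = id" using anti_involution_iff[OF *(6)] by simp
  moreover have "mob a' b' c' e' \<circ> J \<in> extended_moebius" using *(6) extended_moebius_iff by blast
  ultimately show "has_anti_involution (quotient_fun d P' Q')" using *(7) unfolding has_anti_involution_def by blast
qed

lemma closed_half_turn:
  assumes d: "d \<ge> 2" shows "closedin (moduli_space d) {orbit \<phi> | \<phi>. is_rat d \<phi> \<and> has_half_turn \<phi>}"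
proof (rule closedin_moduli)
  show "d \<ge> 1" using d by simp
  show "has_half_turn (T \<circ> \<phi> \<circ> Hilbert_Choice.inv T)" if "T \<in> PSL2" "has_half_turn \<phi>" for \<phi> T
    using has_half_turn_conj that .
next
  fix P Q :: "nat \<Rightarrow> complex poly" and P' Q'
  assume nd: "\<And>k. nondeg d (P k) (Q k)" and nd': "nondeg d P' Q'"
    and lim: "\<And>i. (\<lambda>k. coeff (P k) i) \<longlonglongrightarrow> coeff P' i" "\<And>i. (\<lambda>k. coeff (Q k) i) \<longlonglongrightarrow> coeff Q' i"
    and R: "\<And>k. has_half_turn (quotient_fun d (P k) (Q k))"
  have "\<exists>a b c e. a * e - b * c = 1 \<and> a + e = 0 \<and>
    quotient_fun d (P k) (Q k) \<circ> mob a b c e = mob a b c e \<circ> quotient_fun d (P k) (Q k)" for k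
  proof -
    obtain S where S: "S \<in> PSL2" "S \<noteq> id" "S \<circ> S = id" "S \<circ> quotient_fun d (P k) (Q k) = quotient_fun d (P k) (Q k) \<circ> S"
      using R[of k] unfolding has_half_turn_def by blast
    obtain a b c e where m: "a * e - b * c = 1" "S = mob a b c e" using S(1) unfolding PSL2_iff by metis
    then have "a + e = 0" using half_turn_iff_trace[OF m(1)] S(2,3) by blast
    then show ?thesis using m S(4) by metis
  qed
  then obtain a b c e where det: "\<And>k. a k * e k - b k * c k = 1" and tr: "\<And>k. a k + e k = 0"
    and comm: "\<And>k. quotient_fun d (P k) (Q k) \<circ> mob (a k) (b k) (c k) (e k) = mob (a k) (b k) (c k) (e k) \<circ> quotient_fun d (P k) (Q k)"
    by metis
  obtain r a' b' c' e' where *: "strict_mono (r :: nat \<Rightarrow> nat)" "(a \<circ> r) \<longlonglongrightarrow> a'" "(b \<circ> r) \<longlonglongrightarrow> b'"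
    "(c \<circ> r) \<longlonglongrightarrow> c'" "(e \<circ> r) \<longlonglongrightarrow> e'" "a' * e' - b' * c' = 1"
    "quotient_fun d P' Q' \<circ> mob a' b' c' e' = mob a' b' c' e' \<circ> quotient_fun d P' Q'"
    by (rule conjugating_maps_converge[OF d nd nd nd' nd' lim lim det comm])
  have "(\<lambda>k. (a \<circ> r) k + (e \<circ> r) k) \<longlonglongrightarrow> a' + e'" by (intro tendsto_intros *)
  then have "a' + e' = 0" using tr by (simp add: LIMSEQ_const_iff)
  then show "has_half_turn (quotient_fun d P' Q')"
    using half_turn_iff_trace[OF *(6)] *(7) mob_in_PSL2[of a' e' b' c'] *(6)
    unfolding has_half_turn_def by auto
qed

section \<open>Pseudo-real maps of every odd degree\<close>

text \<open>For \<open>t = 0\<close> these are the maps \<open>z \<mapsto> \<i> * z ^ d\<close> and \<open>z \<mapsto> \<i> / z ^ d\<close> with \<open>d = m + n\<close>. The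
  factor \<open>\<i>\<close> obstructs the reflections that fix \<open>0\<close> and \<open>\<infinity>\<close>.\<close>

definition perturbed_power :: "bool \<Rightarrow> nat \<Rightarrow> nat \<Rightarrow> real \<Rightarrow> sphere \<Rightarrow> sphere" where
  "perturbed_power sw n m t =
     quotient_fun (m + n) (orb_num sw \<i> n m [of_real t]) (orb_den sw n m [of_real t])"

lemma antipode_free_real: "antipode_free [complex_of_real t]"
proof -
  have "t * t \<noteq> - 1" by (smt (verit) zero_le_square)
  then have "complex_of_real (t * t) \<noteq> of_real (- 1)" by (simp only: of_real_eq_iff not_False_eq_True)
  then show ?thesis by (simp add: antipode_free_def)
qed

lemma nondeg_perturbed:
  "n \<ge> 1 \<Longrightarrow> nondeg (m + n) (orb_num sw \<i> n m [of_real t]) (orb_den sw n m [of_real t])"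
  using nondeg_orb[of n \<i> "[of_real t]" m sw] antipode_free_real[of t] by simp

lemma hform_perturbed:
  "hform (m + n) (orb_num sw \<i> n m [of_real t]) x y =
     \<i> * (if sw then y ^ m * (y ^ n + of_real t * x ^ n) else x ^ m * (x ^ n - of_real t * y ^ n))"
  "hform (m + n) (orb_den sw n m [of_real t]) x y =
     (if sw then x ^ m * (x ^ n - of_real t * y ^ n) else y ^ m * (y ^ n + of_real t * x ^ n))"
  using hform_orb[of n m "[of_real t]" x y] hform_coorb[of n "[of_real t]" m x y]
  by (simp_all add: orb_num_def orb_den_def hform_smult)

lemma perturbed_power_hpt:
  assumes "n \<ge> 1" "x \<noteq> 0 \<or> y \<noteq> 0"
  shows "perturbed_power sw n m t (hpt x y) =
    (if sw then hpt (\<i> * (y ^ m * (y ^ n + of_real t * x ^ n))) (x ^ m * (x ^ n - of_real t * y ^ n))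
     else hpt (\<i> * (x ^ m * (x ^ n - of_real t * y ^ n))) (y ^ m * (y ^ n + of_real t * x ^ n)))"
  unfolding perturbed_power_def quotient_fun_hpt[OF nondeg_degree[OF nondeg_perturbed[OF assms(1)]] assms(2)] hform_perturbed
  by simp

lemma perturbed_power_nonzero:
  assumes "n \<ge> 1" "x \<noteq> 0 \<or> y \<noteq> 0"
  shows "x ^ m * (x ^ n - of_real t * y ^ n) \<noteq> 0 \<or> y ^ m * (y ^ n + of_real t * x ^ n) \<noteq> (0 :: complex)"
  using nondeg_hform[OF nondeg_perturbed[OF assms(1), of m False t] assms(2)] unfolding hform_perturbed by simp

text \<open>In the disc of radius \<open>1 / 2\<close> the map \<open>z \<mapsto> z ^ m * (z ^ n + A) / (1 + B * z ^ n)\<close> contracts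
  towards \<open>0\<close>: the factor in the numerator is at most \<open>3 / 4\<close> and the denominator at least
  \<open>7 / 8\<close>, and their quotient is \<open>6 / 7\<close>.\<close>

lemma attracting_estimate:
  fixes x y A B :: complex
  assumes A: "norm A \<le> 1 / 4" and B: "norm B \<le> 1 / 4" and xy: "2 * norm x \<le> norm y" "y \<noteq> 0" and mn: "m \<ge> 1" "n \<ge> 1"
  shows "y ^ m * (y ^ n + B * x ^ n) \<noteq> 0 \<and>
    norm (x ^ m * (x ^ n + A * y ^ n)) * norm y \<le> 6 / 7 * norm x * norm (y ^ m * (y ^ n + B * x ^ n))"
proof -
  define p q where "p = norm y" and "q = norm x"
  have p: "p > 0" and q: "q \<ge> 0" and qp: "q \<le> p / 2" using xy by (auto simp: p_def q_def)
  obtain n' where n': "n = Suc n'" using mn(2) by (cases n) auto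
  obtain m' where m': "m = Suc m'" using mn(1) by (cases m) auto
  have "q ^ n \<le> (p / 2) * p ^ n'" unfolding n' power_Suc using q qp p by (intro mult_mono power_mono) auto
  then have qn: "q ^ n \<le> p ^ n / 2" by (simp add: n')
  have "norm (x ^ n + A * y ^ n) \<le> q ^ n + norm A * p ^ n"
    by (rule order_trans[OF norm_triangle_ineq]) (simp add: norm_mult norm_power p_def q_def)
  also have "norm A * p ^ n \<le> 1 / 4 * p ^ n" using A p by (intro mult_right_mono) auto
  finally have up: "norm (x ^ n + A * y ^ n) \<le> 3 / 4 * p ^ n" using qn by simp
  have "norm (y ^ n) - norm (B * x ^ n) \<le> norm (y ^ n + B * x ^ n)"
    using norm_triangle_ineq2[of "y ^ n" "- (B * x ^ n)"] by simp
  moreover have "norm (B * x ^ n) \<le> 1 / 4 * (p ^ n / 2)"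
    unfolding norm_mult norm_power q_def[symmetric] using B qn q by (intro mult_mono) auto
  ultimately have low: "7 / 8 * p ^ n \<le> norm (y ^ n + B * x ^ n)" by (simp add: norm_power p_def)
  have pn: "p ^ n > 0" "p ^ m > 0" using p by auto
  then have nz: "y ^ n + B * x ^ n \<noteq> 0" using low by auto
  have qm: "q ^ m * p \<le> q * p ^ m"
  proof -
    have "q ^ m' \<le> p ^ m'" using q qp p by (intro power_mono) auto
    then have "q * q ^ m' * p \<le> q * p ^ m' * p" using q p by (intro mult_right_mono mult_left_mono) auto
    then show ?thesis by (simp add: m' mult_ac)
  qed
  have "norm (x ^ m * (x ^ n + A * y ^ n)) * norm y = q ^ m * p * norm (x ^ n + A * y ^ n)"
    by (simp add: norm_mult norm_power p_def q_def)
  also have "\<dots> \<le> (q * p ^ m) * (3 / 4 * p ^ n)"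
    by (rule mult_mono[OF qm up]) (use q p pn in auto)
  also have "\<dots> = 6 / 7 * q * (p ^ m * (7 / 8 * p ^ n))" by simp
  also have "\<dots> \<le> 6 / 7 * q * (p ^ m * norm (y ^ n + B * x ^ n))"
    using low q pn by (intro mult_left_mono) auto
  also have "\<dots> = 6 / 7 * norm x * norm (y ^ m * (y ^ n + B * x ^ n))"
    by (simp add: norm_mult norm_power p_def q_def)
  finally show ?thesis using nz xy(2) by simp
qed

lemma contraction_chain:
  fixes x y X Y f g :: real
  assumes "x \<ge> 0" "Y > 0" "g > 0" "y \<ge> 0" "X \<ge> 0"
    and "X * y \<le> 6 / 7 * x * Y" "f * Y \<le> 6 / 7 * X * g" "f * y = x * g"
  shows "x = 0"
proof (rule ccontr)
  assume "x \<noteq> 0"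
  with assms(1) have x: "x > 0" by simp
  have "x * g * Y = (f * Y) * y" using assms(8) by (simp add: mult_ac)
  also have "\<dots> \<le> (6 / 7 * X * g) * y" using assms(7,4) by (rule mult_right_mono)
  also have "\<dots> = 6 / 7 * g * (X * y)" by simp
  also have "\<dots> \<le> 6 / 7 * g * (6 / 7 * x * Y)" using assms(3,6) by (intro mult_left_mono) auto
  also have "\<dots> = 36 / 49 * (x * g * Y)" by simp
  finally have "x * g * Y \<le> 36 / 49 * (x * g * Y)" .
  moreover have "x * g * Y > 0" using x assms(2,3) by simp
  ultimately show False by linarith
qed

text \<open>The second iterate contracts the distance to \<open>0\<close>, as both steps do; in the reciprocal family
  the first step leads to a neighbourhood of \<open>\<infinity>\<close> and the second one back.\<close>

lemma periodic_near_zero: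
  assumes n: "n \<ge> 1" and m: "m \<ge> 1" and t: "\<bar>t\<bar> \<le> 1 / 4" and xy: "x \<noteq> 0 \<or> y \<noteq> 0" "2 * norm x \<le> norm y"
    and per: "perturbed_power sw n m t (perturbed_power sw n m t (hpt x y)) = hpt x y"
  shows "x = 0"
proof -
  have y0: "y \<noteq> 0" using xy by auto
  define F where "F x y = x ^ m * (x ^ n - of_real t * y ^ n)" for x y :: complex
  define G where "G x y = y ^ m * (y ^ n + of_real t * x ^ n)" for x y :: complex
  have map: "perturbed_power sw n m t (hpt x y) = (if sw then hpt (\<i> * G x y) (F x y) else hpt (\<i> * F x y) (G x y))"
    if "x \<noteq> 0 \<or> y \<noteq> 0" for x y unfolding F_def G_def by (rule perturbed_power_hpt[OF n that])
  have est: "G x y \<noteq> 0 \<and> norm (F x y) * norm y \<le> 6 / 7 * norm x * norm (G x y)"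
    if "2 * norm x \<le> norm y" "y \<noteq> 0" for x y
    using attracting_estimate[of "- of_real t" "of_real t" x y m n] that t m n by (simp add: F_def G_def)
  have est': "F x y \<noteq> 0 \<and> norm (G x y) * norm x \<le> 6 / 7 * norm y * norm (F x y)"
    if "2 * norm y \<le> norm x" "x \<noteq> 0" for x y
    using attracting_estimate[of "of_real t" "- of_real t" y x m n] that t m n by (simp add: F_def G_def)
  have small: "2 * X \<le> Y" if "X * norm y \<le> 6 / 7 * norm x * Y" "Y \<ge> 0" for X Y :: real
  proof -
    have "(2 * X) * norm y = 2 * (X * norm y)" by simp
    also have "\<dots> \<le> 2 * (6 / 7 * norm x * Y)" using that(1) by linarith
    also have "\<dots> = 6 / 7 * (2 * norm x) * Y" by simp
    also have "\<dots> \<le> 6 / 7 * norm y * Y" using xy(2) that(2) by (intro mult_right_mono mult_left_mono) auto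
    also have "\<dots> \<le> 1 * norm y * Y" using that(2) by (intro mult_right_mono) auto
    finally have "(2 * X) * norm y \<le> Y * norm y" by (simp add: mult.commute)
    then show ?thesis using y0 by simp
  qed
  note e1 = est[OF xy(2) y0]
  have "norm x = 0"
  proof (cases sw)
    case False
    let ?X = "\<i> * F x y" and ?Y = "G x y"
    have XY: "2 * norm ?X \<le> norm ?Y" using small[of "norm (F x y)" "norm (G x y)"] e1 by (simp add: norm_mult)
    note e2 = est[OF XY conjunct1[OF e1]]
    have "hpt (\<i> * F ?X ?Y) (G ?X ?Y) = hpt x y" using per map[OF xy(1)] map[of ?X ?Y] e1 False by simp
    then have "\<i> * F ?X ?Y * y = x * G ?X ?Y" using e2 xy(1) by (subst (asm) hpt_eq_iff) auto
    then have "norm (\<i> * F ?X ?Y * y) = norm (x * G ?X ?Y)" by (rule arg_cong)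
    then have "norm (F ?X ?Y) * norm y = norm x * norm (G ?X ?Y)" by (simp only: norm_mult norm_ii mult_1)
    then show ?thesis using contraction_chain[of "norm x" "norm ?Y" "norm (G ?X ?Y)" "norm y" "norm ?X" "norm (F ?X ?Y)"] e1 e2
      by (simp add: norm_mult)
  next
    case True
    let ?X = "\<i> * G x y" and ?Y = "F x y"
    have XY: "2 * norm ?Y \<le> norm ?X" using small[of "norm (F x y)" "norm (G x y)"] e1 by (simp add: norm_mult)
    have X0: "?X \<noteq> 0" using e1 by simp
    note e2 = est'[OF XY X0]
    have "hpt (\<i> * G ?X ?Y) (F ?X ?Y) = hpt x y" using per map[OF xy(1)] map[of ?X ?Y] e1 True by simp
    then have "\<i> * G ?X ?Y * y = x * F ?X ?Y" using e2 xy(1) by (subst (asm) hpt_eq_iff) auto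
    then have "norm (\<i> * G ?X ?Y * y) = norm (x * F ?X ?Y)" by (rule arg_cong)
    then have "norm (G ?X ?Y) * norm y = norm x * norm (F ?X ?Y)" by (simp only: norm_mult norm_ii mult_1)
    then show ?thesis using contraction_chain[of "norm x" "norm ?X" "norm (F ?X ?Y)" "norm y" "norm ?Y" "norm (G ?X ?Y)"] e1 e2
      by (simp add: norm_mult)
  qed
  then show ?thesis by simp
qed

text \<open>The relation between \<open>m\<close> and \<open>n\<close> is exactly the compatibility required by \<open>orb_commutes\<close> for
  \<open>c = cis (pi / n)\<close>.\<close>

lemma perturbed_power_commutes:
  assumes n: "n \<ge> 1" and m: "if sw then m + 1 = n else m = n + 1"
  obtains c where "norm c = 1" "c ^ n = - 1" "antirot c \<circ> perturbed_power sw n m t = perturbed_power sw n m t \<circ> antirot c"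
proof -
  define c where "c = cis (pi / real n)"
  have c: "norm c = 1" by (simp add: c_def)
  have cn: "c ^ n = - 1" using n by (simp add: c_def Complex.DeMoivre)
  have "if sw then c * (c ^ m * (- 1) ^ length [complex_of_real t]) = 1 else c ^ m * (- 1) ^ length [complex_of_real t] = c"
  proof (cases sw)
    case True
    then have "c * c ^ m = c ^ n" using m by (simp flip: power_Suc)
    then show ?thesis using True cn by simp
  next
    case False
    then show ?thesis using m cn by (simp add: power_add)
  qed
  from orb_commutes[OF n _ antipode_free_real c cn this, of \<i> "m + n"]
  have "antirot c \<circ> perturbed_power sw n m t = perturbed_power sw n m t \<circ> antirot c"
    by (simp add: perturbed_power_def)
  with that c cn show ?thesis by blast
qed

text \<open>The symmetry \<open>antirot c\<close> carries the statement over from \<open>0\<close>.\<close>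

lemma periodic_near_infinity:
  assumes n: "n \<ge> 1" and m: "m \<ge> 1" "if sw then m + 1 = n else m = n + 1" and t: "\<bar>t\<bar> \<le> 1 / 4"
    and xy: "x \<noteq> 0 \<or> y \<noteq> 0" "2 * norm y \<le> norm x"
    and per: "perturbed_power sw n m t (perturbed_power sw n m t (hpt x y)) = hpt x y"
  shows "y = 0"
proof -
  obtain c where c: "norm c = 1" "antirot c \<circ> perturbed_power sw n m t = perturbed_power sw n m t \<circ> antirot c"
    using perturbed_power_commutes[OF n m(2)] by metis
  have c0: "c \<noteq> 0" using c(1) by auto
  let ?f = "perturbed_power sw n m t"
  have comm: "?f (antirot c s) = antirot c (?f s)" for s using fun_cong[OF c(2), of s] by simp
  have "?f (?f (antirot c (hpt x y))) = antirot c (hpt x y)" unfolding comm per ..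
  then have "?f (?f (hpt (c * cnj y) (cnj x))) = hpt (c * cnj y) (cnj x)" unfolding antirot_hpt[OF xy(1)] .
  then have "c * cnj y = 0" by (intro periodic_near_zero[OF n m(1) t]) (use xy c c0 in \<open>auto simp: norm_mult\<close>)
  then show ?thesis using c0 by simp
qed

lemma zero_infinity_periodic:
  assumes "n \<ge> 1" "m \<ge> 1"
  shows "perturbed_power sw n m t (perturbed_power sw n m t (hpt 0 1)) = hpt 0 1"
    "perturbed_power sw n m t (perturbed_power sw n m t (hpt 1 0)) = hpt 1 0"
proof -
  have i: "hpt \<i> 0 = hpt 1 0" by (simp add: hpt_def)
  have z: "perturbed_power sw n m t (hpt 0 1) = (if sw then hpt 1 0 else hpt 0 1)"
    "perturbed_power sw n m t (hpt 1 0) = (if sw then hpt 0 1 else hpt 1 0)"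
    using assms perturbed_power_hpt[of n 0 1 sw m t] perturbed_power_hpt[of n 1 0 sw m t]
    by (auto simp: power_0_left i hpt_def)
  show "perturbed_power sw n m t (perturbed_power sw n m t (hpt 0 1)) = hpt 0 1"
    "perturbed_power sw n m t (perturbed_power sw n m t (hpt 1 0)) = hpt 1 0"
  proof (atomize (full), cases sw)
    case True
    have "perturbed_power sw n m t (hpt 0 1) = hpt 1 0" "perturbed_power sw n m t (hpt 1 0) = hpt 0 1"
      using z True by simp_all
    then show "perturbed_power sw n m t (perturbed_power sw n m t (hpt 0 1)) = hpt 0 1 \<and>
      perturbed_power sw n m t (perturbed_power sw n m t (hpt 1 0)) = hpt 1 0" by (simp only: simp_thms)
  next
    case False
    have "perturbed_power sw n m t (hpt 0 1) = hpt 0 1" "perturbed_power sw n m t (hpt 1 0) = hpt 1 0"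
      using z False by simp_all
    then show "perturbed_power sw n m t (perturbed_power sw n m t (hpt 0 1)) = hpt 0 1 \<and>
      perturbed_power sw n m t (perturbed_power sw n m t (hpt 1 0)) = hpt 1 0" by (simp only: simp_thms)
  qed
qed

text \<open>The map \<open>z \<mapsto> w * cnj z\<close> with \<open>w = a / e\<close> permutes the solutions of \<open>z ^ n = t\<close>, the nonzero
  preimages of a point of \<open>{0, \<infinity>}\<close>, so \<open>w ^ n = 1\<close>. Then the values at \<open>1\<close> and at \<open>w\<close> are
  incompatible, as the factor \<open>\<i>\<close> changes its sign under conjugation.\<close>

lemma no_diagonal_anti_automorphism:
  assumes n: "n \<ge> 1" and m: "m \<ge> 1" "if sw then m + 1 = n else m = n + 1" and t: "0 < t" "t \<le> 1 / 4"
    and ae: "a * e \<noteq> 0"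
  shows "(mob a 0 0 e \<circ> J) \<circ> perturbed_power sw n m t \<noteq> perturbed_power sw n m t \<circ> (mob a 0 0 e \<circ> J)"
proof
  let ?f = "perturbed_power sw n m t" and ?s = "mob a 0 0 e \<circ> J"
  assume h: "?s \<circ> ?f = ?f \<circ> ?s"
  have comm: "?f (?s p) = ?s (?f p)" for p using fun_cong[OF h, of p] by simp
  have a0: "a \<noteq> 0" "e \<noteq> 0" using ae by auto
  have i0: "hpt a 0 = hpt 1 0" if "a \<noteq> 0" for a :: complex using that by (simp add: hpt_def)
  have o0: "hpt 0 a = hpt 0 1" if "a \<noteq> 0" for a :: complex using that by (simp add: hpt_def)
  have s: "mob a 0 0 e (J (hpt x y)) = hpt (a * cnj x) (e * cnj y)" if "x \<noteq> 0 \<or> y \<noteq> 0" for x y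
    using that by (simp add: J_hpt mob_hpt)
  have s0: "?s (hpt 0 1) = hpt 0 1" using s[of 0 1] o0[OF a0(2)] by simp
  have si: "?s (hpt 1 0) = hpt 1 0" using s[of 1 0] i0[OF a0(1)] by simp
  \<comment> \<open>A real zero of the factor \<open>z ^ n - t\<close>.\<close>
  define z where "z = complex_of_real (root n t)"
  have zn: "z ^ n = of_real t" using n t(1) by (simp add: z_def flip: of_real_power)
  have cz: "cnj z = z" and z0: "z \<noteq> 0" using n t(1) by (simp_all add: z_def)
  have T: "complex_of_real t \<noteq> 0" "1 - complex_of_real t \<noteq> 0" "1 + complex_of_real t \<noteq> 0"
  proof -
    have "t \<noteq> 0" "1 - t \<noteq> 0" "1 + t \<noteq> 0" using t by auto
    then show "complex_of_real t \<noteq> 0" "1 - complex_of_real t \<noteq> 0" "1 + complex_of_real t \<noteq> 0"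
      by (metis of_real_eq_0_iff of_real_1 of_real_add of_real_diff)+
  qed
  have F0: "z ^ m * (z ^ n - of_real t * 1 ^ n) = 0" by (simp add: zn)
  have G0: "1 ^ m * (1 ^ n + of_real t * z ^ n) \<noteq> 0" using perturbed_power_nonzero[OF n, of z 1 m t] z0 F0 by simp
  have aez: "a * z \<noteq> 0 \<or> e \<noteq> 0" using a0 by simp
  have "(a * z) ^ m * ((a * z) ^ n - of_real t * e ^ n) = 0"
  proof (cases sw)
    case False
    have "?f (hpt z 1) = hpt 0 1" using perturbed_power_hpt[OF n, of z 1 sw m t] z0 False F0 G0 by (simp add: hpt_def)
    then have "?f (?s (hpt z 1)) = hpt 0 1" by (simp only: comm s0 si)
    then have "?f (hpt (a * z) e) = hpt 0 1" using z0 by (simp add: s cz)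
    then have "hpt (\<i> * ((a * z) ^ m * ((a * z) ^ n - of_real t * e ^ n))) (e ^ m * (e ^ n + of_real t * (a * z) ^ n)) = hpt 0 1"
      using perturbed_power_hpt[OF n aez, of sw m t] False by simp
    then show ?thesis by (auto simp: hpt_def split: if_splits)
  next
    case True
    have "?f (hpt z 1) = hpt 1 0" using perturbed_power_hpt[OF n, of z 1 sw m t] z0 True F0 G0 by (simp add: hpt_def)
    then have "?f (?s (hpt z 1)) = hpt 1 0" by (simp only: comm s0 si)
    then have "?f (hpt (a * z) e) = hpt 1 0" using z0 by (simp add: s cz)
    then have "hpt (\<i> * (e ^ m * (e ^ n + of_real t * (a * z) ^ n))) ((a * z) ^ m * ((a * z) ^ n - of_real t * e ^ n)) = hpt 1 0"
      using perturbed_power_hpt[OF n aez, of sw m t] True by simp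
    then show ?thesis by (auto simp: hpt_def split: if_splits)
  qed
  then have "of_real t * a ^ n = of_real t * e ^ n" using a0 z0 by (simp add: power_mult_distrib zn mult.commute)
  then have an: "a ^ n = e ^ n" using T by simp
  have s1: "?s (hpt \<i> 1) = hpt (- \<i> * a) e" using s[of \<i> 1] by (simp add: mult.commute)
  have ae0: "a \<noteq> 0 \<or> e \<noteq> 0" using a0 by simp
  have en: "e ^ n \<noteq> 0" "e ^ m \<noteq> 0" "a ^ m \<noteq> 0" using a0 by auto
  have sone: "?s (hpt 1 1) = hpt a e" using s[of 1 1] by simp
  show False
  proof (cases sw)
    case False
    then have m': "m = n + 1" using m(2) by simp
    have "?f (hpt 1 1) = hpt (\<i> * (1 - of_real t)) (1 + of_real t)"
      using perturbed_power_hpt[OF n, of 1 1 sw m t] False by simp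
    then have "?s (?f (hpt 1 1)) = hpt (a * (- \<i> * (1 - of_real t))) (e * (1 + of_real t))"
      using T by (simp add: s)
    moreover have "?f (?s (hpt 1 1)) = hpt (\<i> * (a ^ m * (a ^ n - of_real t * e ^ n))) (e ^ m * (e ^ n + of_real t * a ^ n))"
      unfolding sone using perturbed_power_hpt[OF n ae0, of sw m t] False by simp
    ultimately have "hpt (\<i> * (a ^ m * (a ^ n - of_real t * e ^ n))) (e ^ m * (e ^ n + of_real t * a ^ n))
        = hpt (a * (- \<i> * (1 - of_real t))) (e * (1 + of_real t))" unfolding comm by simp
    moreover have "e ^ m * (e ^ n + of_real t * a ^ n) = e ^ m * e ^ n * (1 + of_real t)" unfolding an by (simp add: algebra_simps)
    moreover have "\<i> * (a ^ m * (a ^ n - of_real t * e ^ n)) = \<i> * a ^ m * e ^ n * (1 - of_real t)" unfolding an by (simp add: algebra_simps)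
    ultimately have "\<i> * a ^ m * e ^ n * (1 - of_real t) * (e * (1 + of_real t)) = a * (- \<i> * (1 - of_real t)) * (e ^ m * e ^ n * (1 + of_real t))"
      using a0 en T by (subst (asm) hpt_eq_iff) auto
    then have "(\<i> * e ^ n * (1 - of_real t) * (1 + of_real t)) * (a ^ m * e + a * e ^ m) = 0" by (simp add: algebra_simps)
    then have "a ^ m * e + a * e ^ m = 0" using a0 en T by simp
    moreover have "a ^ m * e + a * e ^ m = 2 * (a * e * e ^ n)" unfolding m' by (simp add: power_add an)
    ultimately show False using a0 en by simp
  next
    case True
    then have m': "n = m + 1" using m(2) by simp
    have "?f (hpt 1 1) = hpt (\<i> * (1 + of_real t)) (1 - of_real t)"
      using perturbed_power_hpt[OF n, of 1 1 sw m t] True by simp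
    then have "?s (?f (hpt 1 1)) = hpt (a * (- \<i> * (1 + of_real t))) (e * (1 - of_real t))"
      using T by (simp add: s)
    moreover have "?f (?s (hpt 1 1)) = hpt (\<i> * (e ^ m * (e ^ n + of_real t * a ^ n))) (a ^ m * (a ^ n - of_real t * e ^ n))"
      unfolding sone using perturbed_power_hpt[OF n ae0, of sw m t] True by simp
    ultimately have "hpt (\<i> * (e ^ m * (e ^ n + of_real t * a ^ n))) (a ^ m * (a ^ n - of_real t * e ^ n))
        = hpt (a * (- \<i> * (1 + of_real t))) (e * (1 - of_real t))" unfolding comm by simp
    moreover have "\<i> * (e ^ m * (e ^ n + of_real t * a ^ n)) = \<i> * e ^ m * e ^ n * (1 + of_real t)" unfolding an by (simp add: algebra_simps)
    moreover have "a ^ m * (a ^ n - of_real t * e ^ n) = a ^ m * e ^ n * (1 - of_real t)" unfolding an by (simp add: algebra_simps)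
    ultimately have "\<i> * e ^ m * e ^ n * (1 + of_real t) * (e * (1 - of_real t)) = a * (- \<i> * (1 + of_real t)) * (a ^ m * e ^ n * (1 - of_real t))"
      using a0 en T by (subst (asm) hpt_eq_iff) auto
    then have "(\<i> * e ^ n * (1 - of_real t) * (1 + of_real t)) * (e ^ m * e + a * a ^ m) = 0" by (simp add: algebra_simps)
    then have "e ^ m * e + a * a ^ m = 0" using a0 en T by simp
    moreover have "e ^ m * e + a * a ^ m = 2 * e ^ n" using an unfolding m' by (simp add: power_add mult.commute)
    ultimately show False using en by simp
  qed
qed

text \<open>The map \<open>z \<mapsto> b / (c * cnj z)\<close> sends the zeros with \<open>z ^ n = t\<close> to the poles with
  \<open>z ^ n = - 1 / t\<close>, so \<open>(b / c) ^ n = - 1\<close>. A fixed point makes \<open>b / c\<close> a nonnegative real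
  number, which is absurd.\<close>

lemma no_antidiagonal_reflection:
  assumes n: "n \<ge> 1" and m: "m \<ge> 1" and t: "0 < t" "t \<le> 1 / 4"
    and bc: "b * c \<noteq> 0" and fixp: "(mob 0 b c 0 \<circ> J) p = p"
  shows "(mob 0 b c 0 \<circ> J) \<circ> perturbed_power sw n m t \<noteq> perturbed_power sw n m t \<circ> (mob 0 b c 0 \<circ> J)"
proof
  let ?f = "perturbed_power sw n m t" and ?s = "mob 0 b c 0 \<circ> J"
  assume h: "?s \<circ> ?f = ?f \<circ> ?s"
  have comm: "?f (?s p) = ?s (?f p)" for p using fun_cong[OF h, of p] by simp
  have b0: "b \<noteq> 0" "c \<noteq> 0" using bc by auto
  have i0: "hpt a 0 = hpt 1 0" if "a \<noteq> 0" for a :: complex using that by (simp add: hpt_def)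
  have o0: "hpt 0 a = hpt 0 1" if "a \<noteq> 0" for a :: complex using that by (simp add: hpt_def)
  have s: "mob 0 b c 0 (J (hpt x y)) = hpt (b * cnj y) (c * cnj x)" if "x \<noteq> 0 \<or> y \<noteq> 0" for x y
    using that by (simp add: J_hpt mob_hpt)
  have s0: "?s (hpt 0 1) = hpt 1 0" using s[of 0 1] i0[OF b0(1)] by simp
  have si: "?s (hpt 1 0) = hpt 0 1" using s[of 1 0] o0[OF b0(2)] by simp
  \<comment> \<open>A real zero of the factor \<open>z ^ n - t\<close>.\<close>
  define z where "z = complex_of_real (root n t)"
  have zn: "z ^ n = of_real t" using n t(1) by (simp add: z_def flip: of_real_power)
  have cz: "cnj z = z" and z0: "z \<noteq> 0" using n t(1) by (simp_all add: z_def)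
  have F0: "z ^ m * (z ^ n - of_real t * 1 ^ n) = 0" by (simp add: zn)
  have G0: "1 ^ m * (1 ^ n + of_real t * z ^ n) \<noteq> 0" using perturbed_power_nonzero[OF n, of z 1 m t] z0 F0 by simp
  have bcz: "b \<noteq> 0 \<or> c * z \<noteq> 0" using b0 by simp
  have "(c * z) ^ m * ((c * z) ^ n + of_real t * b ^ n) = 0"
  proof (cases sw)
    case False
    have "?f (hpt z 1) = hpt 0 1" using perturbed_power_hpt[OF n, of z 1 sw m t] z0 False F0 G0 by (simp add: hpt_def)
    then have "?f (?s (hpt z 1)) = hpt 1 0" by (simp only: comm s0 si)
    then have "?f (hpt b (c * z)) = hpt 1 0" using z0 by (simp add: s cz)
    then have "hpt (\<i> * (b ^ m * (b ^ n - of_real t * (c * z) ^ n))) ((c * z) ^ m * ((c * z) ^ n + of_real t * b ^ n)) = hpt 1 0"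
      using perturbed_power_hpt[OF n bcz, of sw m t] False by simp
    then show ?thesis by (auto simp: hpt_def split: if_splits)
  next
    case True
    have "?f (hpt z 1) = hpt 1 0" using perturbed_power_hpt[OF n, of z 1 sw m t] z0 True F0 G0 by (simp add: hpt_def)
    then have "?f (?s (hpt z 1)) = hpt 0 1" by (simp only: comm s0 si)
    then have "?f (hpt b (c * z)) = hpt 0 1" using z0 by (simp add: s cz)
    then have "hpt (\<i> * ((c * z) ^ m * ((c * z) ^ n + of_real t * b ^ n))) (b ^ m * (b ^ n - of_real t * (c * z) ^ n)) = hpt 0 1"
      using perturbed_power_hpt[OF n bcz, of sw m t] True by simp
    then show ?thesis by (auto simp: hpt_def split: if_splits)
  qed
  then have "(c * z) ^ n + of_real t * b ^ n = 0" using b0 z0 by simp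
  then have "of_real t * (c ^ n + b ^ n) = 0" by (simp add: power_mult_distrib zn algebra_simps)
  then have cb: "c ^ n + b ^ n = 0" using t(1) by simp
  obtain x y where xy: "p = hpt x y" "x \<noteq> 0 \<or> y \<noteq> 0" by (rule hpt_cases)
  have "hpt (b * cnj y) (c * cnj x) = hpt x y" using fixp s[OF xy(2)] xy(1) by simp
  then have "b * cnj y * y = x * (c * cnj x)" using xy(2) b0 by (subst (asm) hpt_eq_iff) auto
  then have "b * (y * cnj y) = c * (x * cnj x)" by (simp add: mult_ac)
  then have eq: "b * of_real ((norm y)\<^sup>2) = c * of_real ((norm x)\<^sup>2)" by (simp only: complex_norm_square)
  then have y0: "y \<noteq> 0" using b0 xy(2) by auto
  \<comment> \<open>The squared modulus of the fixed point.\<close>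
  define \<rho> where "\<rho> = (norm x)\<^sup>2 / (norm y)\<^sup>2"
  have b: "b = c * of_real \<rho>" using eq y0 by (simp add: \<rho>_def field_simps)
  have "c ^ n * of_real (1 + \<rho> ^ n) = 0" using cb unfolding b by (simp add: power_mult_distrib algebra_simps)
  then have "complex_of_real (1 + \<rho> ^ n) = 0" using b0 by simp
  then have "1 + \<rho> ^ n = 0" by (simp only: of_real_eq_0_iff)
  moreover have "\<rho> ^ n \<ge> 0" by (simp add: \<rho>_def)
  ultimately show False by simp
qed

text \<open>Otherwise the left side would vanish on a single line only, while the right side is
  invariant under multiplying \<open>x\<close> by a root of unity of order \<open>d\<close>.\<close>

lemma power_of_linear_form:
  fixes a b \<alpha> \<beta> :: complex
  assumes d: "d \<ge> 2" and eq: "\<And>x y. (a * x + b * y) ^ d = \<alpha> * x ^ d + \<beta> * y ^ d"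
  shows "a * b = 0"
proof -
  have "card {z::complex. z ^ d = 1} = d" using d by (intro card_roots_unity_eq) simp
  then have "\<not> {z::complex. z ^ d = 1} \<subseteq> {1}" using d card_mono[of "{1::complex}" "{z. z ^ d = 1}"] by auto
  then obtain \<zeta> :: complex where z: "\<zeta> ^ d = 1" "\<zeta> \<noteq> 1" by auto
  have "(- b * \<zeta>) ^ d = (- b) ^ d" by (simp only: power_mult_distrib z(1) mult_1_right)
  then have "(a * (- b * \<zeta>) + b * a) ^ d = (a * (- b) + b * a) ^ d" unfolding eq by (simp only:)
  also have "\<dots> = 0" using d by simp
  finally have "a * (- b * \<zeta>) + b * a = 0" using d by simp
  then have "a * b * (1 - \<zeta>) = 0" by (simp add: algebra_simps)
  then show ?thesis using z(2) by simp
qed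

text \<open>An antiholomorphic automorphism of \<open>\<i> * z ^ d\<close> or \<open>\<i> / z ^ d\<close> preserves the set of its
  critical points, \<open>0\<close> and \<open>\<infinity>\<close>; in terms of forms, the power of a linear form is again a sum of
  two powers.\<close>

lemma power_map_anti_automorphism:
  assumes n: "n \<ge> 1" and d: "m + n \<ge> 2" and det: "a * e - b * c = 1"
    and comm: "(mob a b c e \<circ> J) \<circ> perturbed_power sw n m 0 = perturbed_power sw n m 0 \<circ> (mob a b c e \<circ> J)"
  shows "(b = 0 \<and> c = 0) \<or> (a = 0 \<and> e = 0)"
proof -
  let ?d = "m + n" and ?P = "orb_num sw \<i> n m [of_real 0]" and ?Q = "orb_den sw n m [of_real 0]"
  note nd = nondeg_perturbed[OF n, of m sw 0]
  have "quotient_fun ?d ?P ?Q \<circ> mob a b c e = mob a b c e \<circ> quotient_fun ?d (cpoly ?P) (cpoly ?Q)"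
    using comm unfolding perturbed_power_def J_quotient_fun[OF nd, symmetric] anti_commutes_iff .
  moreover have "?d \<ge> 1" "a * e - b * c \<noteq> 0" using d det by auto
  ultimately obtain \<mu> where \<mu>:
    "\<And>x y. hform ?d ?P (a * x + b * y) (c * x + e * y) = \<mu> * (a * hform ?d (cpoly ?P) x y + b * hform ?d (cpoly ?Q) x y)"
    "\<And>x y. hform ?d ?Q (a * x + b * y) (c * x + e * y) = \<mu> * (c * hform ?d (cpoly ?P) x y + e * hform ?d (cpoly ?Q) x y)"
    using equivariance_factor[OF nd nondeg_cpoly[OF nd]] by metis
  have h: "hform ?d ?P x y = \<i> * (if sw then y ^ ?d else x ^ ?d)" "hform ?d ?Q x y = (if sw then x ^ ?d else y ^ ?d)" for x y
    unfolding hform_perturbed by (simp_all add: power_add)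
  have hc: "hform ?d (cpoly ?P) x y = - \<i> * (if sw then y ^ ?d else x ^ ?d)" "hform ?d (cpoly ?Q) x y = (if sw then x ^ ?d else y ^ ?d)" for x y
    unfolding hform_cpoly h by simp_all
  have "a * b = 0 \<and> c * e = 0"
  proof (cases sw)
    case False
    have "(a * x + b * y) ^ ?d = (- \<mu> * a) * x ^ ?d + (- \<i> * \<mu> * b) * y ^ ?d" for x y
    proof -
      have "\<i> * (a * x + b * y) ^ ?d = \<mu> * (a * (- \<i> * x ^ ?d) + b * y ^ ?d)" using \<mu>(1)[of x y] unfolding h hc using False by simp
      then have "- \<i> * (\<i> * (a * x + b * y) ^ ?d) = - \<i> * (\<mu> * (a * (- \<i> * x ^ ?d) + b * y ^ ?d))" by (simp only:)
      moreover have "- \<i> * (\<i> * (a * x + b * y) ^ ?d) = (a * x + b * y) ^ ?d" by (simp flip: mult.assoc)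
      moreover have "- \<i> * (\<mu> * (a * (- \<i> * x ^ ?d) + b * y ^ ?d)) = (- \<mu> * a) * x ^ ?d + (- \<i> * \<mu> * b) * y ^ ?d" by (simp add: algebra_simps)
      ultimately show ?thesis by (simp only:)
    qed
    moreover have "(c * x + e * y) ^ ?d = (- \<i> * \<mu> * c) * x ^ ?d + (\<mu> * e) * y ^ ?d" for x y
      using \<mu>(2)[of x y] unfolding h hc using False by (simp add: algebra_simps)
    ultimately show ?thesis using power_of_linear_form[OF d] by blast
  next
    case True
    have "(c * x + e * y) ^ ?d = (- \<i> * \<mu> * b) * x ^ ?d + (- \<mu> * a) * y ^ ?d" for x y
    proof -
      have "\<i> * (c * x + e * y) ^ ?d = \<mu> * (a * (- \<i> * y ^ ?d) + b * x ^ ?d)" using \<mu>(1)[of x y] unfolding h hc using True by simp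
      then have "- \<i> * (\<i> * (c * x + e * y) ^ ?d) = - \<i> * (\<mu> * (a * (- \<i> * y ^ ?d) + b * x ^ ?d))" by (simp only:)
      moreover have "- \<i> * (\<i> * (c * x + e * y) ^ ?d) = (c * x + e * y) ^ ?d" by (simp flip: mult.assoc)
      moreover have "- \<i> * (\<mu> * (a * (- \<i> * y ^ ?d) + b * x ^ ?d)) = (- \<i> * \<mu> * b) * x ^ ?d + (- \<mu> * a) * y ^ ?d" by (simp add: algebra_simps)
      ultimately show ?thesis by (simp only:)
    qed
    moreover have "(a * x + b * y) ^ ?d = (\<mu> * e) * x ^ ?d + (- \<i> * \<mu> * c) * y ^ ?d" for x y
      using \<mu>(2)[of x y] unfolding h hc using True by (simp add: algebra_simps)
    ultimately show ?thesis using power_of_linear_form[OF d] by blast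
  qed
  then show ?thesis using det by auto
qed

text \<open>Otherwise the reflections for \<open>t \<rightarrow> 0\<close> subconverge to an antiholomorphic automorphism of the
  power map, which preserves \<open>{0, \<infinity>}\<close>.\<close>

lemma perturbed_power_no_reflection:
  assumes n: "n \<ge> 1" and m: "m \<ge> 1" "if sw then m + 1 = n else m = n + 1"
  shows "\<exists>t>0. t \<le> 1 / 4 \<and> \<not> has_reflection (perturbed_power sw n m t)"
proof (rule ccontr)
  assume "\<not> ?thesis"
  then have refl: "has_reflection (perturbed_power sw n m t)" if "0 < t" "t \<le> 1 / 4" for t using that by blast
  have d: "m + n \<ge> 2" using n m(1) by simp
  \<comment> \<open>Starting at \<open>1 / 4\<close>, as required by \<open>attracting_estimate\<close>.\<close>
  define t :: "nat \<Rightarrow> real" where "t k = 1 / real (k + 4)" for k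
  have t: "0 < t k" "t k \<le> 1 / 4" for k by (simp_all add: t_def field_simps)
  have t_lim: "t \<longlonglongrightarrow> 0" unfolding t_def using LIMSEQ_ignore_initial_segment[OF lim_1_over_n, of 4] by simp
  have "\<exists>a b c e p. a * e - b * c = 1 \<and> (mob a b c e \<circ> J) p = p \<and>
      (mob a b c e \<circ> J) \<circ> perturbed_power sw n m (t k) = perturbed_power sw n m (t k) \<circ> (mob a b c e \<circ> J)" for k
  proof -
    obtain Q p where Q: "Q \<in> extended_moebius" "Q p = p" "Q \<circ> perturbed_power sw n m (t k) = perturbed_power sw n m (t k) \<circ> Q"
      using refl[OF t] unfolding has_reflection_def reflection_def by blast
    obtain a b c e where q: "a * e - b * c = 1" "Q = mob a b c e \<circ> J" using Q(1) unfolding extended_moebius_iff by blast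
    show ?thesis using q(1) Q(2,3) unfolding q(2) by blast
  qed
  then obtain a b c e p where det: "\<And>k. a k * e k - b k * c k = 1"
    and fixp: "\<And>k. (mob (a k) (b k) (c k) (e k) \<circ> J) (p k) = p k"
    and comm: "\<And>k. (mob (a k) (b k) (c k) (e k) \<circ> J) \<circ> perturbed_power sw n m (t k) = perturbed_power sw n m (t k) \<circ> (mob (a k) (b k) (c k) (e k) \<circ> J)"
    by metis
  have cont: "cont_poly UNIV (\<lambda>s. orb_num sw \<i> n m [complex_of_real s])" "cont_poly UNIV (\<lambda>s. orb_den sw n m [complex_of_real s])"
    unfolding orb_num_def orb_den_def orb_poly_def coorb_poly_def list.map prod_list.Cons
    by (cases sw; simp only: if_True if_False; intro cont_poly_intros continuous_intros)+
  have limc: "(\<lambda>k. f (t k)) \<longlonglongrightarrow> f 0" if "continuous_on UNIV f" for f :: "real \<Rightarrow> complex"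
    using continuous_on_tendsto_compose[OF that t_lim] by simp
  have lim: "(\<lambda>k. coeff (orb_num sw \<i> n m [complex_of_real (t k)]) i) \<longlonglongrightarrow> coeff (orb_num sw \<i> n m [complex_of_real 0]) i"
    "(\<lambda>k. coeff (orb_den sw n m [complex_of_real (t k)]) i) \<longlonglongrightarrow> coeff (orb_den sw n m [complex_of_real 0]) i" for i
    by (rule limc[of "\<lambda>s. coeff (orb_num sw \<i> n m [complex_of_real s]) i"], use cont(1) in \<open>simp add: cont_poly_def\<close>)
      (rule limc[of "\<lambda>s. coeff (orb_den sw n m [complex_of_real s]) i"], use cont(2) in \<open>simp add: cont_poly_def\<close>)
  obtain r a' b' c' e' where *: "strict_mono (r :: nat \<Rightarrow> nat)" "(a \<circ> r) \<longlonglongrightarrow> a'" "(b \<circ> r) \<longlonglongrightarrow> b'"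
    "(c \<circ> r) \<longlonglongrightarrow> c'" "(e \<circ> r) \<longlonglongrightarrow> e'" "a' * e' - b' * c' = 1"
    "(mob a' b' c' e' \<circ> J) \<circ> perturbed_power sw n m 0 = perturbed_power sw n m 0 \<circ> (mob a' b' c' e' \<circ> J)"
    unfolding perturbed_power_def
    by (rule commuting_anti_maps_converge[OF d nondeg_perturbed[OF n] nondeg_perturbed[OF n] lim det comm[unfolded perturbed_power_def]])
  \<comment> \<open>The images of \<open>0\<close> and \<open>\<infinity>\<close> are periodic, so they stay at \<open>0\<close> and \<open>\<infinity>\<close> once they are close to them.\<close>
  have per: "perturbed_power sw n m (t k) (perturbed_power sw n m (t k) (hpt (b k) (e k))) = hpt (b k) (e k)"
    "perturbed_power sw n m (t k) (perturbed_power sw n m (t k) (hpt (a k) (c k))) = hpt (a k) (c k)" for k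
  proof -
    let ?f = "perturbed_power sw n m (t k)" and ?s = "mob (a k) (b k) (c k) (e k) \<circ> J"
    have cs: "?f (?s x) = ?s (?f x)" for x using fun_cong[OF comm[of k], of x] by simp
    have s: "?s (hpt 0 1) = hpt (b k) (e k)" "?s (hpt 1 0) = hpt (a k) (c k)" by (simp_all add: J_hpt mob_hpt)
    show "?f (?f (hpt (b k) (e k))) = hpt (b k) (e k)" "?f (?f (hpt (a k) (c k))) = hpt (a k) (c k)"
      unfolding s[symmetric] cs using zero_infinity_periodic[OF n m(1), of sw "t k"] by simp_all
  qed
  have nz: "b k \<noteq> 0 \<or> e k \<noteq> 0" "a k \<noteq> 0 \<or> c k \<noteq> 0" for k using det[of k] by auto
  have abs_t: "\<bar>t k\<bar> \<le> 1 / 4" for k using t[of k] by simp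
  have small: "eventually (\<lambda>k. 2 * norm (f k) \<le> norm (g k)) sequentially"
    if "f \<longlonglongrightarrow> 0" "g \<longlonglongrightarrow> g'" "g' \<noteq> 0" for f g :: "nat \<Rightarrow> complex" and g'
  proof -
    have "(\<lambda>k. norm (g k) - 2 * norm (f k)) \<longlonglongrightarrow> norm g' - 2 * norm (0 :: complex)" by (intro tendsto_intros that)
    moreover have "0 < norm g' - 2 * norm (0 :: complex)" using that(3) by simp
    ultimately have "eventually (\<lambda>k. 0 < norm (g k) - 2 * norm (f k)) sequentially" by (rule order_tendstoD)
    then show ?thesis by (rule eventually_mono) simp
  qed
  from power_map_anti_automorphism[OF n d *(6,7)] show False
  proof
    assume 0: "b' = 0 \<and> c' = 0"
    then have ae: "a' \<noteq> 0" "e' \<noteq> 0" using *(6) by auto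
    have "eventually (\<lambda>k. 2 * norm ((b \<circ> r) k) \<le> norm ((e \<circ> r) k) \<and> 2 * norm ((c \<circ> r) k) \<le> norm ((a \<circ> r) k)) sequentially"
      using small[of "b \<circ> r" "e \<circ> r" e'] small[of "c \<circ> r" "a \<circ> r" a'] * 0 ae by (intro eventually_conj) simp_all
    then obtain j where j: "2 * norm (b (r j)) \<le> norm (e (r j))" "2 * norm (c (r j)) \<le> norm (a (r j))"
      by (auto simp: eventually_sequentially)
    let ?k = "r j"
    have "b ?k = 0" by (rule periodic_near_zero[OF n m(1) abs_t nz(1) j(1) per(1)])
    moreover have "c ?k = 0" by (rule periodic_near_infinity[OF n m abs_t nz(2) j(2) per(2)])
    moreover from calculation have "a ?k * e ?k \<noteq> 0" using det[of ?k] by simp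
    ultimately show False using no_diagonal_anti_automorphism[OF n m t, of "a ?k" "e ?k"] comm[of ?k] by simp
  next
    assume 0: "a' = 0 \<and> e' = 0"
    then have bc: "b' \<noteq> 0" "c' \<noteq> 0" using *(6) by auto
    have "eventually (\<lambda>k. 2 * norm ((e \<circ> r) k) \<le> norm ((b \<circ> r) k) \<and> 2 * norm ((a \<circ> r) k) \<le> norm ((c \<circ> r) k)) sequentially"
      using small[of "e \<circ> r" "b \<circ> r" b'] small[of "a \<circ> r" "c \<circ> r" c'] * 0 bc by (intro eventually_conj) simp_all
    then obtain j where j: "2 * norm (e (r j)) \<le> norm (b (r j))" "2 * norm (a (r j)) \<le> norm (c (r j))"
      by (auto simp: eventually_sequentially)
    let ?k = "r j"
    have "e ?k = 0" by (rule periodic_near_infinity[OF n m abs_t nz(1) j(1) per(1)])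
    moreover have "a ?k = 0" by (rule periodic_near_zero[OF n m(1) abs_t nz(2) j(2) per(2)])
    moreover from calculation have "b ?k * c ?k \<noteq> 0" using det[of ?k] by auto
    ultimately show False
      using no_antidiagonal_reflection[OF n m(1) t, of "b ?k" "c ?k" "p ?k"] fixp[of ?k] comm[of ?k] by simp
  qed
qed

lemma pseudo_real_examples:
  assumes n: "n \<ge> 1" and m: "m \<ge> 1" "if sw then m + 1 = n else m = n + 1"
  shows "\<exists>\<phi>. is_rat (m + n) \<phi> \<and> pseudo_real \<phi> \<and> (if odd n then has_anti_involution \<phi> else has_half_turn \<phi>)"
proof -
  obtain t where t: "\<not> has_reflection (perturbed_power sw n m t)"
    using perturbed_power_no_reflection[OF assms] by blast
  obtain c where c: "norm c = 1" "c ^ n = - 1" "antirot c \<circ> perturbed_power sw n m t = perturbed_power sw n m t \<circ> antirot c"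
    using perturbed_power_commutes[OF n m(2)] by metis
  have "is_rat (m + n) (perturbed_power sw n m t)"
    unfolding perturbed_power_def by (rule is_ratI[OF nondeg_perturbed[OF n]])
  moreover have "pseudo_real (perturbed_power sw n m t)"
    using t c(3) antirot_extended[OF c(1)] unfolding pseudo_real_iff by blast
  ultimately show ?thesis using commuting_antirot_parity[OF c(1,3,2)] by blast
qed

text \<open>The classes with an antiholomorphic involution and those with a half turn are closed, cover
  the locus, are disjoint on it, and both meet it. For \<open>d = 2 * k + 1\<close> the examples with \<open>n = k\<close>
  and with \<open>n = k + 1\<close> have different parity, so they lie in different parts.\<close>

lemma pseudo_real_locus_disconnected:
  assumes d: "d \<ge> 3" "odd d"
  shows "\<not> connectedin (moduli_space d) (pseudo_real_locus d)"
proof -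
  have d2: "d \<ge> 2" and d1: "d \<ge> 1" using d by auto
  let ?E1 = "{orbit \<phi> | \<phi>. is_rat d \<phi> \<and> has_anti_involution \<phi>}" and ?E2 = "{orbit \<phi> | \<phi>. is_rat d \<phi> \<and> has_half_turn \<phi>}"
  have locus: "pseudo_real_locus d = {orbit \<phi> | \<phi>. is_rat d \<phi> \<and> pseudo_real \<phi>}"
    by (simp add: pseudo_real_locus_def topspace_Rat[OF d1])
  have cover: "pseudo_real_locus d \<subseteq> ?E1 \<union> ?E2"
  proof
    fix C assume "C \<in> pseudo_real_locus d"
    then obtain \<phi> where "C = orbit \<phi>" "is_rat d \<phi>" "pseudo_real \<phi>" unfolding locus by blast
    then obtain \<psi> where psi: "is_rat d \<psi>" "C = orbit \<psi>" "has_anti_involution \<psi> \<or> has_half_turn \<psi>"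
      using pseudo_real_cover[OF d2, of \<phi>] by metis
    then show "C \<in> ?E1 \<union> ?E2" by (elim disjE) blast+
  qed
  have disj: "?E1 \<inter> ?E2 \<inter> pseudo_real_locus d = {}"
  proof (rule ccontr)
    assume "?E1 \<inter> ?E2 \<inter> pseudo_real_locus d \<noteq> {}"
    then obtain C where C: "C \<in> ?E1" "C \<in> ?E2" "C \<in> pseudo_real_locus d" by blast
    obtain \<phi> where phi: "is_rat d \<phi>" "pseudo_real \<phi>" "C = orbit \<phi>" using C(3) unfolding locus by blast
    obtain \<psi>1 where psi1: "has_anti_involution \<psi>1" "orbit \<psi>1 = orbit \<phi>" using C(1) phi(3) by auto
    obtain \<psi>2 where psi2: "has_half_turn \<psi>2" "orbit \<psi>2 = orbit \<phi>" using C(2) phi(3) by auto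
    have "has_anti_involution \<phi>" using orbit_eqD[OF psi1(2)] has_anti_involution_conj psi1(1) by blast
    moreover have "has_half_turn \<phi>" using orbit_eqD[OF psi2(2)] has_half_turn_conj psi2(1) by blast
    ultimately show False
      using anti_involution_half_turn_reflection[OF d2 phi(1)] phi(2) unfolding pseudo_real_iff by blast
  qed
  obtain k where k: "d = 2 * k + 1" using d(2) by (rule oddE)
  have k1: "k \<ge> 1" using d(1) k by simp
  have e: "k + 1 + k = d" "k + (k + 1) = d" using k by simp_all
  have "\<exists>\<phi>. is_rat (k + 1 + k) \<phi> \<and> pseudo_real \<phi> \<and> (if odd k then has_anti_involution \<phi> else has_half_turn \<phi>)"
    by (rule pseudo_real_examples[of k "k + 1" False]) (use k1 in auto)
  moreover have "\<exists>\<phi>. is_rat (k + (k + 1)) \<phi> \<and> pseudo_real \<phi> \<and> (if odd (k + 1) then has_anti_involution \<phi> else has_half_turn \<phi>)"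
    by (rule pseudo_real_examples[of "k + 1" k True]) (use k1 in auto)
  ultimately obtain \<phi> \<psi> where "is_rat d \<phi>" "pseudo_real \<phi>" "has_anti_involution \<phi>" "is_rat d \<psi>" "pseudo_real \<psi>" "has_half_turn \<psi>"
    unfolding e by (cases "odd k") auto
  then have "?E1 \<inter> pseudo_real_locus d \<noteq> {}" "?E2 \<inter> pseudo_real_locus d \<noteq> {}" unfolding locus by blast+
  then show ?thesis
    using closed_anti_involution[OF d2] closed_half_turn[OF d2] cover disj unfolding connectedin_closedin by blast
qed

theorem mainTheorem1:
  fixes d :: nat
  assumes "d \<ge> 2"
  shows "connectedin (moduli_space d) (real_points d) \<and>
    (d \<ge> 3 \<and> odd d \<longrightarrow> \<not> connectedin (moduli_space d) (pseudo_real_locus d))"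
  using real_points_connected[OF assms] pseudo_real_locus_disconnected by blast

end
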